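(* For integers $n\ge 2$ let \[ F_n^{\rm sq}=\sum_{\substack{0\le j,k\le n-1\\ (j,k)\neq(0,0)}}\frac{1}{1-\frac12\left(\cos\frac{2\pi j}{n}+\cos\frac{2\pi k}{n}\right)} . \] Then, as $n\to\infty$, \[ F_n^{\rm sq}=\frac{2}{\pi}n^2\log n+\frac{2}{\pi}\left(\gamma+\log\left(\frac{4\sqrt{2\pi}}{\Gamma(\frac14)^2}\right)\right)n^2+\mathcal{O}(1). \]
   Context: Here $\gamma$ is Euler's constant, $\Gamma$ is the Gamma function and $\log$ is the natural logarithm. *)

theory Defs
  imports "HOL-Analysis.Analysis" "HOL-Library.Landau_Symbols"
begin

definition F_sq :: "nat \<Rightarrow> real" where
  "F_sq n = (\<Sum>(j, k) \<in> ({..<n} \<times> {..<n}) - {(0, 0)}.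
     1 / (1 - (1 / 2) * (cos (2 * pi * real j / real n) + cos (2 * pi * real k / real n))))"

end

theory Submission
  imports Defs "HOL-Probability.Distributions" "HOL-Real_Asymp.Real_Asymp"
begin

text \<open>
  For a fixed row j > 0 the inner sum over k is a Poisson kernel summed over the n-th roots of
  unity and therefore elementary: if sinh b = sin (pi j / n), it equals
  n coth (n b) / (sinh b cosh b). The row j = 0 contributes (n^2 - 1) / 3. Writing
  coth (n b) = 1 + 2 / (exp (2 n b) - 1) splits the other rows into an algebraic and an
  exponentially small part (F_sq_decomposition).

  The algebraic part is n times an equidistant sum of 1 / (sin x sqrt (1 + (sin x)^2)). Its
  simple poles at 0 and pi produce harmonic numbers, hence the logarithm and Euler's constant; what
  remains is smooth, and the trapezoidal rule replaces it by its integral. The outcome is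
  (2 / pi) n^2 (ln n + gamma + ln (sqrt 2 / pi)) + O(1) (sum_row_weight_asymptotics).

  The exponentially small part lives near the two ends of the range of j, where b is close to
  pi j / n. It equals (4 / pi) n^2 S + O(1) with S the sum of 1 / (j (exp (2 pi j) - 1)) over j > 0
  (sum_coth_excess_asymptotics), and S = - ln E, where E is the product of all
  1 - exp (- 2 pi m) with m > 0 (ln_euler_product_series).

  The number E is the Dedekind eta function at i up to the factor exp (pi / 12), and its value is
  the arithmetic core. Jacobi's triple product expresses E^3 by theta constants with nome
  exp (- pi). The squares of theta3 and theta4 perform a step of the arithmetic-geometric mean when
  the nome is squared, and up to a factor 2 the squares of theta3 and theta2 do so when its square
  root is taken. Gauss's elliptic integral is invariant under such steps, and following them to nome
  0 and nome 1 evaluates it for both pairs. At nome exp (- pi) the two values agree, so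
  theta2 = theta4; the integral is then lemniscatic, that is, a Beta value, and
  theta3^2 = Gamma (1/4)^2 / (2 pi^(3/2)) (theta_at_pi, euler_product_2pi). The factor
  exp (pi / 12) of E finally cancels the contribution n^2 / 3 of the row j = 0.
\<close>

section \<open>Row sums over a cycle\<close>

text \<open>
  Since (r w)^n = r^n for every n-th root of unity w, each summand is a finite geometric sum in r w
  divided by 1 - r^n; summation over the roots of unity kills every power but the zeroth.
\<close>
lemma sum_inverse_one_minus_roots_of_unity:
  fixes r :: real
  assumes n: "n > 0" and r: "0 \<le> r" "r < 1"
  shows "(\<Sum>k<n. 1 / (1 - of_real r * cis (2 * pi * real k / real n))) = of_real (real n / (1 - r ^ n))"
proof -
  define w where "w = (\<lambda>k::nat. cis (2 * pi * real k / real n))"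
  have rn: "r ^ n < 1" using n r power_less_one_iff[of r n] by auto
  have wn: "w k ^ n = 1" for k
  proof -
    have "w k ^ n = cis (real n * (2 * pi * real k / real n))" unfolding w_def by (rule Complex.DeMoivre)
    also have "real n * (2 * pi * real k / real n) = 2 * pi * real k" using n by simp
    also have "cis \<dots> = 1" by (rule cis_multiple_2pi) simp
    finally show ?thesis .
  qed
  have orth: "(\<Sum>k<n. w k ^ m) = (if m = 0 then of_nat n else 0)" if "m < n" for m
  proof (cases "m = 0")
    case False
    have eq: "w k ^ m = w m ^ k" for k by (simp add: w_def Complex.DeMoivre algebra_simps)
    have "w m \<noteq> 1"
    proof
      assume "w m = 1"
      then have "exp (2 * of_real pi * \<i> * of_nat m / of_nat n) = 1"
        by (simp add: w_def cis_conv_exp algebra_simps)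
      then have "n dvd m" using n by (subst (asm) complex_root_unity_eq_1) auto
      with False that show False by (auto dest: dvd_imp_le)
    qed
    moreover have "1 - w m ^ n = (1 - w m) * (\<Sum>k<n. w m ^ k)"
      by (rule one_diff_power_eq)
    ultimately show ?thesis using False wn by (simp add: eq)
  qed (simp add: w_def)
  have step: "1 / (1 - of_real r * w k) = (\<Sum>m<n. of_real (r ^ m) * w k ^ m) / of_real (1 - r ^ n)" for k
  proof -
    have "1 - (of_real r * w k) ^ n = (1 - of_real r * w k) * (\<Sum>m<n. (of_real r * w k) ^ m)"
      by (rule one_diff_power_eq)
    then have eq: "of_real (1 - r ^ n) = (1 - of_real r * w k) * (\<Sum>m<n. of_real (r ^ m) * w k ^ m)"
      by (simp add: power_mult_distrib wn)
    have "of_real (1 - r ^ n) \<noteq> (0 :: complex)" using rn by (simp only: of_real_eq_0_iff)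
    with eq have "1 / (1 - of_real r * w k) = (\<Sum>m<n. of_real (r ^ m) * w k ^ m)
        / ((1 - of_real r * w k) * (\<Sum>m<n. of_real (r ^ m) * w k ^ m))"
      by (metis (no_types, lifting) divide_divide_eq_left divide_self mult.commute mult_eq_0_iff)
    with eq show ?thesis by metis
  qed
  have "(\<Sum>k<n. 1 / (1 - of_real r * w k)) = (\<Sum>k<n. \<Sum>m<n. of_real (r ^ m) * w k ^ m) / of_real (1 - r ^ n)"
    unfolding step by (simp add: sum_divide_distrib)
  also have "(\<Sum>k<n. \<Sum>m<n. of_real (r ^ m) * w k ^ m) = (\<Sum>m<n. of_real (r ^ m) * (\<Sum>k<n. w k ^ m))"
    by (subst sum.swap) (simp add: sum_distrib_left)
  also have "\<dots> = (\<Sum>m<n. if m = 0 then of_nat n else 0)"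
    by (rule sum.cong) (auto simp: orth)
  also have "\<dots> = of_nat n" using n by (simp add: sum.delta)
  finally show ?thesis by (simp add: w_def)
qed

text \<open>
  The Poisson kernel is 2 Re (1 / (1 - r exp (i t))) - 1.
\<close>
lemma sum_poisson_kernel:
  fixes r :: real
  assumes n: "n > 0" and r: "0 \<le> r" "r < 1"
  shows "(\<Sum>k<n. (1 - r\<^sup>2) / (1 - 2 * r * cos (2 * pi * real k / real n) + r\<^sup>2)) = real n * (2 / (1 - r ^ n) - 1)"
proof -
  have Re: "(1 - r\<^sup>2) / (1 - 2 * r * cos t + r\<^sup>2) = 2 * Re (1 / (1 - of_real r * cis t)) - 1" for t
  proof -
    have D: "1 - 2 * r * cos t + r\<^sup>2 = (1 - r * cos t)\<^sup>2 + (r * sin t)\<^sup>2"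
      unfolding power_mult_distrib sin_squared_eq by (simp add: power2_eq_square algebra_simps)
    have "r * cos t \<le> r * 1" using r by (intro mult_left_mono) auto
    then have "0 < 1 - r * cos t" using r by linarith
    then have "0 < 1 - 2 * r * cos t + r\<^sup>2" unfolding D by (intro add_pos_nonneg) auto
    moreover have "Re (1 / (1 - of_real r * cis t)) = (1 - r * cos t) / (1 - 2 * r * cos t + r\<^sup>2)"
      unfolding D by (simp add: Re_divide)
    moreover have "(1 - r\<^sup>2) / D = 2 * ((1 - r * cos t) / D) - 1" if "D > 0" "D = 1 - 2 * r * cos t + r\<^sup>2" for D
      using that(1) by (simp add: field_simps) (simp add: that(2))
    ultimately show ?thesis by simp
  qed
  have "(\<Sum>k<n. (1 - r\<^sup>2) / (1 - 2 * r * cos (2 * pi * real k / real n) + r\<^sup>2))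
     = 2 * Re (\<Sum>k<n. 1 / (1 - of_real r * cis (2 * pi * real k / real n))) - real n"
    unfolding Re by (simp add: sum_subtractf sum_distrib_left)
  also have "\<dots> = 2 * (real n / (1 - r ^ n)) - real n"
    unfolding sum_inverse_one_minus_roots_of_unity[OF assms] by (simp only: Re_complex_of_real)
  finally show ?thesis by (simp add: algebra_simps)
qed

text \<open>
  For r = exp (- 2 b) the Poisson kernel is sinh (2 b) / (cosh (2 b) - cos t), and
  cosh (2 b) = 1 + 2 (sinh b)^2. The last factor is coth (n b), split into its limit and the
  exponentially small rest.
\<close>
lemma row_sum_sinh:
  assumes n: "n > 0" and b: "b > 0"
  shows "(\<Sum>k<n. 2 / (1 + 2 * (sinh b)\<^sup>2 - cos (2 * pi * real k / real n)))
       = real n / (sinh b * cosh b) * (1 + 2 / (exp (2 * real n * b) - 1))"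
proof -
  define r where "r = exp (- (2 * b))"
  have r: "0 < r" "r < 1" using b by (auto simp: r_def)
  have "1 + r\<^sup>2 = 2 * r * (1 + 2 * (sinh b)\<^sup>2)" and "1 - r\<^sup>2 = 4 * r * (sinh b * cosh b)"
  proof -
    define E where "E = exp b"
    have E: "E > 0" "exp (- b) = 1 / E" "r = 1 / E\<^sup>2"
      by (simp_all add: E_def r_def exp_minus field_simps exp_double[symmetric])
    show "1 + r\<^sup>2 = 2 * r * (1 + 2 * (sinh b)\<^sup>2)" "1 - r\<^sup>2 = 4 * r * (sinh b * cosh b)"
      unfolding sinh_def cosh_def E(2,3) E_def[symmetric] using E(1)
      by (simp_all add: field_simps power2_eq_square)
  qed
  then have eq: "2 / (1 + 2 * (sinh b)\<^sup>2 - c) = (1 - r\<^sup>2) / (1 - 2 * r * c + r\<^sup>2) / (sinh b * cosh b)" for c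
  proof -
    assume 1: "1 + r\<^sup>2 = 2 * r * (1 + 2 * (sinh b)\<^sup>2)" and 2: "1 - r\<^sup>2 = 4 * r * (sinh b * cosh b)"
    have "1 - 2 * r * c + r\<^sup>2 = 2 * r * (1 + 2 * (sinh b)\<^sup>2 - c)" using 1 by (simp add: algebra_simps)
    moreover have "sinh b * cosh b \<noteq> 0" using b by simp
    moreover have "2 / q = 4 * r * t / (2 * r * q) / t" if "t \<noteq> 0" for q t
      using that r(1) by simp
    ultimately show ?thesis unfolding 2 by simp
  qed
  have rn: "r ^ n = 1 / exp (2 * real n * b)"
    by (simp add: r_def exp_of_nat_mult[symmetric] exp_minus field_simps)
  have "1 < exp (2 * real n * b)" using n b by simp
  moreover have "2 / (1 - 1 / e) - 1 = 1 + 2 / (e - 1)" if "1 < e" for e :: real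
    using that by (simp add: field_simps)
  ultimately have "2 / (1 - r ^ n) - 1 = 1 + 2 / (exp (2 * real n * b) - 1)"
    unfolding rn by blast
  then show ?thesis
    unfolding eq sum_divide_distrib[symmetric] using sum_poisson_kernel[OF n, of r] r by (simp add: less_imp_le)
qed

text \<open>
  Only y coth y = 1 + y^2 / 3 + o(y^2), at y = n b, involves n; the other factors are
  expanded separately.
\<close>
lemma row_zero_limit:
  fixes n :: real
  assumes "n > 0"
  shows "((\<lambda>b. n / (sinh b * cosh b) * (1 + 2 / (exp (2 * n * b) - 1)) - 1 / (sinh b)\<^sup>2) \<longlongrightarrow> (n\<^sup>2 - 1) / 3) (at_right 0)"
proof -
  define phi where "phi = (\<lambda>y::real. (y * (1 + 2 / (exp (2 * y) - 1)) - 1) / y\<^sup>2)"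
  have "(phi \<longlongrightarrow> 1 / 3) (at_right 0)" unfolding phi_def by real_asymp
  moreover have "filterlim (\<lambda>b. n * b) (at_right 0) (at_right 0)" using assms by real_asymp
  ultimately have 1: "((\<lambda>b. phi (n * b)) \<longlongrightarrow> 1 / 3) (at_right 0)"
    by (rule filterlim_compose)
  have 2: "((\<lambda>b::real. b / (sinh b * cosh b)) \<longlongrightarrow> 1) (at_right 0)"
    unfolding sinh_def cosh_def real_scaleR_def by real_asymp
  have 3: "((\<lambda>b::real. 1 / (b * sinh b * cosh b) - 1 / (sinh b)\<^sup>2) \<longlongrightarrow> - 1 / 3) (at_right 0)"
    unfolding sinh_def cosh_def real_scaleR_def by real_asymp
  have "((\<lambda>b. phi (n * b) * n\<^sup>2 * (b / (sinh b * cosh b)) + (1 / (b * sinh b * cosh b) - 1 / (sinh b)\<^sup>2))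
      \<longlongrightarrow> 1 / 3 * n\<^sup>2 * 1 + (- 1 / 3)) (at_right 0)"
    by (intro tendsto_intros 1 2 3)
  moreover have "\<forall>\<^sub>F b in at_right 0. phi (n * b) * n\<^sup>2 * (b / (sinh b * cosh b)) + (1 / (b * sinh b * cosh b) - 1 / (sinh b)\<^sup>2)
     = n / (sinh b * cosh b) * (1 + 2 / (exp (2 * n * b) - 1)) - 1 / (sinh b)\<^sup>2"
    using eventually_at_right_less[of 0]
  proof eventually_elim
    case (elim b)
    then have b: "b \<noteq> 0" "sinh b * cosh b \<noteq> 0" by auto
    have "(n * b * q - 1) / (n * b)\<^sup>2 * n\<^sup>2 * (b / t) + 1 / (b * t) = n / t * q" if "t \<noteq> 0" for q t
      using assms b(1) that by (simp add: field_simps power2_eq_square)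
    from this[OF b(2)] show ?case
      unfolding phi_def by (simp add: mult.assoc)
  qed
  ultimately have "((\<lambda>b. n / (sinh b * cosh b) * (1 + 2 / (exp (2 * n * b) - 1)) - 1 / (sinh b)\<^sup>2)
      \<longlongrightarrow> 1 / 3 * n\<^sup>2 * 1 + (- 1 / 3)) (at_right 0)"
    by (rule Lim_transform_eventually)
  then show ?thesis by (simp add: diff_divide_distrib)
qed

text \<open>
  The limit b = 0 of the row sums above, after removal of the summand k = 0, which is
  1 / (sinh b)^2.
\<close>
lemma row_zero_sum:
  assumes n: "n > 0"
  shows "(\<Sum>k=1..<n. 2 / (1 - cos (2 * pi * real k / real n))) = ((real n)\<^sup>2 - 1) / 3"
proof -
  let ?c = "\<lambda>k. cos (2 * pi * real k / real n)"
  have neg: "1 - ?c k > 0" if "k \<in> {1..<n}" for k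
  proof -
    have "?c k \<noteq> 1"
    proof
      assume "?c k = 1"
      then obtain i :: int where "2 * pi * real k / real n = of_int i * 2 * pi"
        using cos_one_2pi_int by auto
      then have "real k = of_int i * real n" using n by (simp add: field_simps)
      then have "int k = i * int n" by (metis of_int_eq_iff of_int_mult of_int_of_nat_eq)
      then have "int n dvd int k" by simp
      with that show False by (auto dest: dvd_imp_le simp: int_dvd_int_iff)
    qed
    then show ?thesis using cos_le_one[of "2 * pi * real k / real n"] by linarith
  qed
  have split: "(\<Sum>k<n. f k) = f 0 + (\<Sum>k=1..<n. f k)" for f :: "nat \<Rightarrow> real"
    using n by (simp add: lessThan_atLeast0 sum.atLeast_Suc_lessThan)
  have "((\<lambda>b. \<Sum>k=1..<n. 2 / (1 + 2 * (sinh b)\<^sup>2 - ?c k)) \<longlongrightarrow> (\<Sum>k=1..<n. 2 / (1 + 2 * (sinh 0)\<^sup>2 - ?c k))) (at_right 0)"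
    by (intro tendsto_intros) (use neg in force)
  moreover have "\<forall>\<^sub>F b in at_right 0. (\<Sum>k=1..<n. 2 / (1 + 2 * (sinh b)\<^sup>2 - ?c k))
     = real n / (sinh b * cosh b) * (1 + 2 / (exp (2 * real n * b) - 1)) - 1 / (sinh b)\<^sup>2"
    using eventually_at_right_less[of 0]
  proof eventually_elim
    case (elim b)
    show ?case using row_sum_sinh[OF n elim] elim by (simp add: split)
  qed
  ultimately have "((\<lambda>b. real n / (sinh b * cosh b) * (1 + 2 / (exp (2 * real n * b) - 1)) - 1 / (sinh b)\<^sup>2)
     \<longlongrightarrow> (\<Sum>k=1..<n. 2 / (1 + 2 * (sinh 0)\<^sup>2 - ?c k))) (at_right 0)"
    by (rule Lim_transform_eventually)
  then show ?thesis
    using tendsto_unique[OF _ _ row_zero_limit[of "real n"]] n by simp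
qed

text \<open>
  This is 1 / (sinh b cosh b) for sinh b = sin x.
\<close>
definition row_weight :: "real \<Rightarrow> real" where
  "row_weight x = 1 / (sin x * sqrt (1 + (sin x)\<^sup>2))"

text \<open>
  By cos (2 x) = 1 - 2 (sin x)^2, row j is the row sum with sinh b = sin (pi j / n).
\<close>
lemma F_sq_decomposition:
  assumes n: "n > 0"
  shows "F_sq n = ((real n)\<^sup>2 - 1) / 3 + real n * (\<Sum>j=1..<n. row_weight (pi * real j / real n))
    + 2 * real n * (\<Sum>j=1..<n. row_weight (pi * real j / real n) / (exp (2 * real n * arsinh (sin (pi * real j / real n))) - 1))"
proof -
  let ?c = "\<lambda>k. cos (2 * pi * real k / real n)" and ?x = "\<lambda>j. pi * real j / real n"
  let ?f = "\<lambda>j k. 1 / (1 - (1 / 2) * (?c j + ?c k))"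
  have f: "?f j k = 2 / (2 - ?c j - ?c k)" for j k
    by (simp add: divide_simps) 
  have row: "(\<Sum>k<n. ?f j k) = real n * (row_weight (?x j) * (1 + 2 / (exp (2 * real n * arsinh (sin (?x j))) - 1)))"
    if "j \<in> {1..<n}" for j
  proof -
    have s: "sin (?x j) > 0" using that n by (intro sin_gt_zero) (auto simp: field_simps)
    define b where "b = arsinh (sin (?x j))"
    have b: "b > 0" "sinh b = sin (?x j)" "cosh b = sqrt (1 + (sin (?x j))\<^sup>2)"
      using s by (simp_all add: b_def cosh_arsinh_real add.commute)
    have "?c j = 1 - 2 * (sin (?x j))\<^sup>2" using cos_double_sin[of "?x j"] by (simp add: algebra_simps)
    then have "?f j k = 2 / (1 + 2 * (sinh b)\<^sup>2 - ?c k)" for k unfolding f b by (simp add: algebra_simps)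
    then have "(\<Sum>k<n. ?f j k) = (\<Sum>k<n. 2 / (1 + 2 * (sinh b)\<^sup>2 - ?c k))" by simp
    also have "\<dots> = real n / (sinh b * cosh b) * (1 + 2 / (exp (2 * real n * b) - 1))"
      by (rule row_sum_sinh[OF n b(1)])
    finally show ?thesis unfolding b(2,3) by (simp add: row_weight_def b_def)
  qed
  have "({..<n} \<times> {..<n}) - {(0, 0)} = ({0} \<times> {1..<n}) \<union> ({1..<n} \<times> {..<n})" using n by auto
  then have "F_sq n = (\<Sum>(j, k) \<in> {0} \<times> {1..<n}. ?f j k) + (\<Sum>(j, k) \<in> {1..<n} \<times> {..<n}. ?f j k)"
    unfolding F_sq_def by (simp only:) (rule sum.union_disjoint, auto)
  also have "(\<Sum>(j, k) \<in> {0} \<times> {1..<n}. ?f j k) = (\<Sum>k=1..<n. 2 / (1 - ?c k))"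
    unfolding sum.cartesian_product[symmetric] f by simp
  also have "\<dots> = ((real n)\<^sup>2 - 1) / 3" by (rule row_zero_sum[OF n])
  also have "(\<Sum>(j, k) \<in> {1..<n} \<times> {..<n}. ?f j k) = (\<Sum>j=1..<n. \<Sum>k<n. ?f j k)"
    by (rule sum.cartesian_product[symmetric])
  also have "\<dots> = (\<Sum>j=1..<n. real n * (row_weight (?x j) * (1 + 2 / (exp (2 * real n * arsinh (sin (?x j))) - 1))))"
    by (rule sum.cong[OF refl row])
  also have "\<dots> = real n * (\<Sum>j=1..<n. row_weight (?x j)) + 2 * real n * (\<Sum>j=1..<n. row_weight (?x j) / (exp (2 * real n * arsinh (sin (?x j))) - 1))"
    by (simp add: sum_distrib_left sum.distrib[symmetric] algebra_simps)
  finally show ?thesis by simp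
qed

section \<open>Trapezoidal sums\<close>

text \<open>
  Regarded as a function of the step t, the error vanishes at t = 0 and has the derivative
  (f x - f (x + t) + t f' (x + t)) / 2, which two applications of the mean value theorem bound
  by a multiple of M h^2.
\<close>
lemma trapezoid_step:
  fixes F f f' f'' :: "real \<Rightarrow> real"
  assumes F: "\<And>t. a \<le> t \<Longrightarrow> t \<le> b \<Longrightarrow> (F has_field_derivative f t) (at t)"
    and f: "\<And>t. a \<le> t \<Longrightarrow> t \<le> b \<Longrightarrow> (f has_field_derivative f' t) (at t)"
    and f': "\<And>t. a \<le> t \<Longrightarrow> t \<le> b \<Longrightarrow> (f' has_field_derivative f'' t) (at t)"
    and M: "\<And>t. a \<le> t \<Longrightarrow> t \<le> b \<Longrightarrow> \<bar>f'' t\<bar> \<le> M"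
    and h: "0 < h" "a \<le> x" "x + h \<le> b"
  shows "\<bar>h * (f x + f (x + h)) / 2 - (F (x + h) - F x)\<bar> \<le> M * h ^ 3"
proof -
  have M0: "M \<ge> 0" using M[of x] h by force
  \<comment> \<open>the derivative of the error, up to the factor -1/2\<close>
  have slope: "\<bar>f (x + t) - f x - t * f' (x + t)\<bar> \<le> M * h\<^sup>2" if t: "0 < t" "t \<le> h" for t
  proof -
    obtain z where z: "x < z" "z < x + t" "f (x + t) - f x = (x + t - x) * f' z"
      using MVT2[of x "x + t" f f'] f t h by auto
    obtain y where y: "z < y" "y < x + t" "f' (x + t) - f' z = (x + t - z) * f'' y"
      using MVT2[of z "x + t" f' f''] f' t h z by auto
    have "\<bar>(x + t - z) * f'' y\<bar> \<le> h * M"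
      unfolding abs_mult using y z t h M[of y] by (intro mult_mono) auto
    then have "\<bar>t\<bar> * \<bar>f' z - f' (x + t)\<bar> \<le> h * (h * M)"
      using t h y M0 by (intro mult_mono) auto
    then show ?thesis unfolding z(3) abs_mult[symmetric]
      by (simp add: power2_eq_square algebra_simps)
  qed
  define E where "E = (\<lambda>t. t * (f x + f (x + t)) / 2 - (F (x + t) - F x))"
  have E: "(E has_field_derivative ((f x - f (x + t) + t * f' (x + t)) / 2)) (at t)" if "0 \<le> t" "t \<le> h" for t
  proof -
    have 1: "((\<lambda>t. f (x + t)) has_field_derivative f' (x + t)) (at t)"
      using f[of "x + t"] that h DERIV_shift[of f "f' (x + t)" t x] by (simp add: add.commute)
    have 2: "((\<lambda>t. F (x + t)) has_field_derivative f (x + t)) (at t)"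
      using F[of "x + t"] that h DERIV_shift[of F "f (x + t)" t x] by (simp add: add.commute)
    have "(E has_field_derivative ((1 * (f x + f (x + t)) + (0 + f' (x + t)) * t) / 2 - (f (x + t) - 0))) (at t)"
      unfolding E_def by (intro DERIV_diff DERIV_cdivide DERIV_mult DERIV_ident DERIV_add DERIV_const 1 2)
    also have "(1 * (f x + f (x + t)) + (0 + f' (x + t)) * t) / 2 - (f (x + t) - 0) = (f x - f (x + t) + t * f' (x + t)) / 2"
      by (simp add: field_simps)
    finally show ?thesis .
  qed
  have "\<exists>t>0. t < h \<and> E h - E 0 = (h - 0) * ((f x - f (x + t) + t * f' (x + t)) / 2)"
    by (rule MVT2[OF h(1) E])
  then obtain t where t: "0 < t" "t < h" "E h - E 0 = (h - 0) * ((f x - f (x + t) + t * f' (x + t)) / 2)"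
    by blast
  have "\<bar>E h\<bar> = h * (\<bar>f (x + t) - f x - t * f' (x + t)\<bar> / 2)"
  proof -
    have "E 0 = 0" by (simp add: E_def)
    then have "\<bar>E h\<bar> = \<bar>h * ((f x - f (x + t) + t * f' (x + t)) / 2)\<bar>" using t(3) by simp
    also have "\<dots> = h * (\<bar>f x - f (x + t) + t * f' (x + t)\<bar> / 2)" using h(1) by (simp add: abs_mult)
    also have "\<bar>f x - f (x + t) + t * f' (x + t)\<bar> = \<bar>f (x + t) - f x - t * f' (x + t)\<bar>" by linarith
    finally show ?thesis .
  qed
  also have "\<dots> \<le> h * (M * h\<^sup>2)"
    using slope[of t] t h M0 by (intro mult_left_mono) auto
  finally show ?thesis by (simp add: E_def power2_eq_square power3_eq_cube algebra_simps)
qed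

text \<open>
  The sum runs over the inner nodes only, because the functions of interest arise from others that
  are singular at the end points; half of the boundary values therefore appears on the other side.
\<close>
lemma trapezoid_rule:
  fixes F f f' f'' :: "real \<Rightarrow> real"
  assumes "\<And>t. a \<le> t \<Longrightarrow> t \<le> b \<Longrightarrow> (F has_field_derivative f t) (at t)"
    and "\<And>t. a \<le> t \<Longrightarrow> t \<le> b \<Longrightarrow> (f has_field_derivative f' t) (at t)"
    and "\<And>t. a \<le> t \<Longrightarrow> t \<le> b \<Longrightarrow> (f' has_field_derivative f'' t) (at t)"
    and cont: "continuous_on {a..b} f''" and ab: "a < b"
  obtains C where "\<And>n. n > 0 \<Longrightarrow>
    \<bar>(\<Sum>j=1..<n. f (a + (b - a) * real j / real n)) - (real n / (b - a) * (F b - F a) - (f a + f b) / 2)\<bar> \<le> C / real n"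
proof -
  have "bounded (f'' ` {a..b})" using cont by (intro compact_imp_bounded compact_continuous_image) auto
  then obtain M where M: "\<And>t. a \<le> t \<Longrightarrow> t \<le> b \<Longrightarrow> \<bar>f'' t\<bar> \<le> M"
    unfolding bounded_iff by force
  have "\<bar>(\<Sum>j=1..<n. f (a + (b - a) * real j / real n)) - (real n / (b - a) * (F b - F a) - (f a + f b) / 2)\<bar> \<le> M * (b - a)\<^sup>2 / real n"
    if n: "n > 0" for n
  proof -
    define h where "h = (b - a) / real n"
    have h: "h > 0" "real n * h = b - a" using n ab by (auto simp: h_def)
    define x where "x = (\<lambda>j. a + real j * h)"
    have x: "x 0 = a" "x n = b" "x (Suc j) = x j + h" for j using h by (auto simp: x_def algebra_simps)
    have step: "\<bar>h * (f (x j) + f (x (Suc j))) / 2 - (F (x (Suc j)) - F (x j))\<bar> \<le> M * h ^ 3" if "j < n" for j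
      unfolding x(3)
    proof (rule trapezoid_step[OF assms(1,2,3) M])
      show "a \<le> x j" using h by (simp add: x_def)
      have "real (Suc j) * h \<le> real n * h" using that h(1) by (intro mult_right_mono) auto
      then show "x j + h \<le> b" using h by (simp add: x_def algebra_simps)
    qed (use h in auto)
    have "(\<Sum>j<n. f (x j) + f (x (Suc j))) = 2 * (\<Sum>j=1..<n. f (x j)) + f (x 0) + f (x n)"
      using n
    proof (induction n rule: nat_induct_non_zero)
      case (Suc n)
      then show ?case by (simp add: sum.atLeastLessThan_Suc)
    qed simp
    then have S: "(\<Sum>j<n. h * (f (x j) + f (x (Suc j))) / 2) = h * ((\<Sum>j=1..<n. f (x j)) + (f a + f b) / 2)"
      unfolding x(1,2) sum_divide_distrib[symmetric] sum_distrib_left[symmetric] by (simp add: algebra_simps add_divide_distrib)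
    have T: "(\<Sum>j<n. F (x (Suc j)) - F (x j)) = F b - F a"
      by (subst sum_lessThan_telescope) (simp add: x)
    have "\<bar>h * ((\<Sum>j=1..<n. f (x j)) + (f a + f b) / 2) - (F b - F a)\<bar>
        = \<bar>\<Sum>j<n. h * (f (x j) + f (x (Suc j))) / 2 - (F (x (Suc j)) - F (x j))\<bar>"
      by (subst sum_subtractf) (simp only: S T)
    also have "\<dots> \<le> (\<Sum>j<n. M * h ^ 3)"
      by (rule sum_abs[THEN order_trans], rule sum_mono) (use step in simp)
    also have "\<dots> = M * (b - a) * h\<^sup>2"
      using h(2)[symmetric] by (simp add: power2_eq_square power3_eq_cube)
    finally have "\<bar>h * ((\<Sum>j=1..<n. f (x j)) + (f a + f b) / 2) - (F b - F a)\<bar> / h \<le> M * (b - a) * h\<^sup>2 / h"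
      using h(1) by (intro divide_right_mono) auto
    also have "\<bar>h * ((\<Sum>j=1..<n. f (x j)) + (f a + f b) / 2) - (F b - F a)\<bar> / h
       = \<bar>(h * ((\<Sum>j=1..<n. f (x j)) + (f a + f b) / 2) - (F b - F a)) / h\<bar>" using h(1) by (simp add: abs_divide)
    also have "(h * ((\<Sum>j=1..<n. f (x j)) + (f a + f b) / 2) - (F b - F a)) / h
       = (\<Sum>j=1..<n. f (x j)) - ((F b - F a) / h - (f a + f b) / 2)"
      using h(1) by (simp add: diff_divide_distrib)
    also have "(F b - F a) / h = real n / (b - a) * (F b - F a)" using n by (simp add: h_def)
    also have "M * (b - a) * h\<^sup>2 / h = M * (b - a)\<^sup>2 / real n" using h(1) by (simp add: h_def power2_eq_square)
    finally show ?thesis by (simp add: x_def h_def mult.commute)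
  qed
  then show ?thesis by (rule that)
qed

section \<open>The algebraic part of the row sums\<close>

text \<open>
  The logarithmic derivative of Euler's reflection formula. The pole of Digamma at 0 is moved
  into the term 1 / x by the functional equation, so the bracket is smooth on [0, 1/2].
\<close>
lemma Digamma_reflection_real:
  assumes "0 < x" "x < (1::real)"
  shows "pi * cot (pi * x) = 1 / x + (Digamma (1 - x) - Digamma (1 + x))"
proof -
  have refl: "Gamma y * Gamma (1 - y) = pi / sin (pi * y)" for y :: real
  proof -
    have "of_real (Gamma y * Gamma (1 - y)) = (of_real (pi / sin (pi * y)) :: complex)"
      using Gamma_reflection_complex[of "of_real y"] 
      by (simp add: Gamma_complex_of_real[symmetric] sin_of_real[symmetric])
    then show ?thesis by (simp only: of_real_eq_iff)
  qed
  have eq: "ln_Gamma y + ln_Gamma (1 - y) = ln pi - ln (sin (pi * y))" if "y \<in> {0<..<1}" for y :: real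
  proof -
    have gp: "Gamma y > 0" "Gamma (1 - y) > 0" using that by (auto intro: Gamma_real_pos)
    have "ln (Gamma y * Gamma (1 - y)) = ln (Gamma y) + ln (Gamma (1 - y))"
      by (rule ln_mult_pos[OF gp])
    also have "\<dots> = ln_Gamma y + ln_Gamma (1 - y)"
      using that by (simp add: ln_Gamma_real_pos)
    finally have "ln (Gamma y * Gamma (1 - y)) = ln_Gamma y + ln_Gamma (1 - y)" .
    moreover have "sin (pi * y) > 0" using that by (intro sin_gt_zero) auto
    ultimately show ?thesis unfolding refl by (simp add: ln_div)
  qed
  have s: "sin (pi * x) > 0" using assms by (intro sin_gt_zero) auto
  have "((\<lambda>y. ln_Gamma y + ln_Gamma (1 - y)) has_field_derivative (Digamma x - Digamma (1 - x))) (at x)"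
    using assms by (auto intro!: derivative_eq_intros DERIV_chain2[where g = "\<lambda>y. 1 - y" and f = ln_Gamma] has_field_derivative_ln_Gamma_real)
  moreover have "((\<lambda>y. ln pi - ln (sin (pi * y))) has_field_derivative (- pi * cot (pi * x))) (at x)"
    using s by (auto intro!: derivative_eq_intros simp: cot_def field_simps)
  then have "((\<lambda>y. ln_Gamma y + ln_Gamma (1 - y)) has_field_derivative (- pi * cot (pi * x))) (at x)"
    by (rule has_field_derivative_transform_within_open[of _ _ _ "{0<..<1}"]) (use assms eq in auto)
  ultimately have "Digamma x - Digamma (1 - x) = - pi * cot (pi * x)" by (rule DERIV_unique)
  moreover have "Digamma (x + 1) = Digamma x + 1 / x" using assms by (intro Digamma_plus1) auto
  ultimately show ?thesis by (simp add: add.commute)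
qed

lemma sum_reverse_inner: "(\<Sum>j=1..<n. f (n - j)) = (\<Sum>j=1..<n. f j)" for f :: "nat \<Rightarrow> real"
  by (rule sum.reindex_bij_witness[of _ "\<lambda>j. n - j" "\<lambda>j. n - j"]) auto

text \<open>
  1 / sin (2 y) is the mean of cot y and tan y, and tan y = cot (pi / 2 - y), so that reversing the
  order of summation turns the tangents into cotangents. Only one of the two poles is left.
\<close>
lemma sum_csc_eq_sum_cot:
  "(\<Sum>j=1..<n. 1 / sin (pi * real j / real n)) = (\<Sum>j=1..<n. cot (pi * (real j / (2 * real n))))"
proof -
  let ?y = "\<lambda>j. pi * (real j / (2 * real n))"
  have "1 / sin (pi * real j / real n) = (cot (?y j) + cot (?y (n - j))) / 2" if j: "j \<in> {1..<n}" for j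
  proof -
    have pos: "sin (?y j) > 0" "cos (?y j) > 0"
      using j by (auto intro!: sin_gt_zero cos_gt_zero simp: field_simps)
    have "?y (n - j) = pi / 2 - ?y j" using j by (simp add: of_nat_diff field_simps)
    then have "cot (?y (n - j)) = sin (?y j) / cos (?y j)"
      by (simp add: cot_def sin_diff cos_diff)
    moreover have "sin (pi * real j / real n) = 2 * sin (?y j) * cos (?y j)"
      using sin_double[of "?y j"] by simp
    moreover have "1 / (2 * S * C) = (C / S + S / C) / 2" if "S > 0" "C > 0" "S\<^sup>2 + C\<^sup>2 = 1" for S C :: real
      using that by (simp add: field_simps power2_eq_square)
    ultimately show ?thesis using pos by (simp add: cot_def)
  qed
  then have "(\<Sum>j=1..<n. 1 / sin (pi * real j / real n)) = (\<Sum>j=1..<n. (cot (?y j) + cot (?y (n - j))) / 2)"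
    by (rule sum.cong[OF refl])
  also have "\<dots> = ((\<Sum>j=1..<n. cot (?y j)) + (\<Sum>j=1..<n. cot (?y (n - j)))) / 2"
    by (simp only: sum.distrib sum_divide_distrib[symmetric])
  also have "(\<Sum>j=1..<n. cot (?y (n - j))) = (\<Sum>j=1..<n. cot (?y j))"
    by (rule sum_reverse_inner)
  finally show ?thesis by simp
qed

text \<open>
  The sum stops at n - 1, which accounts for the sign of 1 / (2 n).
\<close>
lemma harm_asymptotics:
  assumes "n > 0"
  shows "\<bar>(\<Sum>j=1..<n. 1 / real j) - (ln (real n) + euler_mascheroni - 1 / (2 * real n))\<bar> \<le> 2 / (real n)\<^sup>2"
proof (cases "n = 1")
  case True
  have "\<bar>euler_mascheroni - 1 / 2 :: real\<bar> \<le> 2"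
    using euler_mascheroni_less_13_over_22 euler_mascheroni_gt_19_over_33 by (simp add: abs_le_iff)
  with True show ?thesis by (simp add: abs_minus_commute)
next
  case False
  with assms obtain m where m: "n = m + 2" by (metis add_2_eq_Suc' not0_implies_Suc One_nat_def less_irrefl)
  have H: "(\<Sum>j=1..<n. 1 / real j) = harm (Suc m)"
    unfolding m harm_def by (rule sum.cong) (auto simp: inverse_eq_divide)
  have "1 / (2 * (real m + 1)) - 1 / (2 * real n) \<le> 2 / (real n)\<^sup>2"
  proof -
    have "1 / (2 * (real m + 1)) - 1 / (2 * real n) = 2 / (4 * (real m + 1) * (real m + 2))"
      by (simp add: m divide_simps) (simp add: algebra_simps)
    also have "\<dots> \<le> 2 / (real n)\<^sup>2"
    proof (rule frac_le)
      show "0 < (real n)\<^sup>2" using assms by simp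
      show "(real n)\<^sup>2 \<le> 4 * (real m + 1) * (real m + 2)" by (simp add: m power2_eq_square algebra_simps)
    qed auto
    finally show ?thesis .
  qed
  moreover have "0 \<le> 2 / (real n)\<^sup>2" by simp
  ultimately show ?thesis
    using euler_mascheroni_lower[of m] euler_mascheroni_upper[of m] unfolding H 
    by (simp add: abs_le_iff m add.commute)
qed

text \<open>
  In the sum of cotangents the pole gives a harmonic number, and the trapezoidal rule applies
  to the digamma part: its primitive - ln Gamma (1 - x) - ln Gamma (1 + x) contributes
  - ln (Gamma (1/2) Gamma (3/2)) = - ln (pi / 2), and its boundary value at 1/2, which is - 2 because
  cot (pi / 2) = 0, cancels the term 1 / (2 n) of the harmonic number.
\<close>
lemma sum_csc_asymptotics:
  obtains C where "\<And>n. n > 0 \<Longrightarrow>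
    \<bar>(\<Sum>j=1..<n. 1 / sin (pi * real j / real n)) - 2 * real n / pi * (ln (real n) + euler_mascheroni - ln (pi / 2))\<bar> \<le> C / real n"
proof -
  define F where "F = (\<lambda>x::real. - ln_Gamma (1 - x) - ln_Gamma (1 + x))"
  define f where "f = (\<lambda>x::real. Digamma (1 - x) - Digamma (1 + x))"
  define f' where "f' = (\<lambda>x::real. - Polygamma 1 (1 - x) - Polygamma 1 (1 + x))"
  define f'' where "f'' = (\<lambda>x::real. Polygamma 2 (1 - x) - Polygamma 2 (1 + x))"
  have Ints: "y \<notin> \<int>\<^sub>\<le>\<^sub>0" if "y > 0" for y :: real using that by (auto elim!: nonpos_Ints_cases)
  have dP: "((\<lambda>x. Polygamma k (1 - x)) has_field_derivative - Polygamma (Suc k) (1 - t)) (at t)" 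
    "((\<lambda>x. Polygamma k (1 + x)) has_field_derivative Polygamma (Suc k) (1 + t)) (at t)" 
    if "0 \<le> t" "t \<le> 1 / 2" for t :: real and k
  proof -
    have p: "1 - t \<notin> \<int>\<^sub>\<le>\<^sub>0" "1 + t \<notin> \<int>\<^sub>\<le>\<^sub>0" using that by (auto intro!: Ints)
    have g: "((\<lambda>x. 1 - x) has_field_derivative -1) (at t)" "((\<lambda>x. 1 + x) has_field_derivative 1) (at t)"
      by (auto intro!: derivative_eq_intros)
    show "((\<lambda>x. Polygamma k (1 - x)) has_field_derivative - Polygamma (Suc k) (1 - t)) (at t)"
      using DERIV_chain2[where f = "Polygamma k" and g = "\<lambda>x. 1 - x", OF has_field_derivative_Polygamma[OF p(1)] g(1)] by simp
    show "((\<lambda>x. Polygamma k (1 + x)) has_field_derivative Polygamma (Suc k) (1 + t)) (at t)"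
      using DERIV_chain2[where f = "Polygamma k" and g = "\<lambda>x. 1 + x", OF has_field_derivative_Polygamma[OF p(2)] g(2)] by simp
  qed
  obtain C where C: "\<And>n. n > 0 \<Longrightarrow>
    \<bar>(\<Sum>j=1..<n. f (0 + (1 / 2 - 0) * real j / real n)) - (real n / (1 / 2 - 0) * (F (1 / 2) - F 0) - (f 0 + f (1 / 2)) / 2)\<bar> \<le> C / real n"
  proof (rule trapezoid_rule[of 0 "1/2" F f f' f''])
    fix t :: real assume t: "0 \<le> t" "t \<le> 1 / 2"
    show "(F has_field_derivative f t) (at t)"
      unfolding F_def f_def using t
      by (auto intro!: derivative_eq_intros DERIV_chain2[where g = "\<lambda>y. 1 - y" and f = ln_Gamma] 
         DERIV_chain2[where g = "\<lambda>y. 1 + y" and f = ln_Gamma] has_field_derivative_ln_Gamma_real)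
    show "(f has_field_derivative f' t) (at t)"
      unfolding f_def f'_def using dP[OF t, of 0] DERIV_diff by fastforce
    show "(f' has_field_derivative f'' t) (at t)"
      unfolding f'_def f''_def using DERIV_diff[OF DERIV_minus[OF dP(1)[OF t, of 1]] dP(2)[OF t, of 1]]
      by (simp add: numeral_2_eq_2)
  next
    show "continuous_on {0..1/2} f''"
      unfolding f''_def
      by (intro continuous_at_imp_continuous_on ballI DERIV_isCont[OF DERIV_diff[OF dP]]) auto
  qed auto
  have F0: "F 0 = 0" by (simp add: F_def ln_Gamma_real_pos)
  have G: "Gamma (3 / 2 :: real) = sqrt pi / 2"
    using Gamma_plus1[of "1 / 2 :: real"] Ints[of "1/2"] by (simp add: Gamma_one_half_real)
  have "F (1 / 2) = - ln (Gamma (1 / 2)) - ln (Gamma (3 / 2))"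
    by (simp add: F_def ln_Gamma_real_pos)
  then have F1: "F (1 / 2) = - ln (pi / 2)"
    unfolding G Gamma_one_half_real by (simp add: ln_div ln_sqrt)
  have "Digamma (1 / 2 + 1 :: real) = Digamma (1 / 2) + 1 / (1 / 2)" by (rule Digamma_plus1) simp
  then have f1: "f 0 = 0" "f (1 / 2) = - 2" by (simp_all add: f_def)
  show ?thesis
  proof (rule that)
    fix n :: nat assume n: "n > 0"
    let ?H = "\<Sum>j=1..<n. 1 / real j" and ?S = "\<Sum>j=1..<n. f (real j / (2 * real n))"
    have cot_eq: "cot (pi * (real j / (2 * real n))) = (2 * real n * (1 / real j) + f (real j / (2 * real n))) / pi" if "j \<in> {1..<n}" for j
    proof -
      have "0 < real j / (2 * real n)" "real j / (2 * real n) < 1" using that by auto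
      from Digamma_reflection_real[OF this] show ?thesis
        unfolding f_def by (simp add: field_simps)
    qed
    have "(\<Sum>j=1..<n. 1 / sin (pi * real j / real n)) = (\<Sum>j=1..<n. (2 * real n * (1 / real j) + f (real j / (2 * real n))) / pi)"
      unfolding sum_csc_eq_sum_cot using cot_eq by (intro sum.cong) auto
    also have "\<dots> = (2 * real n * ?H + ?S) / pi"
      by (simp only: sum_divide_distrib[symmetric] sum.distrib sum_distrib_left)
    finally have eq: "(\<Sum>j=1..<n. 1 / sin (pi * real j / real n)) = (2 * real n * ?H + ?S) / pi" .
    have S: "\<bar>?S - (- (2 * real n * ln (pi / 2)) + 1)\<bar> \<le> C / real n"
      using C[OF n] by (simp add: F0 F1 f1)
    have H: "\<bar>2 * real n * ?H - (2 * real n * (ln (real n) + euler_mascheroni) - 1)\<bar> \<le> 4 / real n"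
    proof -
      have "\<bar>2 * real n * (?H - (ln (real n) + euler_mascheroni - 1 / (2 * real n)))\<bar> \<le> 2 * real n * (2 / (real n)\<^sup>2)"
        unfolding abs_mult using harm_asymptotics[OF n] n by (intro mult_mono) auto
      moreover have "2 * real n * (2 / (real n)\<^sup>2) = 4 / real n"
        using n by (simp add: power2_eq_square)
      moreover have "2 * real n * (?H - (ln (real n) + euler_mascheroni - 1 / (2 * real n)))
         = 2 * real n * ?H - (2 * real n * (ln (real n) + euler_mascheroni) - 1)"
        using n by (simp add: algebra_simps)
      ultimately show ?thesis by simp
    qed
    have "\<bar>(2 * real n * ?H + ?S) - 2 * real n * (ln (real n) + euler_mascheroni - ln (pi / 2))\<bar> \<le> (C + 4) / real n"
      using S H unfolding add_divide_distrib by (simp add: algebra_simps abs_le_iff)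
    then have "\<bar>(2 * real n * ?H + ?S) - 2 * real n * (ln (real n) + euler_mascheroni - ln (pi / 2))\<bar> / pi \<le> (C + 4) / real n / pi"
      by (intro divide_right_mono) auto
    also have "\<bar>(2 * real n * ?H + ?S) - 2 * real n * (ln (real n) + euler_mascheroni - ln (pi / 2))\<bar> / pi
       = \<bar>((2 * real n * ?H + ?S) - 2 * real n * (ln (real n) + euler_mascheroni - ln (pi / 2))) / pi\<bar>"
      by (simp only: abs_divide) simp
    also have "((2 * real n * ?H + ?S) - 2 * real n * (ln (real n) + euler_mascheroni - ln (pi / 2))) / pi
       = (2 * real n * ?H + ?S) / pi - 2 * real n / pi * (ln (real n) + euler_mascheroni - ln (pi / 2))"
      by (simp only: diff_divide_distrib times_divide_eq_left)
    finally show "\<bar>(\<Sum>j=1..<n. 1 / sin (pi * real j / real n)) - 2 * real n / pi * (ln (real n) + euler_mascheroni - ln (pi / 2))\<bar> \<le> ((C + 4) / pi) / real n"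
      unfolding eq by (simp add: mult.commute)
  qed
qed

lemma DERIV_sqrt_one_plus_sin_square:
  "((\<lambda>x. sqrt (1 + (sin x)\<^sup>2)) has_field_derivative (sin x * cos x / sqrt (1 + (sin x)\<^sup>2))) (at x)"
proof -
  have "1 + (sin x)\<^sup>2 > 0" by (simp add: add_pos_nonneg)
  moreover have "((\<lambda>x. 1 + (sin x)\<^sup>2) has_field_derivative (2 * sin x * cos x)) (at x)"
    by (auto intro!: derivative_eq_intros)
  ultimately have "((\<lambda>x. sqrt (1 + (sin x)\<^sup>2)) has_field_derivative (inverse (sqrt (1 + (sin x)\<^sup>2)) / 2 * (2 * sin x * cos x))) (at x)"
    by (intro DERIV_chain2[where f = sqrt and g = "\<lambda>x. 1 + (sin x)\<^sup>2"] DERIV_real_sqrt)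
  moreover have "inverse w / 2 * (2 * s * c) = s * c / w" for w s c :: real
    by (cases "w = 0") (simp_all add: field_simps)
  ultimately show ?thesis by (rule DERIV_cong)
qed

text \<open>
  The function on the right is what remains of the row weight after subtraction of 1 / sin x. Taking
  cos x as the variable and then cos x = sqrt 2 sin phi reduces its integral to that of
  1 / (1 + sqrt 2 cos phi), which the half-angle substitution turns into this difference of
  logarithms.
\<close>
lemma csc_defect_antiderivative:
  fixes x :: real
  defines "W \<equiv> \<lambda>x. sqrt (1 + (sin x)\<^sup>2)" and "k \<equiv> sqrt 2 - 1"
  shows "((\<lambda>x. ln (sqrt 2 + W x + k * cos x) - ln (sqrt 2 + W x - k * cos x)) 
     has_field_derivative (- sin x / (W x * (1 + W x)))) (at x)"
proof -
  let ?S = "sin x" and ?C = "cos x" and ?q = "sqrt 2" and ?N = "sqrt 2 + W x + k * cos x" and ?D = "sqrt 2 + W x - k * cos x"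
  have W1: "W x \<ge> 1" by (simp add: W_def)
  have k: "0 < k" "k < 1" using sqrt2_less_2 by (auto simp: k_def)
  have "\<bar>k * ?C\<bar> \<le> 1 * 1" unfolding abs_mult using k by (intro mult_mono) auto
  moreover have "?q > 1" by simp
  ultimately have pos: "?N > 0" "?D > 0" using W1 by linarith+
  have dW: "(W has_field_derivative (?S * ?C / W x)) (at x)"
    unfolding W_def by (rule DERIV_sqrt_one_plus_sin_square)
  have q2: "?q * ?q = 2" by simp
  have W2: "W x * W x = 2 - ?C * ?C" 
  proof -
    have "W x * W x = 1 + (sin x)\<^sup>2" by (simp add: W_def)
    then show ?thesis unfolding sin_squared_eq by (simp add: power2_eq_square)
  qed
  have ND: "?N * ?D = 2 * ?q * k * (W x + ?q) * (W x + 1)"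
  proof -
    have "(q + w + (q - 1) * c) * (q + w - (q - 1) * c) = 2 * q * (q - 1) * (w + q) * (w + 1)"
      if q: "q * q = 2" and w: "w * w = 2 - c * c" for q w c :: real
    proof -
      have qq: "q * (q * y) = 2 * y" for y using q by (simp add: mult.assoc[symmetric])
      have "(q + w + (q - 1) * c) * (q + w - (q - 1) * c) = (q + w) * (q + w) - (q - 1) * (q - 1) * (c * c)"
        by (simp add: algebra_simps)
      also have "c * c = 2 - w * w" using w by simp
      also have "(q + w) * (q + w) - (q - 1) * (q - 1) * (2 - w * w) = 2 * q * (q - 1) * (w + q) * (w + 1)"
        by (simp add: algebra_simps q qq)
      finally show ?thesis .
    qed
    from this[OF q2 W2] show ?thesis unfolding k_def .
  qed
  have num: "((?S * ?C / W x - k * ?S) * ?D - (?S * ?C / W x + k * ?S) * ?N) * W x = - (2 * ?q * k * ?S * (W x + ?q))"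
  proof -
    have "((?S * ?C / W x - k * ?S) * ?D - (?S * ?C / W x + k * ?S) * ?N) * W x 
       = (?S * ?C - k * ?S * W x) * ?D - (?S * ?C + k * ?S * W x) * ?N"
      using W1 by (simp add: field_simps)
    also have "\<dots> = - (2 * ?q * k * ?S * (W x + ?q))"
    proof -
      have "(s * c - k * s * w) * (q + w - k * c) - (s * c + k * s * w) * (q + w + k * c) = - (2 * q * k * s * (w + q))"
        if q: "q * q = 2" and w: "w * w = 2 - c * c" for q w c s :: real
      proof -
        have "(s * c - k * s * w) * (q + w - k * c) - (s * c + k * s * w) * (q + w + k * c) = - (2 * k * s) * (c * c + w * w + q * w)"
          by (simp add: algebra_simps)
        also have "c * c + w * w + q * w = q * (w + q)" unfolding w distrib_left q by simp
        finally show ?thesis by simp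
      qed
      from this[OF q2 W2] show ?thesis .
    qed
    finally show ?thesis .
  qed
  have "((\<lambda>x. ln (?q + W x + k * cos x) - ln (?q + W x - k * cos x)) 
     has_field_derivative ((?S * ?C / W x - k * ?S) / ?N - (?S * ?C / W x + k * ?S) / ?D)) (at x)"
    using pos by (auto intro!: derivative_eq_intros dW simp: field_simps)
  also have "(?S * ?C / W x - k * ?S) / ?N - (?S * ?C / W x + k * ?S) / ?D
      = (((?S * ?C / W x - k * ?S) * ?D - (?S * ?C / W x + k * ?S) * ?N) * W x) / (?N * ?D * W x)"
  proof -
    have "A / N - B / D = ((A * D - B * N) * w) / (N * D * w)" if "N > 0" "D > 0" "w > 0" for A B N D w :: real
      using that by (simp add: field_simps)
    from this[OF pos, of "W x"] W1 show ?thesis by simp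
  qed
  also have "\<dots> = - ?S / (W x * (1 + W x))"
  proof -
    have "- (2 * q * k * s * u) / (2 * q * k * u * (w + 1) * w) = - s / (w * (1 + w))" if "q > 0" "k > 0" "u > 0" "w > 0" for q k s u w :: real
    proof -
      have "- (2 * q * k * s * u) / (2 * q * k * u * (w + 1) * w) = ((2 * q * k * u) * (- s)) / ((2 * q * k * u) * (w * (1 + w)))"
      proof -
        have "- (2 * q * k * s * u) = (2 * q * k * u) * (- s)" by simp
        moreover have "2 * q * k * u * (w + 1) * w = (2 * q * k * u) * (w * (1 + w))" by (simp add: algebra_simps)
        ultimately show ?thesis by (simp only:)
      qed
      also have "\<dots> = - s / (w * (1 + w))"
        by (rule mult_divide_mult_cancel_left) (use that in simp)
      finally show ?thesis .
    qed
    from this[of ?q k "W x + ?q" "W x" ?S] k W1 show ?thesis unfolding num ND by (simp add: add_pos_pos)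
  qed
  finally show ?thesis .
qed

text \<open>
  The defect vanishes at 0 and pi, so only its integral - ln 2 survives.
\<close>
lemma sum_csc_defect_asymptotics:
  obtains C where "\<And>n. n > 0 \<Longrightarrow>
    \<bar>(\<Sum>j=1..<n. row_weight (pi * real j / real n) - 1 / sin (pi * real j / real n)) - (- real n / pi * ln 2)\<bar> \<le> C / real n"
proof -
  define W where "W = (\<lambda>x::real. sqrt (1 + (sin x)\<^sup>2))"
  define k where "k = sqrt 2 - 1"
  define R where "R = (\<lambda>x. ln (sqrt 2 + W x + k * cos x) - ln (sqrt 2 + W x - k * cos x))"
  define D where "D = (\<lambda>x. W x * (1 + W x))"
  \<comment> \<open>D1 and D2 are the first two derivatives of D\<close>
  define D1 where "D1 = (\<lambda>x. sin x * cos x * (1 / W x + 2))"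
  define D2 where "D2 = (\<lambda>x. ((cos x)\<^sup>2 - (sin x)\<^sup>2) * (1 / W x + 2) - (sin x * cos x)\<^sup>2 / W x ^ 3)"
  define f where "f = (\<lambda>x. - sin x / D x)"
  define f' where "f' = (\<lambda>x. (sin x * D1 x - cos x * D x) / (D x * D x))"
  define f'' where "f'' = (\<lambda>x. ((cos x * D1 x + D2 x * sin x - (- sin x * D x + D1 x * cos x)) * (D x * D x)
       - (sin x * D1 x - cos x * D x) * (D1 x * D x + D1 x * D x)) / ((D x * D x) * (D x * D x)))"
  have W1: "W x \<ge> 1" for x by (simp add: W_def)
  have W0: "W x \<noteq> 0" for x using W1[of x] by linarith
  have D0: "D x \<noteq> 0" for x using W1[of x] by (simp add: D_def) 
  have dW: "(W has_field_derivative (sin x * cos x / W x)) (at x)" for x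
    unfolding W_def by (rule DERIV_sqrt_one_plus_sin_square)
  have dD: "(D has_field_derivative D1 x) (at x)" for x
    unfolding D_def D1_def using W0[of x]
    by (auto intro!: derivative_eq_intros dW simp: field_simps)
  have dD1: "(D1 has_field_derivative D2 x) (at x)" for x
    unfolding D1_def D2_def using W0[of x]
    by (auto intro!: derivative_eq_intros dW simp: field_simps power2_eq_square power3_eq_cube)
  have dR: "(R has_field_derivative f x) (at x)" for x
    unfolding R_def f_def D_def W_def k_def by (rule csc_defect_antiderivative)
  have df: "(f has_field_derivative f' x) (at x)" for x
    using DERIV_divide[OF DERIV_minus[OF DERIV_sin] dD D0, of x] unfolding f_def f'_def by (simp add: algebra_simps)
  have df': "(f' has_field_derivative f'' x) (at x)" for x
    unfolding f'_def f''_def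
    by (intro DERIV_divide DERIV_diff DERIV_mult DERIV_sin DERIV_cos dD dD1) (use D0 in auto)
  have cW: "continuous_on A W" for A
    using dW by (intro continuous_at_imp_continuous_on ballI DERIV_isCont) blast
  have cD: "continuous_on A D" and cD1: "continuous_on A D1" for A
    using dD dD1 by (blast intro: continuous_at_imp_continuous_on DERIV_isCont)+
  have cD2: "continuous_on A D2" for A
    unfolding D2_def by (intro continuous_intros cW ballI) (use W0 in auto)
  have cont: "continuous_on {0..pi} f''"
    unfolding f''_def by (intro continuous_intros cD cD1 cD2 ballI) (use D0 in auto)
  obtain C where C: "\<And>n. n > 0 \<Longrightarrow>
    \<bar>(\<Sum>j=1..<n. f (0 + (pi - 0) * real j / real n)) - (real n / (pi - 0) * (R pi - R 0) - (f 0 + f pi) / 2)\<bar> \<le> C / real n"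
    by (rule trapezoid_rule[of 0 pi R f f' f'', OF dR df df' cont pi_gt_zero]) blast
  have R: "R pi - R 0 = - ln 2"
  proof -
    have "R 0 = ln (2 * sqrt 2) - ln 2" "R pi = ln 2 - ln (2 * sqrt 2)" by (simp_all add: R_def W_def k_def)
    then show ?thesis by (simp add: ln_mult ln_sqrt)
  qed
  have eq: "row_weight (pi * real j / real n) - 1 / sin (pi * real j / real n) = f (0 + (pi - 0) * real j / real n)" if "j \<in> {1..<n}" for j n
  proof -
    let ?x = "pi * real j / real n"
    have s: "sin ?x > 0" using that by (intro sin_gt_zero) (auto simp: field_simps)
    have W2: "W ?x * W ?x = 1 + sin ?x * sin ?x" by (simp add: W_def power2_eq_square)
    have "1 / (S * w) - 1 / S = - S / (w * (1 + w))" if "S > 0" "w \<ge> 1" "w * w = 1 + S * S" for S w :: real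
    proof -
      have "(1 / (S * w) - 1 / S) * (S * w * (1 + w)) = 1 - w * w"
        using that(1,2) by (simp add: field_simps)
      also have "\<dots> = - (S * S)" using that(3) by simp
      also have "\<dots> = (- S / (w * (1 + w))) * (S * w * (1 + w))"
        using that(1,2) by simp
      finally have "(1 / (S * w) - 1 / S) * (S * w * (1 + w)) = (- S / (w * (1 + w))) * (S * w * (1 + w))" .
      moreover have "S * w * (1 + w) \<noteq> 0" using that(1,2) by simp
      ultimately show ?thesis by (simp only: mult_cancel_right) simp
    qed
    from this[OF s W1 W2] show ?thesis by (simp add: row_weight_def f_def D_def W_def)
  qed
  show ?thesis
  proof (rule that[of C])
    fix n :: nat assume n: "n > 0"
    have "f 0 = 0" "f pi = 0" by (simp_all add: f_def)
    then show "\<bar>(\<Sum>j=1..<n. row_weight (pi * real j / real n) - 1 / sin (pi * real j / real n)) - (- real n / pi * ln 2)\<bar> \<le> C / real n"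
      using C[OF n] eq by (simp add: R)
  qed
qed

lemma sum_row_weight_asymptotics:
  obtains C where "\<And>n. n > 0 \<Longrightarrow>
    \<bar>real n * (\<Sum>j=1..<n. row_weight (pi * real j / real n)) - 2 / pi * (real n)\<^sup>2 * (ln (real n) + euler_mascheroni + ln (sqrt 2 / pi))\<bar> \<le> C"
proof -
  obtain C1 where C1: "\<And>n. n > 0 \<Longrightarrow>
    \<bar>(\<Sum>j=1..<n. 1 / sin (pi * real j / real n)) - 2 * real n / pi * (ln (real n) + euler_mascheroni - ln (pi / 2))\<bar> \<le> C1 / real n"
    using sum_csc_asymptotics by blast
  obtain C2 where C2: "\<And>n. n > 0 \<Longrightarrow>
    \<bar>(\<Sum>j=1..<n. row_weight (pi * real j / real n) - 1 / sin (pi * real j / real n)) - (- real n / pi * ln 2)\<bar> \<le> C2 / real n"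
    using sum_csc_defect_asymptotics by blast
  show ?thesis
  proof (rule that)
    fix n :: nat assume n: "n > 0"
    let ?g = "\<Sum>j=1..<n. row_weight (pi * real j / real n)" and ?c = "\<Sum>j=1..<n. 1 / sin (pi * real j / real n)"
    let ?A = "2 * real n / pi * (ln (real n) + euler_mascheroni - ln (pi / 2))" and ?B = "- real n / pi * ln 2"
    have "\<bar>?g - (?A + ?B)\<bar> \<le> C1 / real n + C2 / real n"
      using C1[OF n] C2[OF n] unfolding sum_subtractf by linarith
    then have "real n * \<bar>?g - (?A + ?B)\<bar> \<le> real n * (C1 / real n + C2 / real n)"
      by (rule mult_left_mono) simp
    also have "\<dots> = C1 + C2" using n by (simp add: field_simps)
    also have "real n * \<bar>?g - (?A + ?B)\<bar> = \<bar>real n * ?g - real n * (?A + ?B)\<bar>"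
      by (simp only: right_diff_distrib[symmetric] abs_mult abs_of_nat)
    also have "real n * (?A + ?B) = 2 / pi * (real n)\<^sup>2 * (ln (real n) + euler_mascheroni + (- ln (pi / 2) - ln 2 / 2))"
      by (simp add: field_simps power2_eq_square)
    also have "- ln (pi / 2) - ln 2 / 2 = ln (sqrt 2 / pi)"
      by (simp add: ln_div ln_sqrt)
    finally show "\<bar>real n * ?g - 2 / pi * (real n)\<^sup>2 * (ln (real n) + euler_mascheroni + ln (sqrt 2 / pi))\<bar> \<le> C1 + C2" .
  qed
qed

section \<open>Theta functions on the real axis\<close>

lemma summable_on_power_abs_int:
  fixes r :: real
  assumes "0 \<le> r" "r < 1"
  shows "(\<lambda>n::int. r ^ nat \<bar>n\<bar>) summable_on UNIV"
proof -
  have geo: "(\<lambda>k::nat. r ^ k) summable_on UNIV"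
    by (rule norm_summable_imp_summable_on) (use assms in auto)
  have "(\<lambda>n::int. r ^ nat \<bar>n\<bar>) summable_on {0..}"
    using summable_on_reindex_bij_betw[of int UNIV "{0..}" "\<lambda>n. r ^ nat \<bar>n\<bar>"] geo
    by (force simp: bij_betw_def inj_on_def image_iff intro: zero_le_imp_eq_int)
  moreover have "(\<lambda>n::int. r ^ nat \<bar>n\<bar>) summable_on {..0}"
  proof -
    have "bij_betw (\<lambda>k. - int k) UNIV {..0}"
      by (rule bij_betwI[where g = "\<lambda>n. nat (-n)"]) auto
    from summable_on_reindex_bij_betw[OF this, of "\<lambda>n. r ^ nat \<bar>n\<bar>"] geo show ?thesis
      by simp
  qed
  moreover have "(UNIV :: int set) = {0..} \<union> {..0}" by auto
  ultimately show ?thesis by (metis summable_on_union)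
qed

lemma summable_on_gaussian_int:
  fixes t c :: real
  assumes "t > 0"
  shows "(\<lambda>n::int. exp (- t * (of_int n + c)\<^sup>2)) summable_on UNIV"
proof -
  have "(\<lambda>n::int. exp (t * (\<bar>c\<bar> + 1)) * exp (-t) ^ nat \<bar>n\<bar>) summable_on UNIV"
    by (intro summable_on_cmult_right summable_on_power_abs_int) (use assms in auto)
  then have "(\<lambda>n::int. norm (exp (- t * (of_int n + c)\<^sup>2))) summable_on UNIV"
  proof (rule Infinite_Sum.abs_summable_on_comparison_test')
    fix n :: int
    have "(\<bar>of_int n + c\<bar> - 1/2)\<^sup>2 \<ge> 0" by simp
    then have "(of_int n + c)\<^sup>2 \<ge> \<bar>of_int n + c\<bar> - 1/4"
      by (simp add: power2_diff field_simps)
    then have "(of_int n + c)\<^sup>2 \<ge> \<bar>real_of_int n\<bar> - (\<bar>c\<bar> + 1)" by linarith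
    then have "- t * (of_int n + c)\<^sup>2 \<le> - t * (\<bar>real_of_int n\<bar> - (\<bar>c\<bar> + 1))"
      using assms by simp
    then have "exp (- t * (of_int n + c)\<^sup>2) \<le> exp (t * (\<bar>c\<bar> + 1) + real (nat \<bar>n\<bar>) * (-t))"
      by (simp add: algebra_simps)
    then show "norm (exp (- t * (of_int n + c)\<^sup>2)) \<le> exp (t * (\<bar>c\<bar> + 1)) * exp (-t) ^ nat \<bar>n\<bar>"
      by (simp only: exp_add exp_of_nat_mult norm_exp real_norm_def abs_exp_cancel)
  qed
  then show ?thesis by simp
qed

lemma has_sum_mult_real:
  fixes f :: "'a \<Rightarrow> real" and g :: "'b \<Rightarrow> real"
  assumes "(f has_sum A) UNIV" "(g has_sum B) UNIV"
  shows "((\<lambda>(x, y). f x * g y) has_sum (A * B)) UNIV"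
proof -
  have f: "f summable_on UNIV" "(\<lambda>x. norm (f x)) summable_on UNIV"
    and g: "g summable_on UNIV" "(\<lambda>x. norm (g x)) summable_on UNIV"
    using assms summable_on_iff_abs_summable_on_real by (auto simp: summable_on_def)
  have "(\<lambda>z. norm (case z of (x, y) \<Rightarrow> f x * g y)) summable_on (UNIV \<times> UNIV)"
    unfolding Infinite_Sum.abs_summable_on_Sigma_iff
    using f g by (auto simp: abs_mult infsum_cmult_right' intro!: summable_on_cmult_right summable_on_cmult_left)
  then have s: "(\<lambda>(x, y). f x * g y) summable_on (UNIV \<times> UNIV)"
    by (rule abs_summable_summable)
  have "infsum (\<lambda>(x, y). f x * g y) (UNIV \<times> UNIV) = (\<Sum>\<^sub>\<infinity>x. \<Sum>\<^sub>\<infinity>y. f x * g y)"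
    using infsum_Sigma'_banach[OF s] by simp
  also have "\<dots> = A * B"
    using infsumI[OF assms(1)] infsumI[OF assms(2)] by (simp add: infsum_cmult_right' infsum_cmult_left')
  finally show ?thesis using has_sum_infsum[OF s] by simp
qed

text \<open>
  The pairs with even and with odd coordinate sum are two copies of the lattice, rotated by 45
  degrees and scaled by sqrt 2. As (a + b)^2 + (a - b)^2 = 2 (a^2 + b^2), the decomposition relates
  products of two theta series to products with doubled parameter.
\<close>
lemma has_sum_rotate_lattice:
  fixes F :: "int \<times> int \<Rightarrow> real"
  assumes "(F has_sum S) UNIV"
    and "((\<lambda>(a, b). F (a + b, a - b)) has_sum S1) UNIV"
    and "((\<lambda>(a, b). F (a + b + 1, a - b)) has_sum S2) UNIV"
  shows "S = S1 + S2"
proof -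
  define E :: "(int \<times> int) set" where "E = {(m, n). even (m + n)}"
  have "(\<lambda>(a, b). (a + b, a - b)) ` UNIV = E"
  proof (intro equalityI subsetI)
    fix z assume "z \<in> E"
    then have "even (fst z + snd z)" by (auto simp: E_def)
    then obtain k where "fst z + snd z = 2 * k" by (rule evenE)
    then have "z = (\<lambda>(a, b). (a + b, a - b)) (k, k - snd z)" by (auto intro: prod_eqI)
    then show "z \<in> (\<lambda>(a, b). (a + b, a - b)) ` UNIV" by blast
  qed (auto simp: E_def)
  then have "bij_betw (\<lambda>(a, b). (a + b, a - b)) UNIV E"
    by (auto simp: bij_betw_def inj_on_def)
  then have "(F has_sum S1) E"
    using has_sum_reindex_bij_betw[of "\<lambda>(a, b). (a + b, a - b)" UNIV E F S1] assms(2)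
    by (simp add: case_prod_unfold)
  moreover have "(\<lambda>(a, b). (a + b + 1, a - b)) ` UNIV = - E"
  proof (intro equalityI subsetI)
    fix z assume "z \<in> - E"
    then have "odd (fst z + snd z)" by (auto simp: E_def)
    then obtain k where "fst z + snd z = 2 * k + 1" by (rule oddE)
    then have "z = (\<lambda>(a, b). (a + b + 1, a - b)) (k, k - snd z)" by (auto intro: prod_eqI)
    then show "z \<in> (\<lambda>(a, b). (a + b + 1, a - b)) ` UNIV" by blast
  qed (auto simp: E_def)
  then have "bij_betw (\<lambda>(a, b). (a + b + 1, a - b)) UNIV (- E)"
    by (auto simp: bij_betw_def inj_on_def)
  then have "(F has_sum S2) (- E)"
    using has_sum_reindex_bij_betw[of "\<lambda>(a, b). (a + b + 1, a - b)" UNIV "- E" F S2] assms(3)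
    by (simp add: case_prod_unfold)
  ultimately have "(F has_sum (S1 + S2)) (E \<union> - E)"
    by (intro has_sum_Un_disjoint) auto
  with assms(1) show ?thesis
    using has_sum_unique by (metis Compl_partition)
qed

definition alt_sign :: "int \<Rightarrow> real" where "alt_sign n = (if even n then 1 else -1)"

lemma abs_alt_sign [simp]: "\<bar>alt_sign n\<bar> = 1"
  by (simp add: alt_sign_def)

text \<open>
  The theta constants with nome exp (- t). In terms of t, squaring the nome is doubling, and the
  fourth root of the nome in theta2 is unproblematic.
\<close>
definition theta2 :: "real \<Rightarrow> real" where
  "theta2 t = (\<Sum>\<^sub>\<infinity>n::int. exp (- t * (of_int n + 1/2)\<^sup>2))"

definition theta3 :: "real \<Rightarrow> real" where
  "theta3 t = (\<Sum>\<^sub>\<infinity>n::int. exp (- t * (of_int n)\<^sup>2))"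

definition theta4 :: "real \<Rightarrow> real" where
  "theta4 t = (\<Sum>\<^sub>\<infinity>n::int. alt_sign n * exp (- t * (of_int n)\<^sup>2))"

lemma has_sum_theta2: "t > 0 \<Longrightarrow> ((\<lambda>n::int. exp (- t * (of_int n + 1/2)\<^sup>2)) has_sum theta2 t) UNIV"
  unfolding theta2_def by (rule has_sum_infsum, rule summable_on_gaussian_int)

lemma has_sum_theta3: "t > 0 \<Longrightarrow> ((\<lambda>n::int. exp (- t * (of_int n)\<^sup>2)) has_sum theta3 t) UNIV"
  unfolding theta3_def using summable_on_gaussian_int[of t 0] by (intro has_sum_infsum) simp

lemma has_sum_theta4: "t > 0 \<Longrightarrow> ((\<lambda>n::int. alt_sign n * exp (- t * (of_int n)\<^sup>2)) has_sum theta4 t) UNIV"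
  unfolding theta4_def
proof (intro has_sum_infsum, rule abs_summable_summable)
  assume "t > 0"
  then show "(\<lambda>n::int. norm (alt_sign n * exp (- t * (of_int n)\<^sup>2))) summable_on UNIV"
    using summable_on_gaussian_int[of t 0] by (simp add: abs_mult)
qed

text \<open>
  The reflection of n to - 1 - n reverses all signs: this is the odd theta function at 0.
\<close>
lemma alternating_half_integer_sum:
  assumes "t > 0"
  shows "((\<lambda>n::int. alt_sign n * exp (- t * (of_int n + 1/2)\<^sup>2)) has_sum 0) UNIV"
proof -
  let ?f = "\<lambda>n::int. alt_sign n * exp (- t * (of_int n + 1/2)\<^sup>2)"
  have "(\<lambda>n::int. norm (?f n)) summable_on UNIV"
    using summable_on_gaussian_int[of t "1/2"] assms by (simp add: abs_mult)
  then have s: "(?f has_sum infsum ?f UNIV) UNIV"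
    by (rule has_sum_infsum[OF abs_summable_summable])
  have "bij_betw (\<lambda>n::int. -1 - n) UNIV UNIV"
    by (rule bij_betwI[where g = "\<lambda>n. -1 - n"]) auto
  from has_sum_reindex_bij_betw[OF this, of ?f] s
  have "((\<lambda>n. ?f (-1 - n)) has_sum infsum ?f UNIV) UNIV" by simp
  moreover have "?f (-1 - n) = - ?f n" for n
  proof -
    have "(real_of_int (-1 - n) + 1/2)\<^sup>2 = (of_int n + 1/2)\<^sup>2"
      by (simp add: power2_eq_square algebra_simps)
    then show ?thesis by (simp add: alt_sign_def)
  qed
  ultimately have "((\<lambda>n. - ?f n) has_sum infsum ?f UNIV) UNIV" by simp
  then have "(?f has_sum (- infsum ?f UNIV)) UNIV"
    using has_sum_uminus[of ?f UNIV "infsum ?f UNIV"] by simp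
  with s have "infsum ?f UNIV = - infsum ?f UNIV" by (rule has_sum_unique)
  with s show ?thesis by simp
qed

text \<open>
  By this and the next three identities, the squares of theta3 and theta4 at 2 t are the arithmetic
  and the geometric mean of those at t, and the squares of theta3 and theta2 at t are twice the
  two means of those at 2 t.
\<close>
lemma theta3_square: 
  assumes "t > 0" shows "(theta3 t)\<^sup>2 = (theta3 (2*t))\<^sup>2 + (theta2 (2*t))\<^sup>2"
  unfolding power2_eq_square[of "theta3 t"]
proof (rule has_sum_rotate_lattice)
  have t2: "2*t > 0" using assms by simp
  show "((\<lambda>(m, n). exp (- t * (of_int m)\<^sup>2) * exp (- t * (of_int n)\<^sup>2)) has_sum theta3 t * theta3 t) (UNIV :: (int \<times> int) set)"
    by (intro has_sum_mult_real has_sum_theta3 assms)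
  have "((\<lambda>(a,b). exp (- (2*t) * (of_int a)\<^sup>2) * exp (- (2*t) * (of_int b)\<^sup>2)) has_sum theta3 (2*t) * theta3 (2*t)) (UNIV :: (int \<times> int) set)"
    by (intro has_sum_mult_real has_sum_theta3 t2)
  then show "((\<lambda>(a, b). case (a + b, a - b) of (m, n) \<Rightarrow> exp (- t * (of_int m)\<^sup>2) * exp (- t * (of_int n)\<^sup>2)) has_sum (theta3 (2*t))\<^sup>2) (UNIV :: (int \<times> int) set)"
    by (simp add: power2_eq_square flip: exp_add) (simp add: algebra_simps)
  have "((\<lambda>(a,b). exp (- (2*t) * (of_int a + 1/2)\<^sup>2) * exp (- (2*t) * (of_int b + 1/2)\<^sup>2)) has_sum theta2 (2*t) * theta2 (2*t)) (UNIV :: (int \<times> int) set)"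
    by (intro has_sum_mult_real has_sum_theta2 t2)
  then show "((\<lambda>(a, b). case (a + b + 1, a - b) of (m, n) \<Rightarrow> exp (- t * (of_int m)\<^sup>2) * exp (- t * (of_int n)\<^sup>2)) has_sum (theta2 (2*t))\<^sup>2) (UNIV :: (int \<times> int) set)"
    by (simp add: power2_eq_square flip: exp_add) (simp add: algebra_simps)
qed

lemma theta4_square: 
  assumes "t > 0" shows "(theta4 t)\<^sup>2 = (theta3 (2*t))\<^sup>2 - (theta2 (2*t))\<^sup>2"
  unfolding power2_eq_square[of "theta4 t"] diff_conv_add_uminus
proof (rule has_sum_rotate_lattice)
  have t2: "2*t > 0" using assms by simp
  show "((\<lambda>(m, n). (alt_sign m * exp (- t * (of_int m)\<^sup>2)) * (alt_sign n * exp (- t * (of_int n)\<^sup>2))) has_sum theta4 t * theta4 t) (UNIV :: (int \<times> int) set)"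
    by (intro has_sum_mult_real has_sum_theta4 assms)
  have "((\<lambda>(a,b). exp (- (2*t) * (of_int a)\<^sup>2) * exp (- (2*t) * (of_int b)\<^sup>2)) has_sum theta3 (2*t) * theta3 (2*t)) (UNIV :: (int \<times> int) set)"
    by (intro has_sum_mult_real has_sum_theta3 t2)
  moreover have "(alt_sign (a+b) * exp (- t * (of_int (a+b))\<^sup>2)) * (alt_sign (a-b) * exp (- t * (of_int (a-b))\<^sup>2))
      = exp (- (2*t) * (of_int a)\<^sup>2) * exp (- (2*t) * (of_int b)\<^sup>2)" for a b :: int
    by (simp add: alt_sign_def power2_eq_square flip: exp_add) (simp add: algebra_simps)
  ultimately show "((\<lambda>(a, b). case (a + b, a - b) of (m, n) \<Rightarrow> (alt_sign m * exp (- t * (of_int m)\<^sup>2)) * (alt_sign n * exp (- t * (of_int n)\<^sup>2))) has_sum (theta3 (2*t))\<^sup>2) (UNIV :: (int \<times> int) set)"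
    by (simp add: power2_eq_square)
  have "((\<lambda>(a,b). exp (- (2*t) * (of_int a + 1/2)\<^sup>2) * exp (- (2*t) * (of_int b + 1/2)\<^sup>2)) has_sum theta2 (2*t) * theta2 (2*t)) (UNIV :: (int \<times> int) set)"
    by (intro has_sum_mult_real has_sum_theta2 t2)
  then have "((\<lambda>x. - (case x of (a,b) \<Rightarrow> exp (- (2*t) * (of_int a + 1/2)\<^sup>2) * exp (- (2*t) * (of_int b + 1/2)\<^sup>2))) has_sum - (theta2 (2*t))\<^sup>2) (UNIV :: (int \<times> int) set)"
    by (subst has_sum_uminus) (simp add: power2_eq_square)
  moreover have "(alt_sign (a+b+1) * exp (- t * (of_int (a+b+1))\<^sup>2)) * (alt_sign (a-b) * exp (- t * (of_int (a-b))\<^sup>2))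
      = - (exp (- (2*t) * (of_int a + 1/2)\<^sup>2) * exp (- (2*t) * (of_int b + 1/2)\<^sup>2))" for a b :: int
    by (simp add: alt_sign_def power2_eq_square flip: exp_add) (simp add: algebra_simps)
  ultimately show "((\<lambda>(a, b). case (a + b + 1, a - b) of (m, n) \<Rightarrow> (alt_sign m * exp (- t * (of_int m)\<^sup>2)) * (alt_sign n * exp (- t * (of_int n)\<^sup>2))) has_sum - (theta2 (2*t))\<^sup>2) (UNIV :: (int \<times> int) set)"
    by (simp add: case_prod_unfold)
qed

lemma theta3_theta4: 
  assumes "t > 0" shows "theta3 t * theta4 t = (theta4 (2*t))\<^sup>2"
proof -
  have t2: "2*t > 0" using assms by simp
  have "theta3 t * theta4 t = (theta4 (2*t))\<^sup>2 + 0"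
  proof (rule has_sum_rotate_lattice)
    show "((\<lambda>(m, n). exp (- t * (of_int m)\<^sup>2) * (alt_sign n * exp (- t * (of_int n)\<^sup>2))) has_sum theta3 t * theta4 t) (UNIV :: (int \<times> int) set)"
      by (intro has_sum_mult_real has_sum_theta3 has_sum_theta4 assms)
    have "((\<lambda>(a,b). (alt_sign a * exp (- (2*t) * (of_int a)\<^sup>2)) * (alt_sign b * exp (- (2*t) * (of_int b)\<^sup>2))) has_sum theta4 (2*t) * theta4 (2*t)) (UNIV :: (int \<times> int) set)"
      by (intro has_sum_mult_real has_sum_theta4 t2)
    moreover have "exp (- t * (of_int (a+b))\<^sup>2) * (alt_sign (a-b) * exp (- t * (of_int (a-b))\<^sup>2))
        = (alt_sign a * exp (- (2*t) * (of_int a)\<^sup>2)) * (alt_sign b * exp (- (2*t) * (of_int b)\<^sup>2))" for a b :: int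
      by (simp add: alt_sign_def power2_eq_square flip: exp_add) (simp add: algebra_simps)
    ultimately show "((\<lambda>(a, b). case (a + b, a - b) of (m, n) \<Rightarrow> exp (- t * (of_int m)\<^sup>2) * (alt_sign n * exp (- t * (of_int n)\<^sup>2))) has_sum (theta4 (2*t))\<^sup>2) (UNIV :: (int \<times> int) set)"
      by (simp add: power2_eq_square)
    have "((\<lambda>(a,b). (alt_sign a * exp (- (2*t) * (of_int a + 1/2)\<^sup>2)) * (alt_sign b * exp (- (2*t) * (of_int b + 1/2)\<^sup>2))) has_sum 0 * 0) (UNIV :: (int \<times> int) set)"
      by (intro has_sum_mult_real alternating_half_integer_sum t2)
    moreover have "exp (- t * (of_int (a+b+1))\<^sup>2) * (alt_sign (a-b) * exp (- t * (of_int (a-b))\<^sup>2))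
        = (alt_sign a * exp (- (2*t) * (of_int a + 1/2)\<^sup>2)) * (alt_sign b * exp (- (2*t) * (of_int b + 1/2)\<^sup>2))" for a b :: int
      by (simp add: alt_sign_def power2_eq_square flip: exp_add) (simp add: algebra_simps)
    ultimately show "((\<lambda>(a, b). case (a + b + 1, a - b) of (m, n) \<Rightarrow> exp (- t * (of_int m)\<^sup>2) * (alt_sign n * exp (- t * (of_int n)\<^sup>2))) has_sum 0) (UNIV :: (int \<times> int) set)"
      by (simp add: power2_eq_square)
  qed
  then show ?thesis by simp
qed

lemma has_sum_shift_int:
  fixes f :: "int \<Rightarrow> real"
  assumes "(f has_sum S) UNIV" shows "((\<lambda>n. f (n + k)) has_sum S) UNIV"
proof -
  have "bij_betw (\<lambda>n::int. n + k) UNIV UNIV"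
    by (rule bij_betwI[where g = "\<lambda>n. n - k"]) auto
  from has_sum_reindex_bij_betw[OF this, of f] assms show ?thesis by simp
qed

lemma theta2_square: 
  assumes "t > 0" shows "(theta2 t)\<^sup>2 = theta3 (2*t) * theta2 (2*t) + theta3 (2*t) * theta2 (2*t)"
  unfolding power2_eq_square[of "theta2 t"]
proof (rule has_sum_rotate_lattice)
  have t2: "2*t > 0" using assms by simp
  show "((\<lambda>(m, n). exp (- t * (of_int m + 1/2)\<^sup>2) * exp (- t * (of_int n + 1/2)\<^sup>2)) has_sum theta2 t * theta2 t) (UNIV :: (int \<times> int) set)"
    by (intro has_sum_mult_real has_sum_theta2 assms)
  have "((\<lambda>(a,b). exp (- (2*t) * (of_int a + 1/2)\<^sup>2) * exp (- (2*t) * (of_int b)\<^sup>2)) has_sum theta2 (2*t) * theta3 (2*t)) (UNIV :: (int \<times> int) set)"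
    by (intro has_sum_mult_real has_sum_theta3 has_sum_theta2 t2)
  then show "((\<lambda>(a, b). case (a + b, a - b) of (m, n) \<Rightarrow> exp (- t * (of_int m + 1/2)\<^sup>2) * exp (- t * (of_int n + 1/2)\<^sup>2)) has_sum (theta3 (2*t) * theta2 (2*t))) (UNIV :: (int \<times> int) set)"
    by (simp add: power2_eq_square flip: exp_add) (simp add: algebra_simps)
  have "((\<lambda>(a,b). exp (- (2*t) * (of_int (a + 1))\<^sup>2) * exp (- (2*t) * (of_int b + 1/2)\<^sup>2)) has_sum theta3 (2*t) * theta2 (2*t)) (UNIV :: (int \<times> int) set)"
    by (intro has_sum_mult_real has_sum_theta2 has_sum_shift_int[OF has_sum_theta3] t2)
  then show "((\<lambda>(a, b). case (a + b + 1, a - b) of (m, n) \<Rightarrow> exp (- t * (of_int m + 1/2)\<^sup>2) * exp (- t * (of_int n + 1/2)\<^sup>2)) has_sum (theta3 (2*t) * theta2 (2*t))) (UNIV :: (int \<times> int) set)"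
    by (simp add: power2_eq_square flip: exp_add) (simp add: algebra_simps)
qed

text \<open>
  Even and odd n in theta3 give theta3 and theta2; thus theta2 inherits its behaviour near 0
  from theta3.
\<close>
lemma theta3_even_odd_split:
  assumes "t > 0" shows "theta3 t = theta3 (4*t) + theta2 (4*t)"
proof -
  have t4: "4*t > 0" using assms by simp
  let ?f = "\<lambda>n::int. exp (- t * (of_int n)\<^sup>2)"
  have "bij_betw (\<lambda>n::int. 2*n) UNIV {n. even n}"
    by (rule bij_betwI[where g = "\<lambda>n. n div 2"]) auto
  from has_sum_reindex_bij_betw[OF this, of ?f] has_sum_theta3[OF t4]
  have "(?f has_sum theta3 (4*t)) {n. even n}" by (simp add: power2_eq_square algebra_simps)
  moreover have "bij_betw (\<lambda>n::int. 2*n+1) UNIV (-{n. even n})"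
    by (rule bij_betwI[where g = "\<lambda>n. n div 2"]) auto
  from has_sum_reindex_bij_betw[OF this, of ?f] has_sum_theta2[OF t4]
  have "(?f has_sum theta2 (4*t)) (-{n. even n})" by (simp add: power2_eq_square algebra_simps)
  ultimately have "(?f has_sum (theta3 (4*t) + theta2 (4*t))) ({n. even n} \<union> -{n. even n})"
    by (intro has_sum_Un_disjoint) auto
  with has_sum_theta3[OF assms] show ?thesis
    using has_sum_unique by (metis Compl_partition)
qed

section \<open>Complete elliptic integrals and the arithmetic-geometric mean\<close>

lemma absolutely_integrable_integral_cong:
  fixes f g :: "real \<Rightarrow> real"
  assumes "\<And>x. x \<in> S \<Longrightarrow> f x = g x"
  shows "f absolutely_integrable_on S \<and> integral S f = c \<longleftrightarrow> g absolutely_integrable_on S \<and> integral S g = c"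
  using assms integral_cong[of S f g] set_integrable_cong[of lebesgue lebesgue S S f g] by auto

text \<open>
  The case of equal parameters of the elliptic integral below, and its majorant in general.
\<close>
lemma integral_inverse_square_plus_square:
  fixes a :: real
  assumes "a > 0"
  shows "(\<lambda>t. 1 / (a\<^sup>2 + t\<^sup>2)) absolutely_integrable_on UNIV" (is "?A")
    and "integral UNIV (\<lambda>t. 1 / (a\<^sup>2 + t\<^sup>2)) = pi / a" (is "?B")
proof -
  define S where "S = {-(pi/2)<..<pi/2}"
  have cos: "cos x > 0" if "x \<in> S" for x
    using that unfolding S_def by (intro cos_gt_zero_pi) auto
  have eq: "\<bar>a / (cos x)\<^sup>2\<bar> * (1 / (a\<^sup>2 + (a * tan x)\<^sup>2)) = 1 / a" if "x \<in> S" for x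
  proof -
    have "a\<^sup>2 + (a * tan x)\<^sup>2 = a\<^sup>2 * (1 + (tan x)\<^sup>2)" by (simp add: algebra_simps)
    also have "1 + (tan x)\<^sup>2 = 1 / (cos x)\<^sup>2"
      using tan_sec[of x] cos[OF that] by (simp add: inverse_eq_divide power_divide)
    finally show ?thesis
      using cos[OF that] assms by (simp add: power2_eq_square field_simps)
  qed
  have img: "(\<lambda>x. a * tan x) ` S = UNIV"
  proof -
    have "y = a * tan (arctan (y / a))" for y using assms by (simp add: tan_arctan)
    then show ?thesis
      unfolding S_def using arctan_bounded by (metis (no_types, lifting) UNIV_eq_I greaterThanLessThan_iff image_eqI)
  qed
  have "inj_on (\<lambda>x. a * tan x) S"
    using assms arctan_tan by (auto simp: S_def inj_on_def) (metis minus_divide_left)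
  have *: "(\<lambda>x. \<bar>a / (cos x)\<^sup>2\<bar> * (1 / (a\<^sup>2 + (a * tan x)\<^sup>2))) absolutely_integrable_on S \<and>
       integral S (\<lambda>x. \<bar>a / (cos x)\<^sup>2\<bar> * (1 / (a\<^sup>2 + (a * tan x)\<^sup>2))) = pi / a
       \<longleftrightarrow> (\<lambda>t. 1 / (a\<^sup>2 + t\<^sup>2)) absolutely_integrable_on ((\<lambda>x. a * tan x) ` S) \<and>
           integral ((\<lambda>x. a * tan x) ` S) (\<lambda>t. 1 / (a\<^sup>2 + t\<^sup>2)) = pi / a"
  proof (rule has_absolute_integral_change_of_variables_1')
    show "((\<lambda>x. a * tan x) has_field_derivative a / (cos x)\<^sup>2) (at x within S)" if "x \<in> S" for x
      using cos[OF that] by (auto intro!: derivative_eq_intros simp: field_simps power2_eq_square)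
  qed (use \<open>inj_on _ S\<close> in \<open>auto simp: S_def\<close>)
  have "(\<lambda>x. 1 / a :: real) absolutely_integrable_on S"
    unfolding S_def by (intro absolutely_integrable_on_const) auto
  moreover have "integral S (\<lambda>x. 1 / a) = pi / a"
    unfolding S_def by (simp flip: integral_open_interval_real)
  ultimately have "(\<lambda>x. \<bar>a / (cos x)\<^sup>2\<bar> * (1 / (a\<^sup>2 + (a * tan x)\<^sup>2))) absolutely_integrable_on S \<and>
       integral S (\<lambda>x. \<bar>a / (cos x)\<^sup>2\<bar> * (1 / (a\<^sup>2 + (a * tan x)\<^sup>2))) = pi / a"
    using eq by (simp cong: set_integrable_cong integral_cong)
  with * show ?A ?B by (simp_all add: img)
qed

text \<open>
  Gauss's complete elliptic integral, whose value is pi divided by the arithmetic-geometric mean of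
  a and b. Integration over the whole line makes the Landen transformation a single substitution.
\<close>
definition ellint :: "real \<Rightarrow> real \<Rightarrow> real" where
  "ellint a b = integral UNIV (\<lambda>t. 1 / sqrt ((a\<^sup>2 + t\<^sup>2) * (b\<^sup>2 + t\<^sup>2)))"

lemma ellint_integrand_le:
  assumes "0 < (c::real)" "c \<le> a" "c \<le> b"
  shows "1 / sqrt ((a\<^sup>2 + t\<^sup>2) * (b\<^sup>2 + t\<^sup>2)) \<le> 1 / (c\<^sup>2 + t\<^sup>2)"
proof -
  have "sqrt ((c\<^sup>2 + t\<^sup>2) * (c\<^sup>2 + t\<^sup>2)) \<le> sqrt ((a\<^sup>2 + t\<^sup>2) * (b\<^sup>2 + t\<^sup>2))"
    using assms by (intro real_sqrt_le_mono mult_mono add_right_mono power_mono) auto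
  then show ?thesis using assms by (intro divide_left_mono) (auto simp: add_pos_nonneg)
qed

lemma ellint_integrand_ge:
  assumes "0 < a" "0 < b" "a \<le> c" "b \<le> (c::real)"
  shows "1 / (c\<^sup>2 + t\<^sup>2) \<le> 1 / sqrt ((a\<^sup>2 + t\<^sup>2) * (b\<^sup>2 + t\<^sup>2))"
proof -
  have "sqrt ((a\<^sup>2 + t\<^sup>2) * (b\<^sup>2 + t\<^sup>2)) \<le> sqrt ((c\<^sup>2 + t\<^sup>2) * (c\<^sup>2 + t\<^sup>2))"
    using assms by (intro real_sqrt_le_mono mult_mono add_right_mono power_mono) auto
  then show ?thesis using assms by (intro divide_left_mono) (auto simp: add_pos_nonneg)
qed

lemma continuous_ellint_integrand:
  assumes "0 < a" "0 < b"
  shows "continuous_on S (\<lambda>t. 1 / sqrt ((a\<^sup>2 + t\<^sup>2) * (b\<^sup>2 + t\<^sup>2 :: real)))"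
proof -
  have "0 < (a\<^sup>2 + t\<^sup>2) * (b\<^sup>2 + t\<^sup>2)" for t
    using assms by (simp add: add_pos_nonneg)
  then show ?thesis by (intro continuous_intros ballI) (metis less_irrefl real_sqrt_eq_zero_cancel_iff)
qed

lemma ellint_integrable:
  assumes "0 < a" "0 < b"
  shows "(\<lambda>t. 1 / sqrt ((a\<^sup>2 + t\<^sup>2) * (b\<^sup>2 + t\<^sup>2 :: real))) absolutely_integrable_on UNIV"
proof (rule measurable_bounded_by_integrable_imp_absolutely_integrable)
  show "(\<lambda>t. 1 / sqrt ((a\<^sup>2 + t\<^sup>2) * (b\<^sup>2 + t\<^sup>2))) \<in> borel_measurable (lebesgue_on UNIV)"
    using continuous_ellint_integrand[OF assms]
    by (intro continuous_imp_measurable_on_sets_lebesgue) auto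
  show "(\<lambda>t. 1 / ((min a b)\<^sup>2 + t\<^sup>2)) integrable_on UNIV"
    using assms by (intro set_lebesgue_integral_eq_integral(1)[OF integral_inverse_square_plus_square(1)]) auto
  show "norm (1 / sqrt ((a\<^sup>2 + t\<^sup>2) * (b\<^sup>2 + t\<^sup>2))) \<le> 1 / ((min a b)\<^sup>2 + t\<^sup>2)" for t
    using ellint_integrand_le[of "min a b" a b t] assms by simp
qed auto

lemma ellint_le:
  assumes "0 < c" "c \<le> a" "c \<le> b"
  shows "ellint a b \<le> pi / c"
  unfolding ellint_def integral_inverse_square_plus_square(2)[OF assms(1), symmetric]
proof (rule integral_le)
  show "(\<lambda>t. 1 / sqrt ((a\<^sup>2 + t\<^sup>2) * (b\<^sup>2 + t\<^sup>2))) integrable_on UNIV"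
    using assms by (intro set_lebesgue_integral_eq_integral(1)[OF ellint_integrable]) auto
  show "(\<lambda>t. 1 / (c\<^sup>2 + t\<^sup>2)) integrable_on UNIV"
    using assms by (intro set_lebesgue_integral_eq_integral(1)[OF integral_inverse_square_plus_square(1)]) auto
qed (use ellint_integrand_le assms in blast)

lemma ellint_ge:
  assumes "0 < a" "0 < b" "a \<le> c" "b \<le> c"
  shows "pi / c \<le> ellint a b"
proof -
  have "0 < c" using assms by simp
  then show ?thesis
    unfolding ellint_def integral_inverse_square_plus_square(2)[OF \<open>0 < c\<close>, symmetric]
  proof (intro integral_le)
    show "(\<lambda>t. 1 / sqrt ((a\<^sup>2 + t\<^sup>2) * (b\<^sup>2 + t\<^sup>2))) integrable_on UNIV"
      using assms by (intro set_lebesgue_integral_eq_integral(1)[OF ellint_integrable]) auto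
    show "(\<lambda>t. 1 / (c\<^sup>2 + t\<^sup>2)) integrable_on UNIV"
      using \<open>0 < c\<close> by (intro set_lebesgue_integral_eq_integral(1)[OF integral_inverse_square_plus_square(1)]) auto
  qed (use ellint_integrand_ge assms in blast)
qed

lemma ellint_commute: "ellint a b = ellint b a"
  by (simp add: ellint_def mult.commute)

text \<open>
  The integrand is strictly decreasing in the second parameter.
\<close>
lemma ellint_inj:
  assumes "0 < a" "0 < b" "0 < c" "ellint a b = ellint a c"
  shows "b = c"
proof -
  have "False" if "0 < b" "b < c" "ellint a b = ellint a c" for b c
  proof -
    let ?f = "\<lambda>b t. 1 / sqrt ((a\<^sup>2 + t\<^sup>2) * (b\<^sup>2 + t\<^sup>2))"
    have c: "c > 0" using that by simp
    let ?D = "\<lambda>t. ?f b t - ?f c t"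
    have int: "?f b integrable_on UNIV" "?f c integrable_on UNIV"
      by (intro set_lebesgue_integral_eq_integral(1)[OF ellint_integrable] assms that c)+
    have pos: "?D t > 0" for t
    proof -
      have "sqrt ((a\<^sup>2 + t\<^sup>2) * (b\<^sup>2 + t\<^sup>2)) < sqrt ((a\<^sup>2 + t\<^sup>2) * (c\<^sup>2 + t\<^sup>2))"
        using assms(1) that
        by (intro real_sqrt_less_mono mult_strict_left_mono add_strict_right_mono power_strict_mono)
           (auto simp: add_pos_nonneg)
      then show ?thesis using assms(1) that by (auto intro!: divide_strict_left_mono simp: add_pos_nonneg)
    qed
    have cont: "continuous_on {0..1} ?D"
      by (intro continuous_on_diff continuous_ellint_integrand assms that c)
    have "integral {0..1} ?D \<le> integral UNIV ?D"
      by (rule integral_subset_le)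
         (use int cont pos in \<open>auto intro!: integrable_diff integrable_continuous_real less_imp_le\<close>)
    also have "\<dots> = 0"
      using that(3) int by (simp add: ellint_def Henstock_Kurzweil_Integration.integral_diff)
    finally have "integral {0..1} ?D \<le> 0" .
    moreover have "integral {0..1} ?D \<ge> 0"
      by (rule integral_nonneg) (use cont pos in \<open>auto intro!: integrable_continuous_real less_imp_le\<close>)
    ultimately have zero: "integral {0..1} ?D = 0" by simp
    have iff: "integral {0..1} ?D = 0 \<longleftrightarrow> (\<forall>t\<in>{0..1}. ?D t = 0)"
      by (rule integral_eq_0_iff[OF cont]) (use pos in \<open>auto intro: less_imp_le\<close>)
    have "\<forall>t\<in>{0..1}. ?D t = 0" by (rule iffD1[OF iff zero])
    then have "?D 0 = 0" by (rule bspec) simp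
    with pos[of 0] show False by linarith
  qed
  from this[of b c] this[of c b] assms show ?thesis by fastforce
qed

lemma integral_even_UNIV:
  fixes f :: "real \<Rightarrow> real"
  assumes "f absolutely_integrable_on UNIV" "\<And>t. f (- t) = f t"
  shows "integral UNIV f = 2 * integral {0<..} f"
proof -
  have int: "f absolutely_integrable_on S" if "S \<in> sets lebesgue" for S
    using assms(1) that by (rule set_integrable_subset) auto
  have "(\<lambda>x. f (- x)) absolutely_integrable_on {0<..} \<and> integral {0<..} (\<lambda>x. f (-x)) = integral {0<..} f
     \<longleftrightarrow> f absolutely_integrable_on {..<0} \<and> integral {..<0} f = integral {0<..} f"
    by (rule has_absolute_integral_reflect_real) auto
  then have neg: "integral {..<0} f = integral {0<..} f"
    using int[of "{0<..}"] assms(2) by simp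
  have disj: "{..<0} \<inter> {0<..} = ({} :: real set)" by auto
  have "integral UNIV f = integral ({..<0} \<union> {0<..}) f"
    by (rule integral_spike_set) (auto intro: negligible_subset[of "{0}"])
  also have "\<dots> = integral {..<0} f + integral {0<..} f"
    by (rule integral_Un) (auto intro!: set_lebesgue_integral_eq_integral(1)[OF int] simp: disj)
  finally show ?thesis using neg by simp
qed

lemma ellint_half_line:
  assumes "0 < a" "0 < b"
  shows "ellint a b = 2 * integral {0<..} (\<lambda>t. 1 / sqrt ((a\<^sup>2 + t\<^sup>2) * (b\<^sup>2 + t\<^sup>2)))"
  unfolding ellint_def by (rule integral_even_UNIV) (use ellint_integrable assms in auto)

text \<open>
  The substitution u = (t - b^2 / t) / 2 maps the positive half-line increasingly onto the line. It
  makes 4 t^2 (b^2 + u^2) the square of t^2 + b^2, which du cancels, and 4 t^2 (a^2 + u^2) the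
  quartic under the root. This quartic factors when a and b are two means, and it loses its middle
  term when b = sqrt 2 a; the next two lemmas are these cases.
\<close>
lemma ellint_landen:
  assumes a: "0 < a" and b: "0 < b"
  shows "(\<lambda>t. 1 / sqrt (t^4 + (4 * a\<^sup>2 - 2 * b\<^sup>2) * t\<^sup>2 + b^4)) absolutely_integrable_on {0<..}" (is ?A)
    and "ellint a b = 2 * integral {0<..} (\<lambda>t. 1 / sqrt (t^4 + (4 * a\<^sup>2 - 2 * b\<^sup>2) * t\<^sup>2 + b^4))" (is ?B)
proof -
  define u where "u = (\<lambda>t. (t - b\<^sup>2 / t) / 2)"
  define u' where "u' = (\<lambda>t. (1 + b\<^sup>2 / t\<^sup>2) / 2)"
  let ?f = "\<lambda>t. 1 / sqrt ((a\<^sup>2 + t\<^sup>2) * (b\<^sup>2 + t\<^sup>2))"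
  let ?g = "\<lambda>t. 1 / sqrt (t^4 + (4 * a\<^sup>2 - 2 * b\<^sup>2) * t\<^sup>2 + b^4)"
  have eq: "\<bar>u' t\<bar> * ?f (u t) = 2 * ?g t" if "t > 0" for t
  proof -
    have 1: "a\<^sup>2 + (u t)\<^sup>2 = (t^4 + (4 * a\<^sup>2 - 2 * b\<^sup>2) * t\<^sup>2 + b^4) / (4 * t\<^sup>2)"
      and 2: "b\<^sup>2 + (u t)\<^sup>2 = ((t\<^sup>2 + b\<^sup>2) / (2 * t))\<^sup>2"
      using that by (simp_all add: u_def field_simps power2_eq_square eval_nat_numeral)
    have 3: "sqrt ((a\<^sup>2 + (u t)\<^sup>2) * (b\<^sup>2 + (u t)\<^sup>2)) 
        = sqrt (t^4 + (4 * a\<^sup>2 - 2 * b\<^sup>2) * t\<^sup>2 + b^4) / (2 * t) * ((t\<^sup>2 + b\<^sup>2) / (2 * t))"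
      using that unfolding 1 2 real_sqrt_mult real_sqrt_divide
      by (simp add: real_sqrt_mult add_nonneg_nonneg)
    have 4: "u' t = (t\<^sup>2 + b\<^sup>2) / (2 * t\<^sup>2)"
      using that by (simp add: u'_def field_simps)
    have pos: "0 < t\<^sup>2 + b\<^sup>2" using that by (simp add: add_pos_nonneg)
    show ?thesis
      using that pos unfolding 3 4 
      by (simp add: abs_mult divide_simps power2_eq_square)
  qed
  have mono: "u s < u t" if "0 < s" "s < t" for s t
  proof -
    have "b\<^sup>2 / t \<le> b\<^sup>2 / s" using that by (intro divide_left_mono) auto
    then show ?thesis using that unfolding u_def by (intro divide_strict_right_mono) linarith+
  qed
  have inj: "inj_on u {0<..}"
    by (rule inj_onI) (metis greaterThan_iff linorder_neqE_linordered_idom mono less_irrefl)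
  have img: "u ` {0<..} = UNIV"
  proof -
    have "\<exists>t>0. u t = y" for y
    proof (intro exI conjI)
      let ?t = "y + sqrt (y\<^sup>2 + b\<^sup>2)"
      have "\<bar>y\<bar> < sqrt (y\<^sup>2 + b\<^sup>2)"
        using b by (intro real_less_rsqrt) auto
      then show "?t > 0" by linarith
      moreover have "(sqrt (y\<^sup>2 + b\<^sup>2))\<^sup>2 = y\<^sup>2 + b\<^sup>2" by simp
      then have "?t\<^sup>2 - b\<^sup>2 = 2 * y * ?t"
        by (simp add: power2_eq_square algebra_simps)
      ultimately show "u ?t = y" 
        by (simp add: u_def field_simps power2_eq_square del: real_sqrt_mult_self)
    qed
    then show ?thesis by (metis UNIV_eq_I greaterThan_iff image_eqI)
  qed
  have *: "(\<lambda>t. \<bar>u' t\<bar> * ?f (u t)) absolutely_integrable_on {0<..} \<and>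
      integral {0<..} (\<lambda>t. \<bar>u' t\<bar> * ?f (u t)) = ellint a b
      \<longleftrightarrow> ?f absolutely_integrable_on (u ` {0<..}) \<and> integral (u ` {0<..}) ?f = ellint a b"
  proof (rule has_absolute_integral_change_of_variables_1'[OF _ _ inj])
    show "(u has_field_derivative u' t) (at t within {0<..})" if "t \<in> {0<..}" for t
      unfolding u_def u'_def using that
      by (auto intro!: derivative_eq_intros simp: field_simps power2_eq_square)
  qed auto
  have "(\<lambda>t. \<bar>u' t\<bar> * ?f (u t)) absolutely_integrable_on {0<..} \<and>
      integral {0<..} (\<lambda>t. \<bar>u' t\<bar> * ?f (u t)) = ellint a b"
    unfolding * img using ellint_integrable[OF a b] by (simp add: ellint_def)
  then have 5: "(\<lambda>t. 2 * ?g t) absolutely_integrable_on {0<..} \<and>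
      integral {0<..} (\<lambda>t. 2 * ?g t) = ellint a b"
    by (subst (asm) absolutely_integrable_integral_cong[where g = "\<lambda>t. 2 * ?g t"]) (use eq in auto)
  then have 6: "(\<lambda>t. 2 * ?g t) absolutely_integrable_on {0<..}" by blast
  have "(\<lambda>t. (1/2) * (2 * ?g t)) absolutely_integrable_on {0<..}"
    by (rule set_integrable_mult_right) (rule 6)
  then show ?A by simp
  have "integral {0<..} (\<lambda>t. 2 * ?g t) = 2 * integral {0<..} ?g"
    by (rule Henstock_Kurzweil_Integration.integral_mult_right)
  with 5 show ?B by argo
qed

lemma ellint_agm_step:
  assumes "0 < a" "0 < b"
  shows "ellint ((a + b) / 2) (sqrt (a * b)) = ellint a b"
proof -
  have "ellint ((a + b) / 2) (sqrt (a * b)) = 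
    2 * integral {0<..} (\<lambda>t. 1 / sqrt (t^4 + (4 * ((a + b) / 2)\<^sup>2 - 2 * (sqrt (a * b))\<^sup>2) * t\<^sup>2 + (sqrt (a * b))^4))"
    using assms by (intro ellint_landen) auto
  moreover have "t^4 + (4 * ((a + b) / 2)\<^sup>2 - 2 * (sqrt (a * b))\<^sup>2) * t\<^sup>2 + (sqrt (a * b))^4
     = (a\<^sup>2 + t\<^sup>2) * (b\<^sup>2 + t\<^sup>2)" for t
  proof -
    have s: "(sqrt (a * b))\<^sup>2 = a * b" using assms by simp
    then have "(sqrt (a * b))^4 = (a * b)\<^sup>2" 
      by (metis numeral_Bit0 power2_eq_square power_add)
    then show ?thesis unfolding s by (simp add: power2_eq_square eval_nat_numeral field_simps)
  qed
  ultimately show ?thesis using ellint_half_line[OF assms] by simp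
qed

text \<open>
  The quartic is t^4 + x^4, and v = t^4 / (x^4 + t^4) turns the integral into Euler's integral for
  Beta (1/4) (1/4), up to the factor 4 x.
\<close>
lemma ellint_lemniscatic:
  assumes x: "0 < x"
  shows "ellint x (x / sqrt 2) = (Gamma (1/4))\<^sup>2 / (2 * sqrt pi * x)"
proof -
  let ?g = "\<lambda>t. 1 / sqrt (t^4 + x^4)"
  let ?b = "\<lambda>v::real. v powr (1/4 - 1) * (1 - v) powr (1/4 - 1)"
  define v where "v = (\<lambda>t. t^4 / (x^4 + t^4))"
  define v' where "v' = (\<lambda>t. 4 * t^3 * x^4 / (x^4 + t^4)\<^sup>2)"
  have pos: "0 < x^4 + t^4" for t using x by (simp add: add_pos_nonneg)
  have "4 * (x / sqrt 2)\<^sup>2 - 2 * x\<^sup>2 = 0" by (simp add: power_divide)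
  note zero = this
  have L: "?g absolutely_integrable_on {0<..}" "ellint x (x / sqrt 2) = 2 * integral {0<..} ?g"
    using ellint_landen[of "x / sqrt 2" x] x unfolding zero by (simp_all add: ellint_commute)
  have eq: "\<bar>v' t\<bar> * ?b (v t) = 4 * x * ?g t" if "t > 0" for t
  proof -
    let ?s = "x^4 + t^4"
    have 1: "1 - v t = x^4 / ?s" using pos[of t] by (simp add: v_def field_simps)
    have p4: "(y^4) powr (- 3/4) = 1 / y^3" if "y > 0" for y :: real
    proof -
      have "(y^4) powr (- 3/4) = (y powr 4) powr (- 3/4)" using that by simp
      also have "\<dots> = y powr (- 3)" by (simp only: powr_powr) simp
      also have "\<dots> = 1 / y powr 3" by (rule powr_minus_divide)
      also have "\<dots> = 1 / y^3" using that by simp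
      finally show ?thesis .
    qed
    have "?b (v t) = ((t^4) powr (-3/4) / ?s powr (-3/4)) * ((x^4) powr (-3/4) / ?s powr (-3/4))"
      unfolding 1 using pos[of t] that x by (simp add: v_def powr_divide)
    also have "\<dots> = 1 / (t^3 * x^3 * (?s powr (-3/4) * ?s powr (-3/4)))"
      unfolding p4[OF that] p4[OF x] by simp
    also have "?s powr (-3/4) * ?s powr (-3/4) = ?s powr (-3/2)"
      by (simp only: powr_add[symmetric]) simp
    also have "?s powr (-3/2) = sqrt ?s / ?s\<^sup>2"
    proof -
      have "?s powr (-3/2) = ?s powr (1/2) / ?s powr 2"
        by (simp only: powr_diff[symmetric]) simp
      then show ?thesis using pos[of t] by (simp add: powr_half_sqrt)
    qed
    finally have "?b (v t) = 1 / (t^3 * x^3 * (sqrt ?s / ?s\<^sup>2))" .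
    moreover have "\<bar>v' t\<bar> = 4 * t^3 * x^4 / ?s\<^sup>2"
      using that x pos[of t] by (simp add: v'_def)
    moreover have "4 * t^3 * x^4 / s\<^sup>2 * (1 / (t^3 * x^3 * (r / s\<^sup>2))) = 4 * x * (1 / r)" if "s > 0" "r > 0" for s r
      using that \<open>t > 0\<close> x by (simp add: field_simps eval_nat_numeral)
    ultimately show ?thesis using pos[of t] by (simp add: add.commute)
  qed
  have mono: "v s < v t" if "0 < s" "s < t" for s t
  proof -
    have "s^4 < t^4" using that by (intro power_strict_mono) auto
    then have "s^4 * x^4 < t^4 * x^4" using x by simp
    then show ?thesis using pos[of s] pos[of t] by (simp add: v_def divide_simps algebra_simps)
  qed
  have inj: "inj_on v {0<..}"
    by (rule inj_onI) (metis greaterThan_iff linorder_neqE_linordered_idom mono less_irrefl)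
  have img: "v ` {0<..} = {0<..<1}"
  proof (intro equalityI subsetI)
    fix y assume "y \<in> v ` {0<..}"
    then obtain t where "t > 0" "y = v t" by auto
    then show "y \<in> {0<..<1}" using pos[of t] x by (auto simp: v_def)
  next
    fix y :: real assume y: "y \<in> {0<..<1}"
    define t where "t = x * root 4 (y / (1 - y))"
    have "t^4 = x^4 * (y / (1 - y))" using y by (simp add: t_def power_mult_distrib real_root_pow_pos2)
    moreover have "x^4 + x^4 * (y / (1 - y)) = x^4 / (1 - y)" using y by (simp add: field_simps)
    ultimately have "v t = y" using x y by (simp add: v_def)
    moreover have "t > 0" using x y by (simp add: t_def)
    ultimately show "y \<in> v ` {0<..}" by force
  qed
  have *: "(\<lambda>t. \<bar>v' t\<bar> * ?b (v t)) absolutely_integrable_on {0<..} \<and>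
      integral {0<..} (\<lambda>t. \<bar>v' t\<bar> * ?b (v t)) = integral {0<..} (\<lambda>t. 4 * x * ?g t)
      \<longleftrightarrow> ?b absolutely_integrable_on (v ` {0<..}) \<and> integral (v ` {0<..}) ?b = integral {0<..} (\<lambda>t. 4 * x * ?g t)"
  proof (rule has_absolute_integral_change_of_variables_1'[OF _ _ inj])
    show "(v has_field_derivative v' t) (at t within {0<..})" if "t \<in> {0<..}" for t
      unfolding v_def v'_def using that pos[of t]
      by (auto intro!: derivative_eq_intros simp: field_simps eval_nat_numeral)
  qed auto
  have "(\<lambda>t. 4 * x * ?g t) absolutely_integrable_on {0<..}"
    by (rule set_integrable_mult_right) (rule L)
  then have "(\<lambda>t. \<bar>v' t\<bar> * ?b (v t)) absolutely_integrable_on {0<..} \<and>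
      integral {0<..} (\<lambda>t. \<bar>v' t\<bar> * ?b (v t)) = integral {0<..} (\<lambda>t. 4 * x * ?g t)"
    by (subst absolutely_integrable_integral_cong[where g = "\<lambda>t. 4 * x * ?g t"]) (use eq in auto)
  then have "integral {0<..<1} ?b = integral {0<..} (\<lambda>t. 4 * x * ?g t)"
    unfolding * img by blast
  also have "\<dots> = 4 * x * integral {0<..} ?g"
    by (rule Henstock_Kurzweil_Integration.integral_mult_right)
  finally have "integral {0<..<1} ?b = 4 * x * integral {0<..} ?g" .
  moreover have "integral {0<..<1} ?b = Beta (1/4) (1/4 :: real)"
    using has_integral_Beta_real[of "1/4" "1/4"] by (simp add: has_integral_Icc_iff_Ioo integral_unique)
  moreover have "Beta (1/4) (1/4 :: real) = (Gamma (1/4))\<^sup>2 / sqrt pi"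
    by (simp add: Beta_def Gamma_one_half_real power2_eq_square)
  ultimately show ?thesis using L(2) x by (simp add: field_simps)
qed

section \<open>Theta values at the lemniscatic point\<close>

lemma infsum_int_split:
  fixes f :: "int \<Rightarrow> real"
  assumes "f summable_on UNIV"
  shows "summable (\<lambda>k. f (int k))" "summable (\<lambda>k. f (- int (Suc k)))"
    and "infsum f UNIV = (\<Sum>k. f (int k)) + (\<Sum>k. f (- int (Suc k)))"
proof -
  have s: "f summable_on {0..}" "f summable_on {..-1}"
    by (rule summable_on_subset_banach[OF assms], simp)+
  have 1: "bij_betw int UNIV {0..}" by (rule bij_betwI[where g = nat]) auto
  have 2: "bij_betw (\<lambda>k. - int (Suc k)) UNIV {..-1}" by (rule bij_betwI[where g = "\<lambda>n. nat (- n) - 1"]) auto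
  have a: "((\<lambda>k. f (int k)) has_sum infsum f {0..}) UNIV"
    using has_sum_reindex_bij_betw[OF 1, of f] has_sum_infsum[OF s(1)] by simp
  have b: "((\<lambda>k. f (- int (Suc k))) has_sum infsum f {..-1}) UNIV"
    using has_sum_reindex_bij_betw[OF 2, of f] has_sum_infsum[OF s(2)] by simp
  have "{0..} \<union> {..-1} = (UNIV :: int set)" by auto
  then have "infsum f UNIV = infsum f {0..} + infsum f {..-1}"
    using infsum_Un_disjoint[OF s] by fastforce
  with has_sum_imp_sums[OF a] has_sum_imp_sums[OF b]
  show "summable (\<lambda>k. f (int k))" "summable (\<lambda>k. f (- int (Suc k)))"
    and "infsum f UNIV = (\<Sum>k. f (int k)) + (\<Sum>k. f (- int (Suc k)))"
    by (simp_all add: sums_iff)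
qed

lemma sums_even_int_series:
  fixes f :: "int \<Rightarrow> real"
  assumes "(f has_sum S) UNIV" "\<And>n. f (- n) = f n"
  shows "(\<lambda>k. f (int k)) sums ((S + f 0) / 2)"
proof -
  have "f summable_on UNIV" using assms(1) by (rule has_sum_imp_summable)
  note split = infsum_int_split[OF this]
  have "(\<Sum>k. f (- int (Suc k))) = (\<Sum>k. f (int (Suc k)))" by (simp only: assms(2))
  also have "\<dots> = (\<Sum>k. f (int k)) - f 0" using suminf_split_head[OF split(1)] by simp
  finally have "(\<Sum>k. f (int k)) = (S + f 0) / 2"
    using split(3) infsumI[OF assms(1)] by simp
  with summable_sums[OF split(1)] show ?thesis by simp
qed

lemma integral_gaussian_half_line:
  assumes "t > 0"
  shows "(\<lambda>x. exp (- t * x\<^sup>2)) absolutely_integrable_on {0..}"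
    and "integral {0..} (\<lambda>x. exp (- t * x\<^sup>2)) = sqrt (pi / t) / 2"
proof -
  have "integrable lborel (\<lambda>x::real. indicator {0..} x *\<^sub>R exp (- x\<^sup>2))"
    and eq: "(LBINT x:{0..}. exp (- x\<^sup>2 :: real)) = sqrt pi / 2"
    using gaussian_moment_0 unfolding set_lebesgue_integral_def by (auto simp: has_bochner_integral_iff)
  then have g: "set_integrable lborel {0..} (\<lambda>x::real. exp (- x\<^sup>2))"
    by (simp add: set_integrable_def)
  have base: "(\<lambda>x::real. exp (- x\<^sup>2)) absolutely_integrable_on {0..}" "integral {0..} (\<lambda>x::real. exp (- x\<^sup>2)) = sqrt pi / 2"
    using set_borel_integral_eq_integral[OF g] eq by (auto intro!: nonnegative_absolutely_integrable_1)
  define c where "c = sqrt t"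
  have c: "c > 0" "c\<^sup>2 = t" using assms by (auto simp: c_def)
  have img: "(\<lambda>x. c * x) ` {0..} = {0..}"
  proof (intro equalityI subsetI)
    fix y :: real assume "y \<in> {0..}"
    then show "y \<in> (\<lambda>x. c * x) ` {0..}" using c by (intro image_eqI[of _ _ "y / c"]) auto
  qed (use c in auto)
  have *: "(\<lambda>x. \<bar>c\<bar> * exp (- (c * x)\<^sup>2)) absolutely_integrable_on {0..} \<and>
      integral {0..} (\<lambda>x. \<bar>c\<bar> * exp (- (c * x)\<^sup>2)) = sqrt pi / 2
      \<longleftrightarrow> (\<lambda>x. exp (- x\<^sup>2)) absolutely_integrable_on ((\<lambda>x. c * x) ` {0..}) \<and>
        integral ((\<lambda>x. c * x) ` {0..}) (\<lambda>x. exp (- x\<^sup>2)) = sqrt pi / 2"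
    by (rule has_absolute_integral_change_of_variables_1')
       (use c in \<open>auto intro!: derivative_eq_intros simp: inj_on_def\<close>)
  have e: "\<bar>c\<bar> * exp (- (c * x)\<^sup>2) = c * exp (- t * x\<^sup>2)" for x
    using c by (simp add: power_mult_distrib)
  have 1: "(\<lambda>x. c * exp (- t * x\<^sup>2)) absolutely_integrable_on {0..}"
    and 2: "integral {0..} (\<lambda>x. c * exp (- t * x\<^sup>2)) = sqrt pi / 2"
    using * base unfolding img e by auto
  have "(\<lambda>x. (1 / c) * (c * exp (- t * x\<^sup>2))) absolutely_integrable_on {0..}"
    by (rule set_integrable_mult_right) (rule 1)
  then show "(\<lambda>x. exp (- t * x\<^sup>2)) absolutely_integrable_on {0..}" using c by simp
  have "c * integral {0..} (\<lambda>x. exp (- t * x\<^sup>2)) = sqrt pi / 2"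
    using 2 by (subst (asm) Henstock_Kurzweil_Integration.integral_mult_right)
  then show "integral {0..} (\<lambda>x. exp (- t * x\<^sup>2)) = sqrt (pi / t) / 2"
    using c(1) by (simp add: c_def real_sqrt_divide field_simps)
qed

text \<open>
  The integral test for a decreasing function: the sum exceeds the integral by at most the
  first term.
\<close>
lemma gaussian_series_bounds:
  assumes "t > 0"
  shows "sqrt (pi / t) / 2 \<le> (\<Sum>k. exp (- t * (real k)\<^sup>2))"
    and "(\<Sum>k. exp (- t * (real k)\<^sup>2)) \<le> sqrt (pi / t) / 2 + 1"
proof -
  let ?f = "\<lambda>x::real. exp (- t * x\<^sup>2)"
  interpret antimono_fun_sum_integral_diff ?f
    using assms by unfold_locales (auto intro!: continuous_intros power_mono)
  have I: "?f integrable_on {0..}"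
    using integral_gaussian_half_line(1)[OF assms] by (rule set_lebesgue_integral_eq_integral(1))
  have lim: "(\<lambda>n. integral {0..real n} ?f) \<longlonglongrightarrow> integral {0..} ?f"
  proof -
    have "(\<lambda>n. integral {0..} (\<lambda>x. if x \<in> {0..real n} then ?f x else 0)) \<longlonglongrightarrow> integral {0..} ?f"
    proof (rule dominated_convergence(2)[OF _ I])
      show "(\<lambda>x. if x \<in> {0..real k} then ?f x else 0) integrable_on {0..}" for k
        by (subst integrable_restrict_Int) (auto intro!: integrable_continuous_real continuous_intros simp: Int_absorb2)
      show "(\<lambda>n. if x \<in> {0..real n} then ?f x else 0) \<longlonglongrightarrow> ?f x" if "x \<in> {0..}" for x
      proof (rule tendsto_eventually)
        have "eventually (\<lambda>n. n \<ge> nat \<lceil>x\<rceil>) sequentially" by (rule eventually_ge_at_top)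
        then show "\<forall>\<^sub>F n in sequentially. (if x \<in> {0..real n} then ?f x else 0) = ?f x"
          by (rule eventually_mono) (use that in \<open>auto simp: nat_le_iff ceiling_le_iff\<close>)
      qed
    qed auto
    moreover have "integral {0..} (\<lambda>x. if x \<in> {0..real n} then ?f x else 0) = integral {0..real n} ?f" for n
      by (subst integral_restrict_Int) (simp add: Int_absorb2)
    ultimately show ?thesis by simp
  qed
  have le: "integral {0..real n} ?f \<le> integral {0..} ?f" for n
    by (rule integral_subset_le) (use I in \<open>auto intro!: integrable_continuous_real continuous_intros\<close>)
  have sum_le: "(\<Sum>k\<le>n. ?f (real k)) \<le> integral {0..} ?f + 1" for n
    using sum_integral_diff_series_antimono[of 0 n] le[of n]
    unfolding sum_integral_diff_series_def by simp
  have sm: "summable (\<lambda>k. ?f (real k))"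
    by (rule bounded_imp_summable[OF _ sum_le]) simp
  have part: "(\<lambda>n. \<Sum>k\<le>n. ?f (real k)) \<longlonglongrightarrow> (\<Sum>k. ?f (real k))"
    using summable_LIMSEQ'[OF sm] .
  have "integral {0..} ?f \<le> (\<Sum>k. ?f (real k))"
    by (rule LIMSEQ_le[OF lim part])
       (use sum_integral_diff_series_nonneg[unfolded sum_integral_diff_series_def] in auto)
  then show "sqrt (pi / t) / 2 \<le> (\<Sum>k. exp (- t * (real k)\<^sup>2))"
    using integral_gaussian_half_line(2)[OF assms] by simp
  have "(\<Sum>k. ?f (real k)) \<le> integral {0..} ?f + 1"
    by (rule LIMSEQ_le_const2[OF part]) (use sum_le in auto)
  then show "(\<Sum>k. exp (- t * (real k)\<^sup>2)) \<le> sqrt (pi / t) / 2 + 1"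
    using integral_gaussian_half_line(2)[OF assms] by simp
qed

lemma has_sum_pos:
  fixes f :: "'a \<Rightarrow> real"
  assumes "(f has_sum S) UNIV" "\<And>x. f x > 0"
  shows "S > 0"
proof -
  have "sum f {undefined} \<le> S"
    by (rule finite_sum_le_has_sum[OF assms(1)]) (auto intro: less_imp_le assms(2))
  then show ?thesis using assms(2)[of undefined] by simp
qed

lemma theta3_pos: "t > 0 \<Longrightarrow> theta3 t > 0"
  by (rule has_sum_pos[OF has_sum_theta3]) auto

lemma theta2_pos: "t > 0 \<Longrightarrow> theta2 t > 0"
  by (rule has_sum_pos[OF has_sum_theta2]) auto

lemma theta3_near_zero:
  assumes "t > 0"
  shows "\<bar>theta3 t - sqrt (pi / t)\<bar> \<le> 1"
proof -
  have "(\<lambda>k. exp (- t * (real k)\<^sup>2)) sums ((theta3 t + 1) / 2)"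
    using sums_even_int_series[OF has_sum_theta3[OF assms]] by simp
  then have "(\<Sum>k. exp (- t * (real k)\<^sup>2)) = (theta3 t + 1) / 2"
    by (rule sums_unique[symmetric])
  with gaussian_series_bounds[OF assms] show ?thesis by (simp add: field_simps)
qed

lemma theta2_near_zero:
  assumes "t > 0"
  shows "\<bar>theta2 t - sqrt (pi / t)\<bar> \<le> 2"
proof -
  have "sqrt (pi / (t / 4)) = 2 * sqrt (pi / t)"
    by (simp add: real_sqrt_mult flip: real_sqrt_divide) (simp add: real_sqrt_divide real_sqrt_mult)
  moreover have "theta3 (t / 4) = theta3 t + theta2 t"
    using theta3_even_odd_split[of "t / 4"] assms by simp
  ultimately show ?thesis
    using theta3_near_zero[of "t / 4"] theta3_near_zero[of t] assms by simp
qed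

lemma even_int_series_near_one:
  fixes f :: "int \<Rightarrow> real"
  assumes "(f has_sum S) UNIV" "\<And>n. f (- n) = f n" "f 0 = 1"
    and "\<And>k. \<bar>f (int (Suc k))\<bar> \<le> r ^ Suc k" "0 \<le> r" "r < 1"
  shows "\<bar>S - 1\<bar> \<le> 2 * (r / (1 - r))"
proof -
  have "(\<lambda>k. f (int k)) sums ((S + f 0) / 2)"
    by (rule sums_even_int_series) fact+
  then have s: "(\<lambda>k. f (int (Suc k))) sums ((S - 1) / 2)"
    using assms(3) by (subst sums_Suc_iff) (simp add: field_simps)
  have g: "(\<lambda>k. r ^ Suc k) sums (r / (1 - r))"
    using sums_mult[OF geometric_sums[of r], of r] assms(5,6) by simp
  have "(S - 1) / 2 \<le> r / (1 - r)"
    by (rule sums_le[OF _ s g]) (use assms(4) abs_le_D1 in blast)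
  moreover have "- ((S - 1) / 2) \<le> r / (1 - r)"
    by (rule sums_le[OF _ sums_minus[OF s] g]) (use assms(4) abs_le_D2 in blast)
  ultimately have "\<bar>(S - 1) / 2\<bar> \<le> r / (1 - r)" by (rule abs_leI)
  then show ?thesis by (simp add: mult.commute)
qed

lemma exp_square_le_power:
  assumes "t > 0"
  shows "exp (- t * (real (Suc k))\<^sup>2) \<le> exp (- t) ^ Suc k"
proof -
  have "real (Suc k) * 1 \<le> real (Suc k) * real (Suc k)" by (intro mult_left_mono) auto
  then have "real (Suc k) * (- t) \<ge> - t * (real (Suc k))\<^sup>2"
    using assms by (simp add: power2_eq_square)
  then have "exp (- t * (real (Suc k))\<^sup>2) \<le> exp (real (Suc k) * (- t))" by simp
  then show ?thesis by (simp only: exp_of_nat_mult)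
qed

lemma theta3_near_infinity:
  assumes "t > 0" shows "\<bar>theta3 t - 1\<bar> \<le> 2 * (exp (- t) / (1 - exp (- t)))"
proof (rule even_int_series_near_one[OF has_sum_theta3[OF assms]])
  show "\<bar>exp (- t * (of_int (int (Suc k)))\<^sup>2)\<bar> \<le> exp (- t) ^ Suc k" for k
    using exp_square_le_power[OF assms, of k] by simp
qed (use assms in auto)

lemma theta4_near_infinity:
  assumes "t > 0" shows "\<bar>theta4 t - 1\<bar> \<le> 2 * (exp (- t) / (1 - exp (- t)))"
proof (rule even_int_series_near_one[OF has_sum_theta4[OF assms]])
  show "\<bar>alt_sign (int (Suc k)) * exp (- t * (of_int (int (Suc k)))\<^sup>2)\<bar> \<le> exp (- t) ^ Suc k" for k
    using exp_square_le_power[OF assms, of k] by (simp add: abs_mult)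
qed (use assms in \<open>auto simp: alt_sign_def\<close>)

lemma theta_doubling_limit:
  assumes "t > 0"
  shows "(\<lambda>N. theta3 (2 ^ N * t)) \<longlonglongrightarrow> 1" "(\<lambda>N. theta4 (2 ^ N * t)) \<longlonglongrightarrow> 1"
proof -
  have lim: "(\<lambda>N. 2 * (exp (- (2 ^ N * t)) / (1 - exp (- (2 ^ N * t))))) \<longlonglongrightarrow> 0"
    using assms by real_asymp
  have pos: "2 ^ N * t > 0" for N using assms by simp
  have "(\<lambda>N. theta3 (2 ^ N * t) - 1) \<longlonglongrightarrow> 0"
    by (rule Lim_null_comparison[OF _ lim]) (use theta3_near_infinity pos in auto)
  then show "(\<lambda>N. theta3 (2 ^ N * t)) \<longlonglongrightarrow> 1" by (rule LIM_zero_cancel)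
  have "(\<lambda>N. theta4 (2 ^ N * t) - 1) \<longlonglongrightarrow> 0"
    by (rule Lim_null_comparison[OF _ lim]) (use theta4_near_infinity pos in auto)
  then show "(\<lambda>N. theta4 (2 ^ N * t)) \<longlonglongrightarrow> 1" by (rule LIM_zero_cancel)
qed

text \<open>
  theta3 t theta4 t is a square, hence theta4 t is not negative; a zero at t would spread to all
  2^N t, where theta4 tends to 1.
\<close>
lemma theta4_pos:
  assumes "t > 0" shows "theta4 t > 0"
proof -
  have "theta4 t \<ge> 0"
    using theta3_theta4[OF assms] theta3_pos[OF assms] by (metis zero_le_mult_iff zero_le_power2 not_less)
  moreover have "theta4 t \<noteq> 0"
  proof
    assume zero: "theta4 t = 0"
    have "theta4 (2 ^ N * t) = 0" for N
    proof (induction N)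
      case (Suc N)
      then show ?case using theta3_theta4[of "2 ^ N * t"] assms by (simp add: mult.assoc)
    qed (use zero in simp)
    then have "(\<lambda>N. theta4 (2 ^ N * t)) \<longlonglongrightarrow> 0" by simp
    with theta_doubling_limit(2)[OF assms] show False using LIMSEQ_unique by fastforce
  qed
  ultimately show ?thesis by simp
qed

text \<open>
  An arithmetic-geometric iteration leaves the integral unchanged, and the integral lies between its
  values for equal parameters.
\<close>
lemma ellint_eq_limit:
  assumes "\<And>N::nat. ellint (x N) (y N) = c" "\<And>N. x N > 0" "\<And>N. y N > 0"
    and "x \<longlonglongrightarrow> L" "y \<longlonglongrightarrow> L" "L > 0"
  shows "c = pi / L"
proof (rule antisym)
  have "(\<lambda>N. pi / min (x N) (y N)) \<longlonglongrightarrow> pi / min L L"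
    by (intro tendsto_intros assms) (use assms in auto)
  moreover have "c \<le> pi / min (x N) (y N)" for N
    using ellint_le[of "min (x N) (y N)" "x N" "y N"] assms(1,2,3) by simp
  ultimately show "c \<le> pi / L" by (intro LIMSEQ_le_const) auto
  have "(\<lambda>N. pi / max (x N) (y N)) \<longlonglongrightarrow> pi / max L L"
    by (intro tendsto_intros assms) (use assms in auto)
  moreover have "pi / max (x N) (y N) \<le> c" for N
    using ellint_ge[of "x N" "y N" "max (x N) (y N)"] assms(1,2,3) by simp
  ultimately show "pi / L \<le> c" by (intro LIMSEQ_le_const2) auto
qed

text \<open>
  Doubling t is an arithmetic-geometric step, and both squares tend to 1 as t grows.
\<close>
lemma ellint_theta3_theta4:
  assumes "t > 0"
  shows "ellint ((theta3 t)\<^sup>2) ((theta4 t)\<^sup>2) = pi"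
proof -
  let ?x = "\<lambda>N. (theta3 (2 ^ N * t))\<^sup>2" and ?y = "\<lambda>N. (theta4 (2 ^ N * t))\<^sup>2"
  have step: "ellint ((theta3 (2 * s))\<^sup>2) ((theta4 (2 * s))\<^sup>2) = ellint ((theta3 s)\<^sup>2) ((theta4 s)\<^sup>2)" if "s > 0" for s
  proof -
    have "((theta3 s)\<^sup>2 + (theta4 s)\<^sup>2) / 2 = (theta3 (2 * s))\<^sup>2"
      using theta3_square[OF that] theta4_square[OF that] by simp
    moreover have "sqrt ((theta3 s)\<^sup>2 * (theta4 s)\<^sup>2) = (theta4 (2 * s))\<^sup>2"
      unfolding power_mult_distrib[symmetric] theta3_theta4[OF that] real_sqrt_abs by simp
    ultimately show ?thesis
      using ellint_agm_step[of "(theta3 s)\<^sup>2" "(theta4 s)\<^sup>2"] theta3_pos[OF that] theta4_pos[OF that] by simp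
  qed
  have "ellint (?x N) (?y N) = ellint ((theta3 t)\<^sup>2) ((theta4 t)\<^sup>2)" for N
  proof (induction N)
    case (Suc N)
    then show ?case using step[of "2 ^ N * t"] assms by (simp add: mult.assoc)
  qed simp
  then have "ellint ((theta3 t)\<^sup>2) ((theta4 t)\<^sup>2) = pi / 1\<^sup>2"
  proof (rule ellint_eq_limit)
    show "?x N > 0" "?y N > 0" for N
      using theta3_pos theta4_pos assms by (simp_all add: less_imp_neq[symmetric])
    show "?x \<longlonglongrightarrow> 1\<^sup>2" "?y \<longlonglongrightarrow> 1\<^sup>2"
      by (intro tendsto_power theta_doubling_limit assms)+
  qed auto
  then show ?thesis by simp
qed

text \<open>
  Halving t is twice an arithmetic-geometric step, so the squares at pi / 2^N divided by 2^N form an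
  arithmetic-geometric iteration. As both theta functions behave like sqrt (pi / t) near t = 0,
  its limit is 1.
\<close>
lemma ellint_theta3_theta2: "ellint ((theta3 pi)\<^sup>2) ((theta2 pi)\<^sup>2) = pi"
proof -
  let ?x = "\<lambda>N. (theta3 (pi / 2 ^ N))\<^sup>2 / 2 ^ N" and ?y = "\<lambda>N. (theta2 (pi / 2 ^ N))\<^sup>2 / 2 ^ N"
  have pos: "?x N > 0" "?y N > 0" for N
    using theta3_pos[of "pi / 2 ^ N"] theta2_pos[of "pi / 2 ^ N"] by simp_all
  have "ellint (?x N) (?y N) = ellint ((theta3 pi)\<^sup>2) ((theta2 pi)\<^sup>2)" for N
  proof (induction N)
    case (Suc N)
    define s where "s = pi / 2 ^ Suc N"
    have s: "s > 0" "2 * s = pi / 2 ^ N" by (auto simp: s_def)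
    have mean: "(?x N + ?y N) / 2 = ?x (Suc N)"
      unfolding s_def[symmetric] s(2)[symmetric] theta3_square[OF s(1)] by (simp add: add_divide_distrib)
    have geo: "sqrt (?x N * ?y N) = ?y (Suc N)"
    proof -
      have "?x N * ?y N = (?y (Suc N))\<^sup>2"
        unfolding s_def[symmetric] s(2)[symmetric] theta2_square[OF s(1)] 
        by (simp add: power2_eq_square)
      then show ?thesis by simp
    qed
    show ?case
      using ellint_agm_step[OF pos[of N]] Suc unfolding mean geo by argo
  qed simp
  then have "ellint ((theta3 pi)\<^sup>2) ((theta2 pi)\<^sup>2) = pi / 1\<^sup>2"
  proof (rule ellint_eq_limit)
    have r: "sqrt (pi / (pi / 2 ^ N)) = sqrt 2 ^ N" for N
      by (simp add: real_sqrt_power)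
    have sq: "(sqrt 2 ^ N)\<^sup>2 = (2 ^ N :: real)" for N
      by (simp add: power_mult[symmetric] mult.commute[of N] power_mult)
    have lim: "(\<lambda>N. a / sqrt 2 ^ N) \<longlonglongrightarrow> 0" for a :: real
      by real_asymp
    have *: "(\<lambda>N. f (pi / 2 ^ N) / sqrt 2 ^ N) \<longlonglongrightarrow> 1"
      if "\<And>t. t > 0 \<Longrightarrow> \<bar>f t - sqrt (pi / t)\<bar> \<le> a" for f :: "real \<Rightarrow> real" and a
    proof -
      have "(\<lambda>N. f (pi / 2 ^ N) / sqrt 2 ^ N - 1) \<longlonglongrightarrow> 0"
      proof (rule Lim_null_comparison[OF _ lim[of a]], rule always_eventually, rule allI)
        fix N
        have "\<bar>f (pi / 2 ^ N) - sqrt 2 ^ N\<bar> \<le> a"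
          using that[of "pi / 2 ^ N"] unfolding r by simp
        then have "\<bar>f (pi / 2 ^ N) - sqrt 2 ^ N\<bar> / sqrt 2 ^ N \<le> a / sqrt 2 ^ N"
          by (intro divide_right_mono) auto
        also have "\<bar>f (pi / 2 ^ N) - sqrt 2 ^ N\<bar> / sqrt 2 ^ N = \<bar>(f (pi / 2 ^ N) - sqrt 2 ^ N) / sqrt 2 ^ N\<bar>"
          by (simp add: abs_divide)
        also have "(f (pi / 2 ^ N) - sqrt 2 ^ N) / sqrt 2 ^ N = f (pi / 2 ^ N) / sqrt 2 ^ N - 1"
          by (simp add: diff_divide_distrib)
        finally show "norm (f (pi / 2 ^ N) / sqrt 2 ^ N - 1) \<le> a / sqrt 2 ^ N" by simp
      qed
      then show ?thesis by (rule LIM_zero_cancel)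
    qed
    show "?x \<longlonglongrightarrow> 1\<^sup>2"
      using tendsto_power[OF *[OF theta3_near_zero], of 2] by (simp add: power_divide sq)
    show "?y \<longlonglongrightarrow> 1\<^sup>2"
      using tendsto_power[OF *[OF theta2_near_zero], of 2] by (simp add: power_divide sq)
  qed (use pos in auto)
  then show ?thesis by simp
qed

text \<open>
  The elliptic integral of the square of theta3 with that of theta4 and with that of theta2 is pi in
  both cases, so these two agree. By theta3^4 = theta2^4 + theta4^4 the parameters then have the
  ratio sqrt 2 of the lemniscatic case.
\<close>
lemma theta_at_pi:
  shows "theta2 pi = theta4 pi"
    and "(theta3 pi)\<^sup>2 = (Gamma (1/4))\<^sup>2 / (2 * pi * sqrt pi)"
    and "(theta3 pi)\<^sup>2 = sqrt 2 * (theta4 pi)\<^sup>2"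
proof -
  let ?x = "(theta3 pi)\<^sup>2" and ?y = "(theta4 pi)\<^sup>2" and ?z = "(theta2 pi)\<^sup>2"
  have pos: "?x > 0" "?y > 0" "?z > 0" "theta2 pi > 0" "theta4 pi > 0"
    using theta3_pos[of pi] theta4_pos[of pi] theta2_pos[of pi] by auto
  have "?y = ?z"
    using ellint_inj[OF pos(1,2,3)] ellint_theta3_theta4[of pi] ellint_theta3_theta2 by simp
  with pos show "theta2 pi = theta4 pi" by (simp add: power2_eq_iff)
  have "?x\<^sup>2 = ?y\<^sup>2 + ?z\<^sup>2"
    unfolding theta3_square[OF pi_gt_zero] theta4_square[OF pi_gt_zero] theta2_square[OF pi_gt_zero]
    by (simp add: power2_eq_square algebra_simps)
  with \<open>?y = ?z\<close> have "?x\<^sup>2 = 2 * ?y\<^sup>2" by simp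
  then have "?x = sqrt (2 * ?y\<^sup>2)" using pos by (metis real_sqrt_unique less_imp_le)
  also have "\<dots> = sqrt 2 * ?y" by (simp only: real_sqrt_mult real_sqrt_abs) simp
  finally show "?x = sqrt 2 * ?y" .
  then have "?y = ?x / sqrt 2" by simp
  then have "(Gamma (1/4))\<^sup>2 / (2 * sqrt pi * ?x) = pi"
    using ellint_lemniscatic[OF pos(1)] ellint_theta3_theta4[of pi] by simp
  then show "?x = (Gamma (1/4))\<^sup>2 / (2 * pi * sqrt pi)"
    using pos by (simp add: field_simps)
qed

section \<open>The Jacobi triple product\<close>

text \<open>
  The Gaussian binomial coefficients in p, defined by their Pascal rule.
\<close>
primrec gauss_binomial :: "real \<Rightarrow> nat \<Rightarrow> nat \<Rightarrow> real" where
  "gauss_binomial p 0 k = (if k = 0 then 1 else 0)"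
| "gauss_binomial p (Suc M) k = gauss_binomial p M k
     + (if k = 0 then 0 else p ^ (Suc M - k) * gauss_binomial p M (k - 1))"

lemma gauss_binomial_eq_0: "M < k \<Longrightarrow> gauss_binomial p M k = 0"
  by (induction M arbitrary: k) auto

lemma gauss_binomial_0 [simp]: "gauss_binomial p M 0 = 1"
  by (induction M) auto

text \<open>
  The q-factorial without its usual denominator (1 - p)^N, that is, the Pochhammer symbol (p; p)_N.
\<close>
definition q_factorial :: "real \<Rightarrow> nat \<Rightarrow> real" where
  "q_factorial p N = (\<Prod>m<N. 1 - p ^ Suc m)"

lemma q_factorial_0 [simp]: "q_factorial p 0 = 1"
  by (simp add: q_factorial_def)

lemma q_factorial_Suc: "q_factorial p (Suc N) = q_factorial p N * (1 - p ^ Suc N)"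
  by (simp add: q_factorial_def)

text \<open>
  The analogue of k! (M - k)! (M choose k) = M!.
\<close>
lemma gauss_binomial_mult_q_factorial:
  "k \<le> M \<Longrightarrow> gauss_binomial p M k * (q_factorial p k * q_factorial p (M - k)) = q_factorial p M"
proof (induction M arbitrary: k)
  case (Suc M)
  show ?case
  proof (cases k)
    case (Suc j)
    show ?thesis
    proof (cases "j = M")
      case True
      then show ?thesis
        using Suc.IH[of M] Suc by (auto simp: gauss_binomial_eq_0 q_factorial_Suc)
    next
      case False
      with Suc Suc.prems have j: "j < M" by simp
      then obtain d where d: "M = Suc (j + d)" by (metis less_iff_Suc_add)
      have 1: "gauss_binomial p M (Suc j) * (q_factorial p (Suc j) * q_factorial p d) = q_factorial p M"
        using Suc.IH[of "Suc j"] j d by simp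
      have 2: "gauss_binomial p M j * (q_factorial p j * q_factorial p (Suc d)) = q_factorial p M"
        using Suc.IH[of j] j d by (simp add: Suc_diff_le)
      have g: "gauss_binomial p (Suc M) k = gauss_binomial p M (Suc j) + p ^ Suc d * gauss_binomial p M j"
        using Suc d by simp
      have f: "q_factorial p k * q_factorial p (Suc M - k) = q_factorial p (Suc j) * q_factorial p (Suc d)"
        using Suc d by simp
      have "(gauss_binomial p M (Suc j) + p ^ Suc d * gauss_binomial p M j) * (q_factorial p (Suc j) * q_factorial p (Suc d))
          = gauss_binomial p M (Suc j) * (q_factorial p (Suc j) * q_factorial p d) * (1 - p ^ Suc d)
            + p ^ Suc d * (1 - p ^ Suc j) * (gauss_binomial p M j * (q_factorial p j * q_factorial p (Suc d)))"
        by (simp add: q_factorial_Suc algebra_simps)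
      also have "\<dots> = q_factorial p M * (1 - p ^ Suc M)"
        unfolding 1 2 by (simp add: d algebra_simps power_add)
      finally show ?thesis unfolding g f by (simp add: q_factorial_Suc)
    qed
  qed simp
qed simp

lemma q_binomial_theorem:
  "(\<Prod>k<M. 1 + x * p ^ k) = (\<Sum>k\<le>M. gauss_binomial p M k * p ^ (k choose 2) * x ^ k)"
proof (induction M)
  case (Suc M)
  let ?g = "gauss_binomial p"
  have "(\<Sum>k\<le>Suc M. ?g (Suc M) k * p ^ (k choose 2) * x ^ k)
     = (\<Sum>k\<le>Suc M. ?g M k * p ^ (k choose 2) * x ^ k)
       + (\<Sum>k\<le>Suc M. (if k = 0 then 0 else p ^ (Suc M - k) * ?g M (k - 1)) * p ^ (k choose 2) * x ^ k)"
    by (simp add: sum.distrib[symmetric] algebra_simps del: sum.atMost_Suc)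
  also have "(\<Sum>k\<le>Suc M. ?g M k * p ^ (k choose 2) * x ^ k) = (\<Sum>k\<le>M. ?g M k * p ^ (k choose 2) * x ^ k)"
    by (simp add: gauss_binomial_eq_0)
  also have "(\<Sum>k\<le>Suc M. (if k = 0 then 0 else p ^ (Suc M - k) * ?g M (k - 1)) * p ^ (k choose 2) * x ^ k)
     = (\<Sum>j\<le>M. p ^ (M - j) * ?g M j * p ^ (Suc j choose 2) * x ^ Suc j)"
    by (subst sum.atMost_Suc_shift) simp
  also have "\<dots> = (\<Sum>j\<le>M. x * p ^ M * (?g M j * p ^ (j choose 2) * x ^ j))"
  proof (rule sum.cong[OF refl])
    fix j assume "j \<in> {..M}"
    then have "p ^ M = p ^ (M - j) * p ^ j" by (simp flip: power_add)
    then show "p ^ (M - j) * ?g M j * p ^ (Suc j choose 2) * x ^ Suc j = x * p ^ M * (?g M j * p ^ (j choose 2) * x ^ j)"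
      by (simp add: numeral_2_eq_2 power_add)
  qed
  also have "\<dots> = x * p ^ M * (\<Sum>j\<le>M. ?g M j * p ^ (j choose 2) * x ^ j)"
    by (rule sum_distrib_left[symmetric])
  finally show ?case using Suc by (simp add: algebra_simps)
qed (simp add: numeral_2_eq_2)

text \<open>
  Euler's function at exp (- s), that is, the Dedekind eta function without the factor
  exp (- s / 24).
\<close>
definition euler_product :: "real \<Rightarrow> real" where
  "euler_product s = (\<Prod>m. 1 - exp (- s) ^ Suc m)"

lemma q_factorial_tendsto_euler_product:
  assumes "s > 0"
  shows "q_factorial (exp (- s)) \<longlonglongrightarrow> euler_product s" and "euler_product s > 0"
    and "euler_product s \<le> q_factorial (exp (- s)) N" and "q_factorial (exp (- s)) N \<le> 1"
    and "q_factorial (exp (- s)) N > 0"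
proof -
  define p where "p = exp (- s)"
  have p: "0 < p" "p < 1" using assms by (auto simp: p_def)
  have pos: "0 < 1 - p ^ Suc m" "1 - p ^ Suc m \<le> 1" for m
    using power_less_one_iff[of p "Suc m"] p by auto
  have "summable (\<lambda>m. \<bar>- (p ^ Suc m)\<bar>)"
    using p summable_geometric[of p] by (simp add: abs_mult summable_mult)
  then have "convergent_prod (\<lambda>m. 1 + - (p ^ Suc m))"
    by (rule summable_imp_convergent_prod_real) (metis pos(1) add.commute add_minus_cancel diff_conv_add_uminus less_irrefl right_minus)
  then have cp: "convergent_prod (\<lambda>m. 1 - p ^ Suc m)" by simp
  have "(\<lambda>n. \<Prod>m\<le>n. 1 - p ^ Suc m) \<longlonglongrightarrow> (\<Prod>m. 1 - p ^ Suc m)"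
    using convergent_prod_LIMSEQ[OF cp] .
  then have "(\<lambda>n. q_factorial p (Suc n)) \<longlonglongrightarrow> euler_product s"
    by (simp add: q_factorial_def euler_product_def p_def lessThan_Suc_atMost del: power_Suc prod.lessThan_Suc)
  then show lim: "q_factorial (exp (- s)) \<longlonglongrightarrow> euler_product s"
    unfolding p_def by (subst (asm) filterlim_sequentially_Suc)
  show pos': "q_factorial (exp (- s)) N > 0" for N
    unfolding q_factorial_def p_def[symmetric] by (intro prod_pos) (use pos in auto)
  have "euler_product s \<noteq> 0"
    unfolding euler_product_def p_def[symmetric] using prodinf_nonzero[OF cp] pos(1) by (metis less_irrefl)
  moreover have "euler_product s \<ge> 0"
    by (rule LIMSEQ_le_const[OF lim]) (use pos' less_imp_le in blast)
  ultimately show "euler_product s > 0" by simp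
  have dec: "decseq (q_factorial (exp (- s)))"
  proof (rule decseq_SucI)
    fix n
    show "q_factorial (exp (- s)) (Suc n) \<le> q_factorial (exp (- s)) n"
      unfolding q_factorial_Suc using pos(2)[of n] pos'[of n] by (simp add: p_def mult_left_le)
  qed
  show "euler_product s \<le> q_factorial (exp (- s)) N"
    using decseq_ge[OF dec lim] .
  show "q_factorial (exp (- s)) N \<le> 1"
    using decseqD[OF dec, of 0 N] by simp
qed

text \<open>
  The q-binomial theorem with 2 N factors, p = exp (- 2 s) and x = z exp ((2 N - 1) s), in which the
  exponents of exp (- s) are the odd numbers between - 2 N and 2 N. Each of the N factors with a
  negative exponent equals z exp (s (2 i + 1)) times a factor with 1 / z; the quantity A in the
  proof is the product of these prefactors, and dividing by it centres the sum.
\<close>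
lemma finite_triple_product:
  assumes "z \<noteq> 0"
  shows "(\<Prod>i<N. (1 + z * exp (- s * (2 * real i + 1))) * (1 + exp (- s * (2 * real i + 1)) / z))
       = (\<Sum>i\<le>N. gauss_binomial (exp (- (2 * s))) (2 * N) (N + i) * (exp (- s * (real i)\<^sup>2) * z ^ i))
       + (\<Sum>i<N. gauss_binomial (exp (- (2 * s))) (2 * N) (N - Suc i) * (exp (- s * (real (Suc i))\<^sup>2) / z ^ Suc i))"
proof -
  define p where "p = exp (- (2 * s))"
  define x where "x = z * exp (s * (2 * real N - 1))"
  define A where "A = z ^ N * exp (s * (real N)\<^sup>2)"
  let ?e = "\<lambda>i. exp (- s * (2 * real i + 1))"
  let ?g = "gauss_binomial p (2 * N)"
  have "A \<noteq> 0" using assms by (simp add: A_def)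
  have split: "h {..<2 * N} = h ({..<N} \<union> {N..<2 * N})" for h :: "nat set \<Rightarrow> real"
    by (rule arg_cong[of _ _ h]) auto
  have pk: "x * p ^ k = z * exp (s * (2 * real N - 1 - 2 * real k))" for k
    by (simp add: x_def p_def exp_of_nat_mult[symmetric] exp_add[symmetric] algebra_simps)
  have "(\<Prod>k<2 * N. 1 + x * p ^ k) = (\<Prod>k<N. 1 + x * p ^ k) * (\<Prod>k=N..<2 * N. 1 + x * p ^ k)"
    by (subst split) (rule prod.union_disjoint, auto)
  also have "(\<Prod>k=N..<2 * N. 1 + x * p ^ k) = (\<Prod>i<N. 1 + z * ?e i)"
    by (rule prod.reindex_bij_witness[of _ "\<lambda>i. N + i" "\<lambda>k. k - N"])
       (auto simp: pk of_nat_diff algebra_simps)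
  also have "(\<Prod>k<N. 1 + x * p ^ k) = (\<Prod>i<N. (z * exp (s * (2 * real i + 1))) * (1 + ?e i / z))"
    by (rule prod.reindex_bij_witness[of _ "\<lambda>i. N - Suc i" "\<lambda>k. N - Suc k"])
       (use assms in \<open>auto simp: pk of_nat_diff field_simps exp_minus_inverse exp_add[symmetric]\<close>)
  also have "\<dots> = A * (\<Prod>i<N. 1 + ?e i / z)"
  proof -
    have "(\<Prod>i<n. z * exp (s * (2 * real i + 1))) = z ^ n * exp (s * (real n)\<^sup>2)" for n
      by (induction n) (simp_all add: exp_add[symmetric] power2_eq_square algebra_simps)
    then show ?thesis by (simp add: prod.distrib A_def)
  qed
  finally have L: "(\<Prod>k<2 * N. 1 + x * p ^ k) = A * (\<Prod>i<N. (1 + z * ?e i) * (1 + ?e i / z))"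
    by (simp add: prod.distrib mult.assoc mult.commute)
  have term_k: "p ^ (k choose 2) * x ^ k = exp (- s * (real k)\<^sup>2 + 2 * s * real N * real k) * z ^ k" for k
  proof -
    have "real (k choose 2) = real k * (real k - 1) / 2"
      by (cases k) (simp_all add: choose_two real_of_nat_div field_simps)
    then have "p ^ (k choose 2) = exp (- s * (real k * (real k - 1)))"
      by (simp add: p_def exp_of_nat_mult[symmetric])
    then show ?thesis
      by (simp add: x_def power_mult_distrib exp_of_nat_mult[symmetric] exp_add[symmetric] power2_eq_square algebra_simps)
  qed
  have "(\<Sum>k\<le>2 * N. ?g k * p ^ (k choose 2) * x ^ k) = (\<Sum>k\<in>{..<N} \<union> {N..2 * N}. ?g k * p ^ (k choose 2) * x ^ k)"
    by (rule sum.cong) auto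
  also have "\<dots> = (\<Sum>k<N. ?g k * p ^ (k choose 2) * x ^ k) + (\<Sum>k=N..2 * N. ?g k * p ^ (k choose 2) * x ^ k)"
    by (rule sum.union_disjoint) auto
  also have "(\<Sum>k=N..2 * N. ?g k * p ^ (k choose 2) * x ^ k) = (\<Sum>i\<le>N. A * (?g (N + i) * (exp (- s * (real i)\<^sup>2) * z ^ i)))"
  proof (rule sum.reindex_bij_witness[of _ "\<lambda>i. N + i" "\<lambda>k. k - N"])
    fix k assume "k \<in> {N..2 * N}"
    then obtain i where i: "k = N + i" by (metis atLeastAtMost_iff le_iff_add)
    show "A * (?g (N + (k - N)) * (exp (- s * (real (k - N))\<^sup>2) * z ^ (k - N))) = ?g k * p ^ (k choose 2) * x ^ k"
      unfolding mult.assoc term_k A_def i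
      by (simp add: power_add power2_eq_square algebra_simps exp_add[symmetric])
  qed auto
  also have "(\<Sum>k<N. ?g k * p ^ (k choose 2) * x ^ k) = (\<Sum>i<N. A * (?g (N - Suc i) * (exp (- s * (real (Suc i))\<^sup>2) / z ^ Suc i)))"
  proof (rule sum.reindex_bij_witness[of _ "\<lambda>i. N - Suc i" "\<lambda>k. N - Suc k"])
    fix k assume "k \<in> {..<N}"
    then obtain d where d: "N = Suc (k + d)" by (metis lessThan_iff less_iff_Suc_add)
    show "A * (?g (N - Suc (N - Suc k)) * (exp (- s * (real (Suc (N - Suc k)))\<^sup>2) / z ^ Suc (N - Suc k)))
       = ?g k * p ^ (k choose 2) * x ^ k"
      using assms unfolding mult.assoc term_k A_def d
      by (simp add: power_add power2_eq_square algebra_simps exp_add[symmetric])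
  qed auto
  finally have R: "(\<Sum>k\<le>2 * N. ?g k * p ^ (k choose 2) * x ^ k) = 
       A * ((\<Sum>i\<le>N. ?g (N + i) * (exp (- s * (real i)\<^sup>2) * z ^ i))
       + (\<Sum>i<N. ?g (N - Suc i) * (exp (- s * (real (Suc i))\<^sup>2) / z ^ Suc i)))"
    by (simp add: sum_distrib_left distrib_left add.commute)
  from q_binomial_theorem[of x p "2 * N"] L R \<open>A \<noteq> 0\<close> show ?thesis
    by (simp add: p_def)
qed

lemma summable_gaussian_int_power:
  fixes z :: real
  assumes "s > 0" "z \<noteq> 0"
  shows "(\<lambda>n::int. \<bar>exp (- s * (of_int n)\<^sup>2) * z powi n\<bar>) summable_on UNIV"
proof -
  define L where "L = ln \<bar>z\<bar>"
  have "(\<lambda>n::int. exp (L\<^sup>2 / (4 * s)) * exp (- s * (of_int n + (- L / (2 * s)))\<^sup>2)) summable_on UNIV"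
    by (intro summable_on_cmult_right summable_on_gaussian_int assms)
  moreover have "exp (L\<^sup>2 / (4 * s)) * exp (- s * (of_int n + (- L / (2 * s)))\<^sup>2) = \<bar>exp (- s * (of_int n)\<^sup>2) * z powi n\<bar>" for n :: int
  proof -
    have "\<bar>z powi n\<bar> = \<bar>z\<bar> powi n" by (simp add: power_int_abs)
    also have "\<dots> = exp (of_int n * L)"
      using assms(2) by (simp add: L_def exp_power_int[symmetric])
    finally have "\<bar>exp (- s * (of_int n)\<^sup>2) * z powi n\<bar> = exp (- s * (of_int n)\<^sup>2 + of_int n * L)"
      by (simp only: abs_mult exp_add abs_exp_cancel)
    also have "- s * (of_int n)\<^sup>2 + of_int n * L = L\<^sup>2 / (4 * s) + (- s * (of_int n + (- L / (2 * s)))\<^sup>2)"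
      using assms(1) by (simp add: field_simps power2_eq_square)
    finally show ?thesis by (simp only: exp_add)
  qed
  ultimately show ?thesis by simp
qed

text \<open>
  The interchange of limit and sum that takes the finite triple product to Jacobi's identity.
\<close>
lemma tannery_finite_sums:
  fixes c :: "nat \<Rightarrow> nat \<Rightarrow> real" and t :: "nat \<Rightarrow> real"
  assumes "summable (\<lambda>k. \<bar>t k\<bar>)"
    and "\<And>N k. k < N \<Longrightarrow> \<bar>c N k\<bar> \<le> B" "\<And>k. (\<lambda>N. c N k) \<longlonglongrightarrow> C"
  shows "(\<lambda>N. \<Sum>k<N. c N k * t k) \<longlonglongrightarrow> C * (\<Sum>k. t k)"
proof -
  define a where "a = (\<lambda>k N. if k < N then c N k * t k else 0)"
  have ts: "summable t" using assms(1) by (rule summable_rabs_cancel)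
  have "B \<ge> 0" using assms(2)[of 0 1] by simp
  have "(\<lambda>N. suminf (\<lambda>k. a k N)) \<longlonglongrightarrow> suminf (\<lambda>k. C * t k)"
  proof (rule tannerys_theorem[THEN conjunct2, THEN conjunct2])
    show "(\<lambda>N. a k N) \<longlonglongrightarrow> C * t k" for k
    proof (rule Lim_transform_eventually)
      show "(\<lambda>N. c N k * t k) \<longlonglongrightarrow> C * t k" by (intro tendsto_intros assms)
      show "\<forall>\<^sub>F N in sequentially. c N k * t k = a k N"
        using eventually_gt_at_top[of k] by eventually_elim (simp add: a_def)
    qed
    show "\<forall>\<^sub>F (k, N) in sequentially \<times>\<^sub>F sequentially. norm (a k N) \<le> B * \<bar>t k\<bar>"
      by (intro always_eventually)
         (auto simp: a_def abs_mult \<open>B \<ge> 0\<close> intro!: mult_right_mono assms(2))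
    show "summable (\<lambda>k. B * \<bar>t k\<bar>)" by (intro summable_mult assms)
  qed auto
  moreover have "suminf (\<lambda>k. a k N) = (\<Sum>k<N. c N k * t k)" for N
    by (subst suminf_finite[of "{..<N}"]) (auto simp: a_def)
  moreover have "suminf (\<lambda>k. C * t k) = C * (\<Sum>k. t k)"
    by (rule suminf_mult[OF ts])
  ultimately show ?thesis by simp
qed

text \<open>
  In the finite identity the coefficients gauss_binomial p (2 N) (N + k), and likewise with N - k, tend
  to 1 / E and are bounded by 1 / E^2, where E is the Euler product; so the limit can be taken in each
  half of the sum.
\<close>
lemma jacobi_triple_product:
  assumes s: "s > 0" and z: "z \<noteq> 0"
  shows "(\<lambda>N. \<Prod>i<N. (1 + z * exp (- s * (2 * real i + 1))) * (1 + exp (- s * (2 * real i + 1)) / z))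
       \<longlonglongrightarrow> (\<Sum>\<^sub>\<infinity>n::int. exp (- s * (of_int n)\<^sup>2) * z powi n) / euler_product (2 * s)"
proof -
  define p where "p = exp (- (2 * s))"
  define E where "E = euler_product (2 * s)"
  have s2: "2 * s > 0" using s by simp
  note E = q_factorial_tendsto_euler_product[OF s2, folded p_def E_def]
  let ?f = "\<lambda>n::int. exp (- s * (of_int n)\<^sup>2) * z powi n"
  have abs_sum: "(\<lambda>n. \<bar>?f n\<bar>) summable_on UNIV" by (rule summable_gaussian_int_power[OF s z])
  have "?f summable_on UNIV"
    by (rule abs_summable_summable) (use abs_sum in simp)
  note S = infsum_int_split[OF this]
  note A = infsum_int_split[OF abs_sum]
  have t1: "?f (int i) = exp (- s * (real i)\<^sup>2) * z ^ i" for i by (simp add: power_int_def)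
  have t2: "?f (- int (Suc i)) = exp (- s * (real (Suc i))\<^sup>2) / z ^ Suc i" for i
    by (simp only: power_int_minus power_int_of_nat of_int_minus of_int_of_nat_eq power2_minus) (simp add: divide_inverse)
  have gb: "gauss_binomial p (2 * N) k = q_factorial p (2 * N) / (q_factorial p k * q_factorial p (2 * N - k))"
    if "k \<le> 2 * N" for N k
    using gauss_binomial_mult_q_factorial[OF that, of p] E(5)[of k] E(5)[of "2 * N - k"]
    by (simp add: field_simps)
  have bound: "\<bar>gauss_binomial p (2 * N) k\<bar> \<le> 1 / (E * E)" if "k \<le> 2 * N" for N k
  proof -
    have "q_factorial p (2 * N) / (q_factorial p k * q_factorial p (2 * N - k)) \<le> 1 / (E * E)"
      using E(2,3,4) less_imp_le[OF E(5)] less_imp_le[OF E(2)] by (intro frac_le mult_mono) auto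
    then show ?thesis using gb[OF that] E(5)[of "2 * N"] E(5)[of k] E(5)[of "2 * N - k"] by simp
  qed
  have sub: "filterlim (\<lambda>N. 2 * N) sequentially sequentially" "filterlim (\<lambda>N. N + k) sequentially sequentially"
     "filterlim (\<lambda>N. N - k) sequentially sequentially" for k :: nat
    by real_asymp+
  have ratio: "(\<lambda>N. q_factorial p (2 * N) / (q_factorial p (N + k) * q_factorial p (N - k))) \<longlonglongrightarrow> E / (E * E)" for k
    using E(2) by (intro tendsto_intros filterlim_compose[OF E(1)] sub) auto
  have lim: "(\<lambda>N. gauss_binomial p (2 * N) (N + k)) \<longlonglongrightarrow> 1 / E" 
            "(\<lambda>N. gauss_binomial p (2 * N) (N - k)) \<longlonglongrightarrow> 1 / E" for k
  proof -
    have "\<forall>\<^sub>F N in sequentially. q_factorial p (2 * N) / (q_factorial p (N + k) * q_factorial p (N - k)) = gauss_binomial p (2 * N) (N + k)"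
      using eventually_ge_at_top[of k]
    proof eventually_elim
      case (elim N)
      then have "2 * N - (N + k) = N - k" by simp
      with gb[of "N + k" N] elim show ?case by simp
    qed
    from Lim_transform_eventually[OF ratio this] show "(\<lambda>N. gauss_binomial p (2 * N) (N + k)) \<longlonglongrightarrow> 1 / E" using E(2) by simp
    have "\<forall>\<^sub>F N in sequentially. q_factorial p (2 * N) / (q_factorial p (N + k) * q_factorial p (N - k)) = gauss_binomial p (2 * N) (N - k)"
      using eventually_ge_at_top[of k]
    proof eventually_elim
      case (elim N)
      then have "2 * N - (N - k) = N + k" by simp
      with gb[of "N - k" N] show ?case by (simp add: mult.commute)
    qed
    from Lim_transform_eventually[OF ratio this] show "(\<lambda>N. gauss_binomial p (2 * N) (N - k)) \<longlonglongrightarrow> 1 / E" using E(2) by simp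
  qed
  have P: "(\<lambda>N. \<Sum>i<N. gauss_binomial p (2 * N) (N + i) * ?f (int i)) \<longlonglongrightarrow> 1 / E * (\<Sum>i. ?f (int i))"
    by (rule tannery_finite_sums[OF A(1), of _ "1 / (E * E)"]) (auto intro!: bound lim)
  \<comment> \<open>the half with nonnegative index has one summand more than the other, namely i = N\<close>
  have last: "(\<lambda>N. gauss_binomial p (2 * N) (N + N) * ?f (int N)) \<longlonglongrightarrow> 0"
  proof (rule Lim_null_comparison)
    show "\<forall>\<^sub>F N in sequentially. norm (gauss_binomial p (2 * N) (N + N) * ?f (int N)) \<le> 1 / (E * E) * \<bar>?f (int N)\<bar>"
    proof (intro always_eventually allI)
      fix N
      have "\<bar>gauss_binomial p (2 * N) (N + N)\<bar> * \<bar>?f (int N)\<bar> \<le> 1 / (E * E) * \<bar>?f (int N)\<bar>"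
        by (rule mult_right_mono[OF bound]) auto
      then show "norm (gauss_binomial p (2 * N) (N + N) * ?f (int N)) \<le> 1 / (E * E) * \<bar>?f (int N)\<bar>"
        by (simp only: real_norm_def abs_mult)
    qed
    show "(\<lambda>N. 1 / (E * E) * \<bar>?f (int N)\<bar>) \<longlonglongrightarrow> 0"
      using tendsto_mult_right_zero[OF summable_LIMSEQ_zero[OF A(1)]] .
  qed
  have M: "(\<lambda>N. \<Sum>i<N. gauss_binomial p (2 * N) (N - Suc i) * ?f (- int (Suc i))) \<longlonglongrightarrow> 1 / E * (\<Sum>i. ?f (- int (Suc i)))"
    by (rule tannery_finite_sums[OF A(2), of _ "1 / (E * E)"]) (auto intro!: bound lim)
  have "(\<lambda>N. (\<Sum>i<N. gauss_binomial p (2 * N) (N + i) * ?f (int i)) + gauss_binomial p (2 * N) (N + N) * ?f (int N)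
          + (\<Sum>i<N. gauss_binomial p (2 * N) (N - Suc i) * ?f (- int (Suc i))))
      \<longlonglongrightarrow> 1 / E * (\<Sum>i. ?f (int i)) + 0 + 1 / E * (\<Sum>i. ?f (- int (Suc i)))"
    by (intro tendsto_add P M last)
  also have "1 / E * (\<Sum>i. ?f (int i)) + 0 + 1 / E * (\<Sum>i. ?f (- int (Suc i))) = infsum ?f UNIV / E"
    unfolding S(3) by (simp add: add_divide_distrib)
  finally show ?thesis
    unfolding finite_triple_product[OF z] t1 t2 p_def E_def by (simp add: lessThan_Suc_atMost[symmetric] mult.assoc)
qed

lemma q_factorial_even_odd:
  "q_factorial p (2 * N) = (\<Prod>i<N. 1 - p ^ (2 * i + 1)) * q_factorial (p\<^sup>2) N"
  by (induction N) (simp_all add: q_factorial_Suc power_mult[symmetric] algebra_simps flip: power_Suc power_add)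

text \<open>
  The case z = - 1 of the triple product. The odd factors of the Euler product at s are its quotient
  by the Euler product at 2 s.
\<close>
lemma theta4_product:
  assumes s: "s > 0"
  shows "theta4 s = (euler_product s)\<^sup>2 / euler_product (2 * s)"
proof -
  define p where "p = exp (- s)"
  have s2: "2 * s > 0" using s by simp
  have p2: "p\<^sup>2 = exp (- (2 * s))" by (simp add: p_def exp_double[symmetric] flip: exp_of_nat_mult)
  note E1 = q_factorial_tendsto_euler_product[OF s, folded p_def]
  note E2 = q_factorial_tendsto_euler_product[OF s2, folded p2]
  have pow: "p ^ (2 * i + 1) = exp (- s * (2 * real i + 1))" for i
    by (simp add: p_def exp_of_nat_mult[symmetric] algebra_simps exp_add[symmetric])
  have sub: "filterlim (\<lambda>N::nat. 2 * N) sequentially sequentially" by real_asymp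
  have "(\<lambda>N. (q_factorial p (2 * N) / q_factorial (p\<^sup>2) N)\<^sup>2) \<longlonglongrightarrow> (euler_product s / euler_product (2 * s))\<^sup>2"
    using E2(2) by (intro tendsto_intros filterlim_compose[OF E1(1)] sub E2(1)) auto
  moreover have "(q_factorial p (2 * N) / q_factorial (p\<^sup>2) N)\<^sup>2 
     = (\<Prod>i<N. (1 + (-1) * exp (- s * (2 * real i + 1))) * (1 + exp (- s * (2 * real i + 1)) / (-1)))" for N
    using E2(5)[of N] unfolding q_factorial_even_odd pow by (simp add: prod.distrib power2_eq_square)
  ultimately have "(euler_product s / euler_product (2 * s))\<^sup>2 =
     (\<Sum>\<^sub>\<infinity>n::int. exp (- s * (of_int n)\<^sup>2) * (-1) powi n) / euler_product (2 * s)"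
    using jacobi_triple_product[OF s, of "-1"] LIMSEQ_unique by fastforce
  also have "(\<Sum>\<^sub>\<infinity>n::int. exp (- s * (of_int n)\<^sup>2) * (-1) powi n) = theta4 s"
    unfolding theta4_def by (intro infsum_cong) (simp add: alt_sign_def power_int_minus_left)
  finally show ?thesis using E2(2) by (simp add: field_simps power2_eq_square)
qed

text \<open>
  The case z = exp (- s), in which n^2 + n = (n + 1/2)^2 - 1/4. The factors 1 + exp (- 2 s i) occur
  once from i = 1 on and once from i = 0 on, whence the factor 2.
\<close>
lemma theta2_product:
  assumes s: "s > 0"
  shows "theta2 s = 2 * exp (- s / 4) * (euler_product (4 * s))\<^sup>2 / euler_product (2 * s)"
proof -
  define p where "p = exp (- (2 * s))"
  have s2: "2 * s > 0" and s4: "4 * s > 0" using s by auto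
  have p2: "p\<^sup>2 = exp (- (4 * s))" by (simp add: p_def flip: exp_of_nat_mult)
  note E1 = q_factorial_tendsto_euler_product[OF s2, folded p_def]
  note E2 = q_factorial_tendsto_euler_product[OF s4, folded p2]
  have pow: "exp (- s) * exp (- s * (2 * real i + 1)) = p ^ Suc i" "exp (- s * (2 * real i + 1)) / exp (- s) = p ^ i" for i
    by (simp_all add: p_def exp_of_nat_mult[symmetric] exp_add[symmetric] exp_diff[symmetric] algebra_simps del: power_Suc)
  have plus: "(\<Prod>i<N. 1 + p ^ Suc i) = q_factorial (p\<^sup>2) N / q_factorial p N" for N
  proof -
    have "(\<Prod>i<N. 1 + p ^ Suc i) * q_factorial p N = q_factorial (p\<^sup>2) N"
      unfolding q_factorial_def prod.distrib[symmetric]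
      by (intro prod.cong) (simp_all add: algebra_simps power2_eq_square power_mult_distrib)
    then show ?thesis using E1(5)[of N] by (simp add: field_simps)
  qed
  have shift: "(\<Prod>i<N. 1 + p ^ i) * (1 + p ^ N) = 2 * (\<Prod>i<N. 1 + p ^ Suc i)" for N
    by (induction N) (simp_all add: algebra_simps)
  have "p > 0" "p < 1" using s by (auto simp: p_def)
  then have p0: "(\<lambda>N. p ^ N) \<longlonglongrightarrow> 0" by (intro LIMSEQ_power_zero) auto
  have nz: "1 + p ^ N > 0" for N using \<open>p > 0\<close> by (simp add: add_pos_pos)
  have "(\<lambda>N. 2 * (q_factorial (p\<^sup>2) N / q_factorial p N)\<^sup>2 / (1 + p ^ N))
     \<longlonglongrightarrow> 2 * (euler_product (4 * s) / euler_product (2 * s))\<^sup>2 / (1 + 0)"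
    using E1(2) by (intro tendsto_intros E1(1) E2(1) p0) auto
  moreover have "2 * (q_factorial (p\<^sup>2) N / q_factorial p N)\<^sup>2 / (1 + p ^ N)
     = (\<Prod>i<N. (1 + exp (- s) * exp (- s * (2 * real i + 1))) * (1 + exp (- s * (2 * real i + 1)) / exp (- s)))" for N
  proof -
    have "(\<Prod>i<N. 1 + p ^ i) = 2 * (q_factorial (p\<^sup>2) N / q_factorial p N) / (1 + p ^ N)"
      using shift[of N] nz[of N] unfolding plus by (subst nonzero_eq_divide_eq) auto
    then show ?thesis unfolding pow prod.distrib plus by (simp add: power2_eq_square ac_simps)
  qed
  ultimately have "2 * (euler_product (4 * s) / euler_product (2 * s))\<^sup>2 =
     (\<Sum>\<^sub>\<infinity>n::int. exp (- s * (of_int n)\<^sup>2) * exp (- s) powi n) / euler_product (2 * s)"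
    using jacobi_triple_product[OF s, of "exp (- s)"] LIMSEQ_unique by fastforce
  also have "(\<Sum>\<^sub>\<infinity>n::int. exp (- s * (of_int n)\<^sup>2) * exp (- s) powi n) = (\<Sum>\<^sub>\<infinity>n::int. exp (s / 4) * exp (- s * (of_int n + 1/2)\<^sup>2))"
  proof (intro infsum_cong)
    fix n :: int
    have "exp (- s) powi n = exp (of_int n * (- s))" by (rule exp_power_int)
    then show "exp (- s * (of_int n)\<^sup>2) * exp (- s) powi n = exp (s / 4) * exp (- s * (of_int n + 1/2)\<^sup>2)"
      by (simp add: exp_add[symmetric] power2_eq_square algebra_simps)
  qed
  also have "\<dots> = exp (s / 4) * theta2 s"
    unfolding theta2_def by (rule infsum_cmult_right')
  finally show ?thesis using E1(2) by (simp add: field_simps power2_eq_square exp_minus)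
qed

section \<open>The Euler product\<close>

text \<open>
  In theta4 (2 s)^2 theta2 s the Euler product at 4 s cancels, leaving the cube of the one at 2 s. For
  s = pi the left side is theta3 pi (theta4 pi)^2, known from the lemniscatic point.
\<close>
lemma euler_product_2pi:
  "euler_product (2 * pi) = exp (pi / 12) * sqrt ((Gamma (1/4))\<^sup>2 / (4 * pi * sqrt pi))"
proof -
  let ?x = "theta3 pi" and ?E = "euler_product (2 * pi)" and ?G = "(Gamma (1/4 :: real))\<^sup>2"
  have x: "?x > 0" by (rule theta3_pos) simp
  have E: "?E > 0" "euler_product (4 * pi) > 0" by (rule q_factorial_tendsto_euler_product(2), simp)+
  have "(theta4 (2 * pi))\<^sup>2 * theta2 pi = 2 * exp (- pi / 4) * ?E ^ 3"
    using E by (simp add: theta4_product theta2_product power_divide field_simps power2_eq_square power3_eq_cube)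
  moreover have "(theta4 (2 * pi))\<^sup>2 * theta2 pi = ?x * (theta4 pi)\<^sup>2"
    unfolding theta3_theta4[OF pi_gt_zero, symmetric] theta_at_pi(1) by (simp add: power2_eq_square)
  moreover have "?x * (theta4 pi)\<^sup>2 = ?x ^ 3 / sqrt 2"
    using theta_at_pi(3) by (simp add: field_simps power2_eq_square power3_eq_cube)
  ultimately have "2 * exp (- pi / 4) * ?E ^ 3 = ?x ^ 3 / sqrt 2" by simp
  then have "exp (pi / 4) * (2 * exp (- pi / 4) * ?E ^ 3) = exp (pi / 4) * (?x ^ 3 / sqrt 2)" by simp
  then have "?E ^ 3 = exp (pi / 4) * (?x ^ 3 / (2 * sqrt 2))"
    by (simp add: exp_minus field_simps)
  also have "\<dots> = (exp (pi / 12) * (?x / sqrt 2)) ^ 3"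
  proof -
    have "exp (pi / 4) = exp (pi / 12) ^ 3" by (simp flip: exp_of_nat_mult)
    then show ?thesis by (simp add: power_mult_distrib power_divide) (simp add: power3_eq_cube)
  qed
  finally have cubes: "?E ^ 3 = (exp (pi / 12) * (?x / sqrt 2)) ^ 3" .
  have "?E = exp (pi / 12) * (?x / sqrt 2)"
    by (rule power_eq_imp_eq_base[OF cubes]) (use E x in simp_all)
  also have "?x / sqrt 2 = sqrt (?x\<^sup>2 / 2)" using x by (simp add: real_sqrt_divide)
  also have "?x\<^sup>2 / 2 = ?G / (4 * pi * sqrt pi)" by (simp add: theta_at_pi(2))
  finally show ?thesis .
qed

text \<open>
  The double series of the expanded logarithms has terms of one sign; summing over the factors of the
  product first leaves geometric series.
\<close>
lemma ln_euler_product_series: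
  assumes s: "s > 0"
  shows "(\<lambda>j. 1 / (real (Suc j) * (exp (s * real (Suc j)) - 1))) sums (- ln (euler_product s))"
proof -
  define p where "p = exp (- s)"
  have p: "0 < p" "p < 1" using s by (auto simp: p_def)
  note E = q_factorial_tendsto_euler_product[OF s, folded p_def]
  let ?f = "\<lambda>j m::nat. p ^ (Suc m * Suc j) / real (Suc j)"
  define a where "a = (\<lambda>j. 1 / (real (Suc j) * (exp (s * real (Suc j)) - 1)))"
  have pk: "0 < p ^ Suc j" "p ^ Suc j < 1" for j
    using p power_less_one_iff[of p "Suc j"] by auto
  have a_eq: "a j = p ^ Suc j / ((1 - p ^ Suc j) * real (Suc j))" for j
  proof -
    have "exp (s * real (Suc j)) = inverse (exp (real (Suc j) * - s))"
      by (simp add: exp_minus[symmetric] mult.commute)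
    also have "exp (real (Suc j) * - s) = p ^ Suc j"
      unfolding p_def by (rule exp_of_nat_mult)
    finally have e: "exp (s * real (Suc j)) = inverse (p ^ Suc j)" .
    have "1 / (n * (inverse y - 1)) = y / ((1 - y) * n)" if "0 < y" "y < 1" "n > 0" for y n :: real
      using that by (simp add: divide_simps) 
    from this[OF pk[of j], of "real (Suc j)"] show ?thesis
      unfolding a_def e by simp
  qed
  have row: "((\<lambda>m. ?f j m) has_sum a j) UNIV" for j
  proof (rule sums_nonneg_imp_has_sum)
    have "(\<lambda>m. (p ^ Suc j) ^ m * (p ^ Suc j / real (Suc j))) sums (1 / (1 - p ^ Suc j) * (p ^ Suc j / real (Suc j)))"
      by (rule sums_mult2[OF geometric_sums]) (use pk[of j] in auto)
    moreover have "(p ^ Suc j) ^ m * (p ^ Suc j / real (Suc j)) = ?f j m" for m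
    proof -
      have "p ^ (Suc m * Suc j) = (p ^ Suc j) ^ m * p ^ Suc j"
        by (simp only: power_mult[symmetric] power_add[symmetric]) (simp add: algebra_simps)
      then show ?thesis by (simp only: times_divide_eq_right)
    qed
    ultimately show "(\<lambda>m. ?f j m) sums a j"
      unfolding a_eq by (simp only: times_divide_eq_left times_divide_eq_right mult_1 divide_divide_eq_left)
  qed (use p in auto)
  have col: "((\<lambda>j. ?f j m) has_sum (- ln (1 - p ^ Suc m))) UNIV" for m
  proof (rule sums_nonneg_imp_has_sum)
    have "(\<lambda>n. - ((- (- (p ^ Suc m))) ^ n) / of_nat n) sums ln (1 + - (p ^ Suc m))"
      by (rule Complex_Transcendental.ln_series') (use pk[of m] in auto)
    from sums_minus[OF this] have "(\<lambda>n. (p ^ Suc m) ^ n / of_nat n) sums (- ln (1 - p ^ Suc m))"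
      by (simp del: power_Suc)
    then have "(\<lambda>n. (p ^ Suc m) ^ Suc n / of_nat (Suc n)) sums (- ln (1 - p ^ Suc m))"
      by (subst sums_Suc_iff) (simp del: power_Suc)
    then show "(\<lambda>j. ?f j m) sums (- ln (1 - p ^ Suc m))"
      by (simp only: power_mult)
  qed (use p in auto)
  have a_sum: "a summable_on UNIV"
  proof (rule summable_nonneg_imp_summable_on)
    show "summable a"
    proof (rule summable_comparison_test[OF exI, OF allI, OF impI])
      show "summable (\<lambda>j. p ^ j / (1 - p))" using p by (intro summable_divide summable_geometric) auto
      show "norm (a j) \<le> p ^ j / (1 - p)" for j
      proof -
        have le: "p ^ Suc j \<le> p ^ 1" "p ^ Suc j \<le> p ^ j" using p by (intro power_decreasing; simp)+
        have "(1 - p) * 1 \<le> (1 - p ^ Suc j) * real (Suc j)"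
          using p pk[of j] le(1) by (intro mult_mono) auto
        with le(2) have "p ^ Suc j / ((1 - p ^ Suc j) * real (Suc j)) \<le> p ^ j / ((1 - p) * 1)"
          using p by (intro frac_le) auto
        then show ?thesis using pk[of j] by (simp add: a_eq del: power_Suc of_nat_Suc)
      qed
    qed
    show "0 \<le> a j" for j using pk[of j] by (simp add: a_eq del: power_Suc of_nat_Suc)
  qed
  have dbl: "(\<lambda>(j, m). ?f j m) summable_on (UNIV \<times> UNIV)"
    by (rule summable_on_SigmaI[OF _ a_sum]) (use row p in auto)
  have "infsum a UNIV = (\<Sum>\<^sub>\<infinity>j. \<Sum>\<^sub>\<infinity>m. ?f j m)"
    using infsumI[OF row] by simp
  also have "\<dots> = (\<Sum>\<^sub>\<infinity>m. \<Sum>\<^sub>\<infinity>j. ?f j m)"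
    by (rule infsum_swap_banach[OF dbl])
  also have "\<dots> = (\<Sum>\<^sub>\<infinity>m. - ln (1 - p ^ Suc m))"
    using infsumI[OF col] by simp
  finally have eq: "infsum a UNIV = (\<Sum>\<^sub>\<infinity>m. - ln (1 - p ^ Suc m))" .
  have "(\<lambda>(m, j). ?f j m) summable_on (UNIV \<times> UNIV)"
    using dbl summable_on_swap[of "\<lambda>(j, m). ?f j m" UNIV UNIV] by simp
  from summable_on_Sigma_banach[OF this] have "(\<lambda>m. - ln (1 - p ^ Suc m)) summable_on UNIV"
    using infsumI[OF col] by simp
  then have "(\<lambda>m. - ln (1 - p ^ Suc m)) sums infsum a UNIV"
    unfolding eq by (intro has_sum_imp_sums has_sum_infsum)
  then have "(\<lambda>N. \<Sum>m<N. - ln (1 - p ^ Suc m)) \<longlonglongrightarrow> infsum a UNIV"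
    unfolding sums_def .
  moreover have "(\<Sum>m<N. - ln (1 - p ^ Suc m)) = - ln (q_factorial p N)" for N
  proof -
    have "1 - p ^ Suc m \<noteq> 0" for m using pk(2)[of m] by (simp del: power_Suc)
    then show ?thesis
      unfolding q_factorial_def by (subst ln_prod) (auto simp: sum_negf simp del: power_Suc)
  qed
  moreover have "(\<lambda>N. - ln (q_factorial p N)) \<longlonglongrightarrow> - ln (euler_product s)"
    using E by (intro tendsto_intros) auto
  ultimately have "infsum a UNIV = - ln (euler_product s)"
    using LIMSEQ_unique by force
  then show ?thesis
    using has_sum_imp_sums[OF has_sum_infsum[OF a_sum]] unfolding a_def by simp
qed

section \<open>The exponentially small part of the row sums\<close>

lemma nonneg_if_deriv_nonneg:
  fixes f f' :: "real \<Rightarrow> real"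
  assumes "f 0 = 0" "0 \<le> x" "\<And>y. 0 \<le> y \<Longrightarrow> (f has_field_derivative f' y) (at y)" "\<And>y. 0 \<le> y \<Longrightarrow> 0 \<le> f' y"
  shows "0 \<le> f x"
  using DERIV_nonneg_imp_nondecreasing[of 0 x f] assms by metis

lemma sin_ge_cubic:
  assumes "0 \<le> (x::real)" shows "x - x ^ 3 / 6 \<le> sin x"
proof -
  have 1: "0 \<le> y - sin y" if "0 \<le> y" for y :: real using sin_x_le_x[OF that] by simp
  have 2: "0 \<le> cos y - 1 + y\<^sup>2 / 2" if "0 \<le> y" for y :: real
    by (rule nonneg_if_deriv_nonneg[of "\<lambda>y. cos y - 1 + y\<^sup>2 / 2" y "\<lambda>y. y - sin y"])
       (use that 1 in \<open>auto intro!: derivative_eq_intros\<close>)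
  have "0 \<le> sin x - x + x ^ 3 / 6"
  proof (rule nonneg_if_deriv_nonneg[of "\<lambda>x. sin x - x + x ^ 3 / 6" x "\<lambda>y. cos y - 1 + y\<^sup>2 / 2"])
    show "((\<lambda>x. sin x - x + x ^ 3 / 6) has_real_derivative cos y - 1 + y\<^sup>2 / 2) (at y)" for y :: real
      by (auto intro!: derivative_eq_intros simp: power2_eq_square)
  qed (use assms 2 in simp_all)
  then show ?thesis by simp
qed

lemma arsinh_ge_cubic:
  assumes "0 \<le> (s::real)" shows "s - s ^ 3 / 6 \<le> arsinh s"
proof -
  have "0 \<le> arsinh s - s + s ^ 3 / 6"
  proof (rule nonneg_if_deriv_nonneg[of "\<lambda>s. arsinh s - s + s ^ 3 / 6" s "\<lambda>y. 1 / sqrt (y\<^sup>2 + 1) - 1 + y\<^sup>2 / 2"])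
    show "((\<lambda>s. arsinh s - s + s ^ 3 / 6) has_real_derivative 1 / sqrt (y\<^sup>2 + 1) - 1 + y\<^sup>2 / 2) (at y)" for y :: real
      by (auto intro!: derivative_eq_intros simp: power2_eq_square)
    show "0 \<le> 1 / sqrt (y\<^sup>2 + 1) - 1 + y\<^sup>2 / 2" for y :: real
    proof (cases "y\<^sup>2 \<le> 2")
      case True
      have "(1 - y\<^sup>2 / 2)\<^sup>2 * (y\<^sup>2 + 1) = 1 - (y\<^sup>2)\<^sup>2 * (3 - y\<^sup>2) / 4"
        by (simp add: power2_eq_square field_simps)
      also have "\<dots> \<le> 1" using True by simp
      finally have "sqrt ((1 - y\<^sup>2 / 2)\<^sup>2 * (y\<^sup>2 + 1)) \<le> 1" by simp
      then have "(1 - y\<^sup>2 / 2) * sqrt (y\<^sup>2 + 1) \<le> 1" using True by (simp add: real_sqrt_mult)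
      moreover have "sqrt (y\<^sup>2 + 1) > 0" by (simp add: add_nonneg_pos)
      ultimately have "1 - y\<^sup>2 / 2 \<le> 1 / sqrt (y\<^sup>2 + 1)" by (simp add: pos_le_divide_eq)
      then show ?thesis by linarith
    next
      case False
      have "0 \<le> 1 / sqrt (y\<^sup>2 + 1)" by simp
      with False show ?thesis by linarith
    qed
  qed (use assms in auto)
  then show ?thesis by simp
qed

lemma arsinh_le: 
  assumes "0 \<le> (s::real)" shows "arsinh s \<le> s"
proof -
  have "0 \<le> s - arsinh s"
  proof (rule nonneg_if_deriv_nonneg[of "\<lambda>s. s - arsinh s" s "\<lambda>y. 1 - 1 / sqrt (y\<^sup>2 + 1)"])
    show "((\<lambda>s. s - arsinh s) has_real_derivative 1 - 1 / sqrt (y\<^sup>2 + 1)) (at y)" for y :: real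
      by (auto intro!: derivative_eq_intros)
    show "0 \<le> 1 - 1 / sqrt (y\<^sup>2 + 1)" for y :: real
    proof -
      have "1 \<le> sqrt (y\<^sup>2 + 1)" by simp
      then have "1 / sqrt (y\<^sup>2 + 1) \<le> 1 / 1" by (intro frac_le) auto
      then show ?thesis by simp
    qed
  qed (use assms in auto)
  then show ?thesis by simp
qed

lemma sin_ge_third:
  assumes "0 \<le> (x::real)" "x \<le> pi / 2" shows "x / 3 \<le> sin x"
proof -
  have "x \<le> 2" using assms pi_half_le_two by linarith
  then have "x * x \<le> 2 * 2" using assms by (intro mult_mono) auto
  then have "x * (x * x) \<le> x * 4" using assms by (intro mult_left_mono) auto
  then show ?thesis using sin_ge_cubic[OF assms(1)] by (simp add: power3_eq_cube)
qed

lemma inverse_exp_minus_one_diff_le: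
  fixes A B :: real
  assumes "0 < A" "A \<le> B" "1 \<le> B"
  shows "\<bar>1 / (exp A - 1) - 1 / (exp B - 1)\<bar> \<le> 2 * (B - A) / (exp A - 1)"
proof -
  have "exp B \<ge> 2" using exp_ge_add_one_self[of B] assms(3) by linarith
  then have e: "exp A > 1" "exp A \<le> exp B" "exp B \<ge> 2" using assms by simp_all
  have "1 - (B - A) \<le> exp (- (B - A))" using exp_ge_add_one_self[of "- (B - A)"] by linarith
  then have "exp B * (1 - (B - A)) \<le> exp B * exp (- (B - A))" by (intro mult_left_mono) auto
  then have "exp B - exp A \<le> (B - A) * exp B" by (simp add: exp_add[symmetric] algebra_simps)
  also have "\<dots> \<le> (B - A) * (2 * (exp B - 1))" using e assms by (intro mult_left_mono) auto
  also have "\<dots> = 2 * (B - A) * (exp B - 1)" by (simp only: ac_simps)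
  finally have *: "exp B - exp A \<le> 2 * (B - A) * (exp B - 1)" .
  have "1 / (exp A - 1) - 1 / (exp B - 1) = (exp B - exp A) / ((exp A - 1) * (exp B - 1))"
    using e by (simp add: field_simps)
  moreover have "0 \<le> (exp B - exp A) / ((exp A - 1) * (exp B - 1))" using e by simp
  moreover have "(exp B - exp A) / ((exp A - 1) * (exp B - 1)) \<le> (2 * (B - A) * (exp B - 1)) / ((exp A - 1) * (exp B - 1))"
    using * e by (intro divide_right_mono) auto
  moreover have "(2 * (B - A) * (exp B - 1)) / ((exp A - 1) * (exp B - 1)) = 2 * (B - A) / (exp A - 1)"
    using e by simp
  ultimately show ?thesis by linarith
qed

lemma row_weight_near_inverse:
  assumes "0 < x" "x \<le> pi / 2"
  shows "\<bar>row_weight x - 1 / x\<bar> \<le> 3 * x"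
proof -
  define s where "s = sin x"
  define w where "w = sqrt (1 + s\<^sup>2)"
  have s: "0 < s" "s \<le> x" "x / 3 \<le> s" "x - x ^ 3 / 6 \<le> s"
    using assms sin_ge_third[of x] sin_ge_cubic[of x] sin_x_le_x[of x] by (auto simp: s_def intro: less_le_trans)
  have "w \<le> 1 + s\<^sup>2 / 2" unfolding w_def
  proof (rule real_le_lsqrt)
    have "0 \<le> (s\<^sup>2 / 2)\<^sup>2" by simp
    then show "1 + s\<^sup>2 \<le> (1 + s\<^sup>2 / 2)\<^sup>2" by (simp add: power2_sum)
  qed simp
  moreover have w1: "w \<ge> 1" by (simp add: w_def)
  ultimately have "s * 1 \<le> s * w" "s * w \<le> s * (1 + s\<^sup>2 / 2)" using s by (auto intro!: mult_left_mono)
  moreover have "s ^ 3 \<le> x ^ 3" using s by (intro power_mono) auto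
  moreover have "0 \<le> x ^ 3" using assms by simp
  ultimately have d: "\<bar>x - s * w\<bar> \<le> x ^ 3"
    using s(2,4) by (simp add: abs_le_iff power2_eq_square power3_eq_cube algebra_simps)
  have "x / 3 * 1 \<le> s * w" using s w1 assms by (intro mult_mono) auto
  then have den: "x * (x / 3) \<le> x * (s * w)" using assms by (intro mult_left_mono) auto
  have "row_weight x - 1 / x = (x - s * w) / (x * (s * w))"
    using s w1 assms by (simp add: row_weight_def s_def[symmetric] w_def[symmetric] field_simps)
  then have "\<bar>row_weight x - 1 / x\<bar> = \<bar>x - s * w\<bar> / (x * (s * w))"
    using s w1 assms by (simp add: abs_mult)
  also have "\<dots> \<le> x ^ 3 / (x * (x / 3))"
    using d den s assms by (intro frac_le) auto
  also have "\<dots> = 3 * x" using assms by (simp add: power3_eq_cube)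
  finally show ?thesis .
qed

lemma row_weight_symmetric: "row_weight (pi - x) = row_weight x"
  by (simp add: row_weight_def)

lemma exp_minus_one_ge:
  assumes "1 \<le> (y::real)" shows "exp y - 1 \<ge> exp (y / 2)"
proof -
  define e where "e = exp (y / 2)"
  have e: "e * e = exp y" by (simp add: e_def flip: exp_add)
  have "e \<ge> 1 + y / 2 + (y / 2)\<^sup>2 / 2" using exp_lower_Taylor_quadratic[of "y/2"] assms by (simp add: e_def)
  moreover have "(y / 2)\<^sup>2 \<ge> (1 / 2)\<^sup>2" using assms by (intro power_mono) auto
  \<comment> \<open>1 + 1/2 + 1/8, the value of the Taylor bound at 1/2\<close>
  ultimately have "e \<ge> 1.625" using assms by (simp add: power2_eq_square)
  then have "1.625 * 0.625 \<le> e * (e - 1)" by (intro mult_mono) auto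
  then show ?thesis unfolding e_def[symmetric] e[symmetric] by (simp add: algebra_simps)
qed

text \<open>
  Near 0 the row weight is 1 / x with an error O(x), and the exponent 2 N arsinh (sin x) is 2 N x with
  an error O(N x^3). The bound arsinh (sin x) \<ge> x / 6 preserves exponential decay in N x, so that
  these errors remain summable.
\<close>
lemma tail_term_bound:
  fixes x :: real and N :: real
  assumes x: "0 < x" "x \<le> pi / 2" and N: "0 < N" "3 \<le> N * x"
  shows "\<bar>row_weight x / (exp (2 * N * arsinh (sin x)) - 1) - 1 / x / (exp (2 * N * x) - 1)\<bar>
       \<le> (3 * x + 4 * N * x\<^sup>2) * exp (- (N * x / 6))"
proof -
  define s where "s = sin x"
  define b where "b = arsinh s"
  have s: "0 < s" "s \<le> x" "x / 3 \<le> s" "x - x ^ 3 / 6 \<le> s" "s \<le> 1"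
    using x sin_ge_third[of x] sin_ge_cubic[of x] sin_x_le_x[of x] by (auto simp: s_def intro: less_le_trans)
  have "s * (s * s) \<le> s * (1 * 1)" using s by (intro mult_mono) auto
  then have "s ^ 3 \<le> s" by (simp add: power3_eq_cube mult.assoc)
  then have "s / 2 \<le> b" using arsinh_ge_cubic[of s] s(1) unfolding b_def by linarith
  then have b: "x / 6 \<le> b" using s(3) by linarith
  have bx: "b \<le> x" using arsinh_le[of s] s by (simp add: b_def)
  have "s ^ 3 \<le> x ^ 3" using s by (intro power_mono) auto
  moreover have "0 \<le> x ^ 3" using x by simp
  ultimately have diff: "x - b \<le> x ^ 3" using arsinh_ge_cubic[of s] s unfolding b_def by linarith
  have A1: "1 \<le> 2 * N * b" 
  proof -
    have "N * (x / 6) \<le> N * b" using b N by (intro mult_left_mono) auto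
    then have "N * x / 6 \<le> N * b" by simp
    then show ?thesis using N(2) by linarith
  qed
  have AB: "2 * N * b \<le> 2 * N * x" using bx N by (intro mult_left_mono) auto
  define E where "E = exp (2 * N * b) - 1"
  have "exp (N * x / 6) \<le> exp (2 * N * b / 2)" using b N by simp
  also have "\<dots> \<le> E" unfolding E_def by (rule exp_minus_one_ge[OF A1])
  finally have E: "exp (N * x / 6) \<le> E" .
  then have E0: "E > 0" using exp_gt_zero less_le_trans by blast
  have iE: "1 / E \<le> exp (- (N * x / 6))"
    using E E0 by (simp add: exp_minus field_simps)
  have "row_weight x / E - 1 / x / (exp (2 * N * x) - 1) = (row_weight x - 1 / x) * (1 / E) + 1 / x * (1 / E - 1 / (exp (2 * N * x) - 1))"
    by (simp add: algebra_simps diff_divide_distrib)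
  also have "\<bar>\<dots>\<bar> \<le> \<bar>row_weight x - 1 / x\<bar> * (1 / E) + 1 / x * \<bar>1 / E - 1 / (exp (2 * N * x) - 1)\<bar>"
  proof (rule order_trans[OF abs_triangle_ineq])
    show "\<bar>(row_weight x - 1 / x) * (1 / E)\<bar> + \<bar>1 / x * (1 / E - 1 / (exp (2 * N * x) - 1))\<bar>
       \<le> \<bar>row_weight x - 1 / x\<bar> * (1 / E) + 1 / x * \<bar>1 / E - 1 / (exp (2 * N * x) - 1)\<bar>"
      unfolding abs_mult using E0 x by simp
  qed
  also have "\<dots> \<le> 3 * x * (1 / E) + 1 / x * (2 * (2 * N * x - 2 * N * b) / E)"
  proof (intro add_mono mult_mono)
    show "\<bar>row_weight x - 1 / x\<bar> \<le> 3 * x" using row_weight_near_inverse[OF x] .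
    show "\<bar>1 / E - 1 / (exp (2 * N * x) - 1)\<bar> \<le> 2 * (2 * N * x - 2 * N * b) / E"
      unfolding E_def using A1 AB by (intro inverse_exp_minus_one_diff_le) auto
  qed (use E0 x in auto)
  also have "2 * (2 * N * x - 2 * N * b) = 4 * N * (x - b)"
    by (simp add: algebra_simps)
  also have "1 / x * (4 * N * (x - b) / E) = (4 * N * (x - b) / x) * (1 / E)"
    by simp
  also have "\<dots> \<le> (4 * N * x\<^sup>2) * (1 / E)"
  proof (rule mult_right_mono)
    have "4 * N * (x - b) \<le> 4 * N * x ^ 3" using diff N by (intro mult_left_mono) auto
    then show "4 * N * (x - b) / x \<le> 4 * N * x\<^sup>2" using x by (simp add: divide_le_eq power2_eq_square power3_eq_cube)
  qed (use E0 in simp)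
  also have "3 * x * (1 / E) + (4 * N * x\<^sup>2) * (1 / E) = (3 * x + 4 * N * x\<^sup>2) * (1 / E)"
    by (simp add: algebra_simps)
  also have "\<dots> \<le> (3 * x + 4 * N * x\<^sup>2) * exp (- (N * x / 6))"
    using x N iE by (intro mult_left_mono) auto
  finally show ?thesis unfolding E_def b_def s_def by simp
qed

lemma square_exp_decay: "0 \<le> y \<Longrightarrow> y\<^sup>2 * exp (- (y / 3)) \<le> 72 * exp (- (y / 6 :: real))"
proof -
  assume y: "0 \<le> y"
  have "1 + y / 6 + (y / 6)\<^sup>2 / 2 \<le> exp (y / 6)" by (rule exp_lower_Taylor_quadratic) (use y in simp)
  then have "y\<^sup>2 \<le> 72 * exp (y / 6)" using y by (simp add: power2_eq_square field_simps)
  then have "y\<^sup>2 * exp (- (y / 3)) \<le> 72 * exp (y / 6) * exp (- (y / 3))" by (intro mult_right_mono) auto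
  also have "\<dots> = 72 * exp (- (y / 6))" by (simp add: mult.assoc exp_add[symmetric])
  finally show ?thesis .
qed

text \<open>
  Row j contributes n times the row weight times 1 + 2 / (exp (2 n b) - 1); this is half of the row
  weight times the second summand.
\<close>
definition coth_excess :: "nat \<Rightarrow> nat \<Rightarrow> real" where
  "coth_excess n j = row_weight (pi * real j / real n) / (exp (2 * real n * arsinh (sin (pi * real j / real n))) - 1)"

text \<open>
  The same term with sine, arsinh and row weight replaced by their leading behaviour at 0.
\<close>
definition coth_excess_limit :: "nat \<Rightarrow> nat \<Rightarrow> real" where
  "coth_excess_limit n j = real n / (pi * real j) / (exp (2 * pi * real j) - 1)"

text \<open>
  In the half of the range where n \<le> 2 j, powers of n are absorbed by the exponential.
\<close>
lemma coth_excess_limit_tail: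
  assumes "0 < j" "n \<le> 2 * j"
  shows "real n * coth_excess_limit n j \<le> 144 * exp (- (real j / 6))" and "0 \<le> coth_excess_limit n j"
proof -
  have j: "real j \<ge> 1" using assms by simp
  have pj: "2 * pi * real j \<ge> 4 * real j" using j pi_ge_two by (intro mult_right_mono) auto
  have "exp (real j / 3) \<le> exp (2 * pi * real j / 2)" using pj j by simp
  also have "\<dots> \<le> exp (2 * pi * real j) - 1" by (rule exp_minus_one_ge) (use pj j in linarith)
  finally have e: "exp (real j / 3) \<le> exp (2 * pi * real j) - 1" .
  then have pos: "0 < exp (2 * pi * real j) - 1" using exp_gt_zero less_le_trans by blast
  show "0 \<le> coth_excess_limit n j" unfolding coth_excess_limit_def using pos by simp
  have "real n * real n \<le> (2 * real j) * (2 * real j)" using assms by (intro mult_mono) linarith+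
  also have "\<dots> = 4 * (real j * real j)" by simp
  also have "\<dots> \<le> 2 * (real j)\<^sup>2 * (pi * real j)"
  proof -
    have "2 * 1 \<le> pi * real j" using j pi_ge_two by (intro mult_mono) auto
    then have "2 * (real j * real j) * 2 \<le> 2 * (real j * real j) * (pi * real j)" by (intro mult_left_mono) auto
    then show ?thesis by (simp add: power2_eq_square)
  qed
  finally have "real n * real n / (pi * real j) \<le> 2 * (real j)\<^sup>2"
    using j by (simp add: divide_le_eq)
  then have "real n * real n / (pi * real j) / (exp (2 * pi * real j) - 1) \<le> 2 * (real j)\<^sup>2 / exp (real j / 3)"
    using e by (intro frac_le) auto
  also have "\<dots> = 2 * ((real j)\<^sup>2 * exp (- (real j / 3)))" by (simp only: exp_minus divide_inverse mult.assoc)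
  also have "\<dots> \<le> 2 * (72 * exp (- (real j / 6)))"
    by (intro mult_left_mono square_exp_decay) auto
  finally show "real n * coth_excess_limit n j \<le> 144 * exp (- (real j / 6))" by (simp add: coth_excess_limit_def)
qed

lemma coth_excess_symmetric: "j < n \<Longrightarrow> coth_excess n (n - j) = coth_excess n j"
proof -
  assume "j < n"
  then have "pi * real (n - j) / real n = pi - pi * real j / real n" by (simp add: of_nat_diff field_simps)
  then show ?thesis by (simp add: coth_excess_def row_weight_symmetric)
qed

lemma coth_excess_near_limit:
  assumes "0 < j" "2 * j \<le> n"
  shows "real n * \<bar>coth_excess n j - coth_excess_limit n j\<bar> \<le> 72 * (3 * pi + 4 * pi\<^sup>2) * exp (- (real j / 6))"
proof -
  define x where "x = pi * real j / real n"
  have j: "real j \<ge> 1" and n: "real n > 0" using assms by auto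
  have x: "0 < x" "real n * x = pi * real j" using j n by (simp_all add: x_def)
  have "real j * 2 \<le> real n" using assms by linarith
  then have x2: "x \<le> pi / 2" using n by (simp add: x_def field_simps)
  have "3 * 1 \<le> pi * real j" using j pi_gt3 by (intro mult_mono) auto
  then have n3: "3 \<le> real n * x" by (simp add: x)
  have "coth_excess n j - coth_excess_limit n j = row_weight x / (exp (2 * real n * arsinh (sin x)) - 1) - 1 / x / (exp (2 * real n * x) - 1)"
    using x n j by (simp add: coth_excess_def coth_excess_limit_def x_def)
  then have "\<bar>coth_excess n j - coth_excess_limit n j\<bar> \<le> (3 * x + 4 * real n * x\<^sup>2) * exp (- (real n * x / 6))"
    using tail_term_bound[OF x(1) x2 n n3] by simp
  then have "real n * \<bar>coth_excess n j - coth_excess_limit n j\<bar> \<le> real n * ((3 * x + 4 * real n * x\<^sup>2) * exp (- (real n * x / 6)))"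
    by (rule mult_left_mono) simp
  also have "\<dots> = (3 * (real n * x) + 4 * (real n * x)\<^sup>2) * exp (- (real n * x / 6))"
    by (simp add: power2_eq_square algebra_simps)
  also have "\<dots> = (3 * pi * real j + 4 * pi\<^sup>2 * (real j)\<^sup>2) * exp (- (pi * real j / 6))"
    unfolding x(2) by (simp add: power_mult_distrib)
  also have "\<dots> \<le> (3 * pi * (real j)\<^sup>2 + 4 * pi\<^sup>2 * (real j)\<^sup>2) * exp (- (real j / 3))"
  proof (rule mult_mono)
    show "3 * pi * real j + 4 * pi\<^sup>2 * (real j)\<^sup>2 \<le> 3 * pi * (real j)\<^sup>2 + 4 * pi\<^sup>2 * (real j)\<^sup>2"
      using j by (simp add: power2_eq_square)
    show "exp (- (pi * real j / 6)) \<le> exp (- (real j / 3))" using j pi_ge_two by simp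
  qed auto
  also have "\<dots> = (3 * pi + 4 * pi\<^sup>2) * ((real j)\<^sup>2 * exp (- (real j / 3)))" by (simp add: algebra_simps)
  also have "\<dots> \<le> (3 * pi + 4 * pi\<^sup>2) * (72 * exp (- (real j / 6)))"
    by (intro mult_left_mono square_exp_decay) auto
  finally show ?thesis by (simp only: ac_simps)
qed

text \<open>
  The excess is symmetric under j to n - j and matters at both ends of the range, so it is compared
  with the sum of two limit terms, one for each end. These add up to twice a partial sum of the series
  S, whose remainder is exponentially small in n.
\<close>
lemma sum_coth_excess_asymptotics:
  assumes S: "(\<lambda>j. 1 / (real (Suc j) * (exp (2 * pi * real (Suc j)) - 1))) sums S"
  obtains C where "\<And>n. n > 0 \<Longrightarrow> \<bar>2 * real n * (\<Sum>j=1..<n. coth_excess n j) - 4 / pi * (real n)\<^sup>2 * S\<bar> \<le> C"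
proof -
  define e where "e = (\<lambda>j::nat. exp (- (real j / 6)))"
  define K where "K = 72 * (3 * pi + 4 * pi\<^sup>2) + 144"
  define B where "B = (\<Sum>j. e j)"
  have K0: "K \<ge> 0" by (simp add: K_def)
  have e_pow: "e = (\<lambda>j. exp (- 1 / 6) ^ j)"
    by (rule ext) (simp add: e_def exp_of_nat_mult[symmetric])
  have e_sum: "summable e" unfolding e_pow by (rule summable_geometric) simp
  have e0: "e j > 0" for j by (simp add: e_def)
  have part: "(\<Sum>j\<in>A. e j) \<le> B" if "finite A" for A
    unfolding B_def by (rule sum_le_suminf[OF e_sum that]) (use e0 less_imp_le in blast)
  \<comment> \<open>for j in the left half, the limit term of the right end is negligible\<close>
  have half: "real n * \<bar>coth_excess n j - (coth_excess_limit n j + coth_excess_limit n (n - j))\<bar> \<le> K * (e j + e (n - j))"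
    if j: "0 < j" "j < n" "2 * j \<le> n" for j n
  proof -
    have "real n * \<bar>coth_excess n j - (coth_excess_limit n j + coth_excess_limit n (n - j))\<bar>
       \<le> real n * (\<bar>coth_excess n j - coth_excess_limit n j\<bar> + \<bar>coth_excess_limit n (n - j)\<bar>)"
      by (rule mult_left_mono) linarith+
    also have "\<dots> = real n * \<bar>coth_excess n j - coth_excess_limit n j\<bar> + real n * coth_excess_limit n (n - j)"
      using coth_excess_limit_tail(2)[of "n - j" n] j by (simp add: distrib_left)
    also have "\<dots> \<le> 72 * (3 * pi + 4 * pi\<^sup>2) * e j + 144 * e (n - j)"
      unfolding e_def using j by (intro add_mono coth_excess_near_limit coth_excess_limit_tail(1)) auto
    also have "\<dots> \<le> K * e j + K * e (n - j)"
      using e0[of j] e0[of "n - j"] by (intro add_mono mult_right_mono) (auto simp: K_def)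
    finally show ?thesis by (simp add: distrib_left)
  qed
  have term_bound: "real n * \<bar>coth_excess n j - (coth_excess_limit n j + coth_excess_limit n (n - j))\<bar> \<le> K * (e j + e (n - j))"
    if j: "j \<in> {1..<n}" for j n
  proof (cases "2 * j \<le> n")
    case True
    with j show ?thesis by (intro half) auto
  next
    case False
    have "real n * \<bar>coth_excess n (n - j) - (coth_excess_limit n (n - j) + coth_excess_limit n (n - (n - j)))\<bar> \<le> K * (e (n - j) + e (n - (n - j)))"
      using j False by (intro half) auto
    then show ?thesis using j by (simp add: coth_excess_symmetric add.commute)
  qed
  show ?thesis
  proof (rule that)
    fix n :: nat assume n: "n > 0"
    let ?t = "\<Sum>j=1..<n. coth_excess n j" and ?u = "\<Sum>j=1..<n. coth_excess_limit n j"
    have "(\<Sum>j=1..<n. coth_excess n j - (coth_excess_limit n j + coth_excess_limit n (n - j))) = ?t - 2 * ?u"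
      using sum_reverse_inner[of "coth_excess_limit n" n] by (simp add: sum_subtractf sum.distrib)
    then have "real n * \<bar>?t - 2 * ?u\<bar> \<le> real n * (\<Sum>j=1..<n. \<bar>coth_excess n j - (coth_excess_limit n j + coth_excess_limit n (n - j))\<bar>)"
      using sum_abs[of "\<lambda>j. coth_excess n j - (coth_excess_limit n j + coth_excess_limit n (n - j))" "{1..<n}"]
      by (intro mult_left_mono) auto
    also have "\<dots> = (\<Sum>j=1..<n. real n * \<bar>coth_excess n j - (coth_excess_limit n j + coth_excess_limit n (n - j))\<bar>)"
      by (rule sum_distrib_left)
    also have "\<dots> \<le> (\<Sum>j=1..<n. K * (e j + e (n - j)))"
      by (rule sum_mono) (rule term_bound)
    also have "\<dots> = 2 * K * (\<Sum>j=1..<n. e j)"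
      using sum_reverse_inner[of e n] by (simp add: sum_distrib_left[symmetric] sum.distrib)
    also have "\<dots> \<le> 2 * K * B" using K0 by (intro mult_left_mono part) auto
    finally have 1: "real n * \<bar>?t - 2 * ?u\<bar> \<le> 2 * K * B" .
    define a where "a = (\<lambda>j. (real n)\<^sup>2 / pi * (1 / (real (Suc j) * (exp (2 * pi * real (Suc j)) - 1))))"
    have a_eq: "a j = real n * coth_excess_limit n (Suc j)" for j
      by (simp add: a_def coth_excess_limit_def power2_eq_square)
    have a: "a sums ((real n)\<^sup>2 / pi * S)" unfolding a_def by (rule sums_mult[OF S])
    have u: "(\<Sum>j<n - 1. a j) = real n * ?u"
      unfolding a_eq sum_distrib_left
      by (rule sum.reindex_bij_witness[of _ "\<lambda>j. j - 1" Suc]) auto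
    have tail: "(\<lambda>j. a (j + (n - 1))) sums ((real n)\<^sup>2 / pi * S - real n * ?u)"
      using sums_split_initial_segment[OF a, of "n - 1"] unfolding u .
    have bnd: "0 \<le> a (j + (n - 1))" "a (j + (n - 1)) \<le> 144 * e j" for j
    proof -
      have "a (j + (n - 1)) \<le> 144 * e (Suc (j + (n - 1)))"
        unfolding a_eq e_def by (rule coth_excess_limit_tail(1)) (use n in auto)
      also have "\<dots> \<le> 144 * e j" by (simp add: e_def)
      finally show "a (j + (n - 1)) \<le> 144 * e j" .
      show "0 \<le> a (j + (n - 1))"
        unfolding a_eq by (intro mult_nonneg_nonneg coth_excess_limit_tail(2)) (use n in auto)
    qed
    have "(real n)\<^sup>2 / pi * S - real n * ?u \<le> 144 * B"
      using sums_le[OF bnd(2) tail] summable_sums[OF summable_mult[OF e_sum, of 144]] 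
      unfolding B_def suminf_mult[OF e_sum] by blast
    moreover have "0 \<le> (real n)\<^sup>2 / pi * S - real n * ?u"
      using sums_le[OF bnd(1) sums_zero tail] .
    ultimately have 2: "\<bar>real n * ?u - (real n)\<^sup>2 / pi * S\<bar> \<le> 144 * B" by linarith
    have "2 * real n * ?t - 4 / pi * (real n)\<^sup>2 * S = 2 * (real n * (?t - 2 * ?u)) + 4 * (real n * ?u - (real n)\<^sup>2 / pi * S)"
      by (simp add: algebra_simps)
    also have "\<bar>\<dots>\<bar> \<le> 2 * \<bar>real n * (?t - 2 * ?u)\<bar> + 4 * \<bar>real n * ?u - (real n)\<^sup>2 / pi * S\<bar>"
    proof -
      have "\<bar>2 * y + 4 * z\<bar> \<le> 2 * \<bar>y\<bar> + 4 * \<bar>z\<bar>" for y z :: real by linarith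
      then show ?thesis by blast
    qed
    also have "\<dots> \<le> 2 * (2 * K * B) + 4 * (144 * B)"
      using 1 2 by (intro add_mono mult_left_mono) (simp_all add: abs_mult)
    finally show "\<bar>2 * real n * ?t - 4 / pi * (real n)\<^sup>2 * S\<bar> \<le> 2 * (2 * K * B) + 4 * (144 * B)" .
  qed
qed

section \<open>The expansion\<close>

theorem theorem1:
  shows "(\<lambda>n::nat. F_sq n -
            ((2 / pi) * (real n)\<^sup>2 * ln (real n)
             + (2 / pi) * (euler_mascheroni + ln (4 * sqrt (2 * pi) / (Gamma (1 / 4 :: real))\<^sup>2))
                 * (real n)\<^sup>2))
         \<in> O(\<lambda>_. 1)"
proof -
  let ?G = "(Gamma (1 / 4 :: real))\<^sup>2"
  define S where "S = - ln (euler_product (2 * pi))"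
  have G: "?G > 0" by (simp add: Gamma_real_pos less_imp_neq[symmetric])
  have "(\<lambda>j. 1 / (real (Suc j) * (exp (2 * pi * real (Suc j)) - 1))) sums S"
    unfolding S_def by (rule ln_euler_product_series) simp
  then obtain C2 where C2: "\<And>n. n > 0 \<Longrightarrow> \<bar>2 * real n * (\<Sum>j=1..<n. coth_excess n j) - 4 / pi * (real n)\<^sup>2 * S\<bar> \<le> C2"
    using sum_coth_excess_asymptotics by blast
  obtain C1 where C1: "\<And>n. n > 0 \<Longrightarrow>
    \<bar>real n * (\<Sum>j=1..<n. row_weight (pi * real j / real n)) - 2 / pi * (real n)\<^sup>2 * (ln (real n) + euler_mascheroni + ln (sqrt 2 / pi))\<bar> \<le> C1"
    using sum_row_weight_asymptotics by blast
  have S: "S = - (pi / 12) - (ln ?G - ln 4 - ln pi - ln pi / 2) / 2"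
  proof -
    have "S = - (pi / 12) - ln (?G / (4 * pi * sqrt pi)) / 2"
      unfolding S_def euler_product_2pi using G by (subst ln_mult_pos) (simp_all add: ln_sqrt)
    also have "ln (?G / (4 * pi * sqrt pi)) = ln ?G - ln 4 - ln pi - ln pi / 2"
      using G by (simp add: ln_div ln_mult_pos ln_sqrt)
    finally show ?thesis .
  qed
  have K: "ln (4 * sqrt (2 * pi) / ?G) = ln 4 + (ln 2 + ln pi) / 2 - ln ?G"
    using G by (simp add: ln_div ln_mult_pos ln_sqrt)
  have K2: "ln (sqrt 2 / pi) = ln 2 / 2 - ln pi" by (simp add: ln_div ln_sqrt)
  have bound: "\<bar>F_sq n - ((2 / pi) * (real n)\<^sup>2 * ln (real n) + (2 / pi) * (euler_mascheroni + ln (4 * sqrt (2 * pi) / ?G)) * (real n)\<^sup>2)\<bar>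
      \<le> 1 / 3 + C1 + C2" if n: "n > 0" for n
  proof -
    let ?m = "2 / pi * (real n)\<^sup>2 * (ln (real n) + euler_mascheroni + ln (sqrt 2 / pi))" and ?b = "4 / pi * (real n)\<^sup>2 * S"
    let ?g = "real n * (\<Sum>j=1..<n. row_weight (pi * real j / real n))" and ?t = "2 * real n * (\<Sum>j=1..<n. coth_excess n j)"
    have "F_sq n = ((real n)\<^sup>2 - 1) / 3 + ?g + ?t"
      unfolding coth_excess_def by (rule F_sq_decomposition[OF n])
    \<comment> \<open>the term pi / 12 of ln E cancels n^2 / 3\<close>
    moreover have "(real n)\<^sup>2 / 3 + ?m + ?b = (2 / pi) * (real n)\<^sup>2 * ln (real n) + (2 / pi) * (euler_mascheroni + ln (4 * sqrt (2 * pi) / ?G)) * (real n)\<^sup>2"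
      unfolding S K K2 by (simp add: field_simps)
    ultimately have "F_sq n - ((2 / pi) * (real n)\<^sup>2 * ln (real n) + (2 / pi) * (euler_mascheroni + ln (4 * sqrt (2 * pi) / ?G)) * (real n)\<^sup>2)
       = - (1 / 3) + (?g - ?m) + (?t - ?b)" by (simp add: diff_divide_distrib)
    moreover have "\<bar>d\<bar> \<le> 1 / 3 + C1 + C2" if "d = - (1 / 3) + x + y" "\<bar>x\<bar> \<le> C1" "\<bar>y\<bar> \<le> C2" for d x y :: real
      using that by linarith
    ultimately show ?thesis using C1[OF n] C2[OF n] by blast
  qed
  show ?thesis
  proof (rule bigoI[of _ "1 / 3 + C1 + C2"])
    show "\<forall>\<^sub>F n in sequentially. norm (F_sq n - ((2 / pi) * (real n)\<^sup>2 * ln (real n) + (2 / pi) * (euler_mascheroni + ln (4 * sqrt (2 * pi) / ?G)) * (real n)\<^sup>2))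
       \<le> (1 / 3 + C1 + C2) * norm (1 :: real)"
      using eventually_gt_at_top[of 0] by eventually_elim (use bound in simp)
  qed
qed

end
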